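(* Let $k$ be a field and let $u>v$ be squarefree monomials of degree $2$ in $k[x_1,\dots,x_n]$, with $u=x_ix_j$, $i<j$. Let $\Delta$ be the simplicial complex on $[n]$ with Stanley-Reisner ideal $I_\Delta=(L(u,v))$. Let $\Delta_1$ be the simplex on $[i-1]=\{1,\dots,i-1\}$ and let $\Delta_2$ be the simplicial complex on $\{i,\dots,n\}$ whose Stanley-Reisner ideal is the ideal generated by $L(u,v)$ in $k[x_i,\dots,x_n]$, so that $\Delta=\Delta_1\ast\Delta_2$. Assume that $\Delta$ is not Cohen-Macaulay (over $k$). Then the following statements are equivalent: (1) $\Delta$ is Buchsbaum (over $k$); (2) one of the following conditions holds: (a) $u=x_1x_{n-2}$, $v=x_{n-2}x_{n-1}$, $n>4$; (b) $u=x_1x_{n-1}$, $v=x_{n-2}x_n$, $n>3$; (3) $\Delta_1=\emptyset$ and $\Delta_2$ is pure. Furthermore, if any of these equivalent conditions holds, then $\Delta$ is disconnected.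
   Context: $R=k[x_1,\dots,x_n]$ is a polynomial ring with standard grading, $M_2$ is the set of all squarefree monomials of degree $2$ in $R$, and monomials are ordered lexicographically with $x_1>x_2>\cdots>x_n$. For $u\ge v$ in $M_2$, $L(u,v)=\{w\in M_2 : u\ge w\ge v\}$, and $(L(u,v))$ is the ideal of $R$ it generates. For a simplicial complex $\Delta$, $I_\Delta$ is its Stanley-Reisner ideal and $k[\Delta]$ its Stanley-Reisner ring; $\Delta$ is Cohen-Macaulay, respectively Buchsbaum (over $k$), if $k[\Delta]$ is. Equivalently, $\Delta$ is Buchsbaum if and only if it is pure and $\mathrm{lk}_\Delta(F)$ is Cohen-Macaulay over $k$ for all $F\in\Delta$ with $\#F\ge1$, where $\mathrm{lk}_\Delta(F)=\{G\in\Delta : G\cup F\in\Delta,\ G\cap F=\varnothing\}$. $\ast$ denotes the join of simplicial complexes. $\Delta_1=\emptyset$ means that $i=1$, in which case $\Delta_1$ has no vertices and $\Delta=\Delta_2$. *)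

theory Defs
  imports
    "HOL-Library.Poly_Mapping"
    "HOL-Library.Extended_Nat"
    "HOL-Algebra.QuotRing"
begin

section \<open>Commutative algebra\<close>

text \<open>
  The chains of prime ideals \<open>p 0 \<subset> \<dots> \<subset> p r\<close> have length \<open>r\<close>. On the zero ring this function
  returns 0; it is only used for local rings.
\<close>

definition krull_dim :: "('a, 'b) ring_scheme \<Rightarrow> enat" where
  "krull_dim A = (SUP r \<in> {r. \<exists>p :: nat \<Rightarrow> 'a set.
       (\<forall>i\<le>r. primeideal (p i) A) \<and> (\<forall>i<r. p i \<subset> p (Suc i))}. enat r)"

definition local_ring :: "('a, 'b) ring_scheme \<Rightarrow> 'a set \<Rightarrow> bool" where
  "local_ring A M \<longleftrightarrow> cring A \<and> {I. maximalideal I A} = {M}"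

definition colon_ideal :: "('a, 'b) ring_scheme \<Rightarrow> 'a set \<Rightarrow> 'a set \<Rightarrow> 'a set" where
  "colon_ideal A I S = {a \<in> carrier A. \<forall>s\<in>S. s \<otimes>\<^bsub>A\<^esub> a \<in> I}"

definition regular_sequence :: "('a, 'b) ring_scheme \<Rightarrow> 'a list \<Rightarrow> bool" where
  "regular_sequence A xs \<longleftrightarrow>
     set xs \<subseteq> carrier A \<and> Idl\<^bsub>A\<^esub> (set xs) \<noteq> carrier A \<and>
     (\<forall>i<length xs. \<forall>a\<in>carrier A.
        xs ! i \<otimes>\<^bsub>A\<^esub> a \<in> Idl\<^bsub>A\<^esub> (set (take i xs)) \<longrightarrow> a \<in> Idl\<^bsub>A\<^esub> (set (take i xs)))"

definition ideal_depth :: "('a, 'b) ring_scheme \<Rightarrow> 'a set \<Rightarrow> enat" where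
  "ideal_depth A M = (SUP xs \<in> {xs. set xs \<subseteq> M \<and> regular_sequence A xs}. enat (length xs))"

definition system_of_parameters :: "('a, 'b) ring_scheme \<Rightarrow> 'a set \<Rightarrow> 'a list \<Rightarrow> bool" where
  "system_of_parameters A M xs \<longleftrightarrow>
     set xs \<subseteq> M \<and> enat (length xs) = krull_dim A \<and>
     (\<forall>a\<in>M. \<exists>r::nat. a [^]\<^bsub>A\<^esub> r \<in> Idl\<^bsub>A\<^esub> (set xs))"

definition weak_sequence :: "('a, 'b) ring_scheme \<Rightarrow> 'a set \<Rightarrow> 'a list \<Rightarrow> bool" where
  "weak_sequence A M xs \<longleftrightarrow>
     (\<forall>i<length xs. colon_ideal A (Idl\<^bsub>A\<^esub> (set (take i xs))) {xs ! i} =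
                    colon_ideal A (Idl\<^bsub>A\<^esub> (set (take i xs))) M)"

text \<open>
  The Cohen-Macaulay and Buchsbaum properties are notions for Noetherian rings. The predicates
  below do not repeat that standing assumption; they are only applied to finitely generated
  algebras over a field and to localizations of these.
\<close>

definition cohen_macaulay_local :: "('a, 'b) ring_scheme \<Rightarrow> bool" where
  "cohen_macaulay_local A \<longleftrightarrow> (\<exists>M. local_ring A M \<and> ideal_depth A M = krull_dim A)"

definition buchsbaum_local :: "('a, 'b) ring_scheme \<Rightarrow> bool" where
  "buchsbaum_local A \<longleftrightarrow> (\<exists>M. local_ring A M \<and>
     (\<forall>xs. system_of_parameters A M xs \<longrightarrow> weak_sequence A M xs))"

text \<open>
  A fraction \<open>a / s\<close> is the class of all pairs \<open>(b, t)\<close> with \<open>w (t a - s b) = 0\<close> for some \<open>w \<in> S\<close>.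
  The unions in the ring operations range over representatives and do not depend on them when
  \<open>S\<close> is multiplicatively closed.
\<close>

definition fraction :: "('a, 'b) ring_scheme \<Rightarrow> 'a set \<Rightarrow> 'a \<Rightarrow> 'a \<Rightarrow> ('a \<times> 'a) set" where
  "fraction A S a s =
     {(b, t). b \<in> carrier A \<and> t \<in> S \<and>
              (\<exists>w\<in>S. w \<otimes>\<^bsub>A\<^esub> (t \<otimes>\<^bsub>A\<^esub> a) = w \<otimes>\<^bsub>A\<^esub> (s \<otimes>\<^bsub>A\<^esub> b))}"

definition localization :: "('a, 'b) ring_scheme \<Rightarrow> 'a set \<Rightarrow> ('a \<times> 'a) set ring" where
  "localization A S =
     \<lparr>carrier = {fraction A S a s | a s. a \<in> carrier A \<and> s \<in> S},
      mult = (\<lambda>X Y. \<Union>(a, s)\<in>X. \<Union>(b, t)\<in>Y. fraction A S (a \<otimes>\<^bsub>A\<^esub> b) (s \<otimes>\<^bsub>A\<^esub> t)),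
      one = fraction A S \<one>\<^bsub>A\<^esub> \<one>\<^bsub>A\<^esub>,
      zero = fraction A S \<zero>\<^bsub>A\<^esub> \<one>\<^bsub>A\<^esub>,
      add = (\<lambda>X Y. \<Union>(a, s)\<in>X. \<Union>(b, t)\<in>Y.
               fraction A S ((t \<otimes>\<^bsub>A\<^esub> a) \<oplus>\<^bsub>A\<^esub> (s \<otimes>\<^bsub>A\<^esub> b)) (s \<otimes>\<^bsub>A\<^esub> t))\<rparr>"

text \<open>
  A ring that need not be local is Cohen-Macaulay (Buchsbaum) if its localizations at all maximal
  ideals are.
\<close>

definition cohen_macaulay_ring :: "('a, 'b) ring_scheme \<Rightarrow> bool" where
  "cohen_macaulay_ring A \<longleftrightarrow>
     (\<forall>P. maximalideal P A \<longrightarrow> cohen_macaulay_local (localization A (carrier A - P)))"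

definition buchsbaum_ring :: "('a, 'b) ring_scheme \<Rightarrow> bool" where
  "buchsbaum_ring A \<longleftrightarrow>
     (\<forall>P. maximalideal P A \<longrightarrow> buchsbaum_local (localization A (carrier A - P)))"

section \<open>Polynomial rings, monomials and lexsegments\<close>

text \<open>
  A monomial is identified with its exponent vector, of type \<^typ>\<open>nat \<Rightarrow>\<^sub>0 nat\<close>, so the product of
  monomials is written additively and the variable \<open>x\<^sub>i\<close> is \<open>X i\<close>. The linear order that
  \<^theory>\<open>HOL-Library.Poly_Mapping\<close> puts on exponent vectors compares them at the first index where
  they differ; this is the lexicographic order with \<open>X 1 > X 2 > \<dots>\<close>.
\<close>

type_synonym monomial = "nat \<Rightarrow>\<^sub>0 nat"

abbreviation X :: "nat \<Rightarrow> monomial" where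
  "X i \<equiv> Poly_Mapping.single i 1"

definition mpoly_ring :: "nat set \<Rightarrow> (monomial \<Rightarrow>\<^sub>0 'k::field) ring" where
  "mpoly_ring V =
     \<lparr>carrier = {p. \<forall>m\<in>Poly_Mapping.keys p. Poly_Mapping.keys m \<subseteq> V},
      mult = (*), one = 1, zero = 0, add = (+)\<rparr>"

definition monomial_ideal :: "nat set \<Rightarrow> monomial set \<Rightarrow> (monomial \<Rightarrow>\<^sub>0 'k::field) set" where
  "monomial_ideal V S = Idl\<^bsub>mpoly_ring V\<^esub> ((\<lambda>m. Poly_Mapping.single m 1) ` S)"

definition sqfree_monomials :: "nat set \<Rightarrow> nat \<Rightarrow> monomial set" where
  "sqfree_monomials V d =
     {m. Poly_Mapping.keys m \<subseteq> V \<and> (\<forall>i. Poly_Mapping.lookup m i \<le> 1) \<and>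
         (\<Sum>i\<in>Poly_Mapping.keys m. Poly_Mapping.lookup m i) = d}"

definition lexsegment :: "nat \<Rightarrow> monomial \<Rightarrow> monomial \<Rightarrow> monomial set" where
  "lexsegment n u v = {w \<in> sqfree_monomials {1..n} 2. v \<le> w \<and> w \<le> u}"

section \<open>Simplicial complexes\<close>

text \<open>
  The elements of \<open>V\<close> need not all be vertices. The complex without vertices is \<open>{{}}\<close>.
\<close>

definition simplicial_complex :: "nat set \<Rightarrow> nat set set \<Rightarrow> bool" where
  "simplicial_complex V \<Delta> \<longleftrightarrow>
     \<Delta> \<subseteq> Pow V \<and> {} \<in> \<Delta> \<and> (\<forall>F\<in>\<Delta>. \<forall>G. G \<subseteq> F \<longrightarrow> G \<in> \<Delta>)"

definition vertices :: "nat set set \<Rightarrow> nat set" where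
  "vertices \<Delta> = {x. {x} \<in> \<Delta>}"

definition facets :: "nat set set \<Rightarrow> nat set set" where
  "facets \<Delta> = {F \<in> \<Delta>. \<forall>G\<in>\<Delta>. F \<subseteq> G \<longrightarrow> G = F}"

definition pure_complex :: "nat set set \<Rightarrow> bool" where
  "pure_complex \<Delta> \<longleftrightarrow> (\<forall>F\<in>facets \<Delta>. \<forall>G\<in>facets \<Delta>. card F = card G)"

definition connected_complex :: "nat set set \<Rightarrow> bool" where
  "connected_complex \<Delta> \<longleftrightarrow>
     (\<forall>x\<in>vertices \<Delta>. \<forall>y\<in>vertices \<Delta>. (x, y) \<in> {(a, b). {a, b} \<in> \<Delta>}\<^sup>*)"

definition complex_join :: "nat set set \<Rightarrow> nat set set \<Rightarrow> nat set set" where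
  "complex_join \<Delta> \<Gamma> = {F \<union> G | F G. F \<in> \<Delta> \<and> G \<in> \<Gamma>}"

definition stanley_reisner_ideal :: "nat set \<Rightarrow> nat set set \<Rightarrow> (monomial \<Rightarrow>\<^sub>0 'k::field) set" where
  "stanley_reisner_ideal V \<Delta> = monomial_ideal V {\<Sum>i\<in>F. X i | F. F \<subseteq> V \<and> F \<notin> \<Delta>}"

definition stanley_reisner_ring ::
    "nat set \<Rightarrow> nat set set \<Rightarrow> (monomial \<Rightarrow>\<^sub>0 'k::field) set ring" where
  "stanley_reisner_ring V \<Delta> = mpoly_ring V Quot stanley_reisner_ideal V \<Delta>"

definition cohen_macaulay_complex :: "'k::field itself \<Rightarrow> nat set \<Rightarrow> nat set set \<Rightarrow> bool" where
  "cohen_macaulay_complex _ V \<Delta> \<longleftrightarrow>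
     cohen_macaulay_ring (stanley_reisner_ring V \<Delta> :: (monomial \<Rightarrow>\<^sub>0 'k) set ring)"

definition buchsbaum_complex :: "'k::field itself \<Rightarrow> nat set \<Rightarrow> nat set set \<Rightarrow> bool" where
  "buchsbaum_complex _ V \<Delta> \<longleftrightarrow>
     buchsbaum_ring (stanley_reisner_ring V \<Delta> :: (monomial \<Rightarrow>\<^sub>0 'k) set ring)"

end

theory Submission
  imports Defs
    "HOL-Computational_Algebra.Polynomial"
    "HOL-Algebra.Ring_Divisibility"
begin

text \<open>
  The generators of the ideal are quadratic, so \<open>\<Delta>\<close> is the complex of independent sets of a graph,
  whose edges are the pairs \<open>{a, b}\<close> with \<open>x\<^sub>a x\<^sub>b\<close> in the segment from \<open>u = x\<^sub>i x\<^sub>j\<close> to \<open>v = x\<^sub>r x\<^sub>s\<close>.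
  Vertices before \<open>i\<close> occur in no generator; they are the cone points that form \<open>\<Delta>\<^sub>1\<close>.

  If \<open>\<Delta>\<^sub>2\<close> is pure, comparing the sizes of a few explicit facets leaves six shapes of \<open>(i, j, r, s)\<close>
  (\<open>pure_shapes\<close>). In one of them \<open>\<Delta>\<^sub>2\<close> consists of isolated points. In the other five \<open>\<Delta>\<close> is the join
  of a simplex with a graph of two stars, whose centres are \<open>i\<close> and \<open>n\<close> and whose leaves lie in between.
  In three shapes the stars share a leaf; in the remaining two, which for \<open>i = 1\<close> are conditions (a)
  and (b), they are disjoint. Sets of points and joins of a simplex with a connected bipartite graph
  are Cohen-Macaulay (\<open>cohen_macaulay_points\<close>, \<open>bipartite_join.cohen_macaulay\<close>) and so are excluded by
  hypothesis. Two disjoint connected bipartite graphs form a Buchsbaum complex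
  (\<open>buchsbaum_two_graphs\<close>), but a proper cone over a disconnected graph is not Buchsbaum
  (\<open>cone_over_disconnected_graph_not_buchsbaum\<close>), and neither is any complex that is not pure
  (\<open>not_pure_imp_not_buchsbaum\<close>). As \<open>\<Delta>\<close> is pure only if \<open>\<Delta>\<^sub>2\<close> is, the equivalences follow.

  The commutative algebra rests on three observations. First, an element of \<open>k[V]\<close> lies in the
  Stanley-Reisner ideal exactly if its restriction to every face, obtained by setting the variables
  outside the face to zero, vanishes (\<open>stanley_reisner_ideal_eq\<close>); so elements of the face ring can
  be compared, divided and glued facet by facet inside polynomial rings (\<open>glue_along_faces\<close>).
  Secondly, every maximal ideal of \<open>k[V]\<close> contains for each variable a nonzero polynomial in that
  variable alone (\<open>maximal_ideal_meets_coordinate_ring\<close>). These polynomials provide regular sequences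
  as if the maximal ideal were generated by the variables, over an arbitrary field and before
  localizing: a polynomial in a fresh variable is regular (\<open>nonzero_divisor_of_fresh_variable\<close>).
  Thirdly, dimension and depth are controlled by elementary means. Chains of primes over the ideal
  of a face are no longer than the face has vertices, since \<open>d + 1\<close> polynomials in \<open>d\<close> variables are
  algebraically dependent (\<open>prime_chain_length\<close>), and a regular sequence produces a chain of primes
  in every commutative ring (\<open>regular_sequence_imp_prime_chain\<close>).
\<close>

hide_const (open) up_ring.coeff up_ring.monom

section \<open>Polynomials in many variables\<close>

type_synonym 'k mpoly = "monomial \<Rightarrow>\<^sub>0 'k"

abbreviation keys :: "('a \<Rightarrow>\<^sub>0 'b::zero) \<Rightarrow> 'a set" where "keys \<equiv> Poly_Mapping.keys"
abbreviation lookup :: "('a \<Rightarrow>\<^sub>0 'b::zero) \<Rightarrow> 'a \<Rightarrow> 'b" where "lookup \<equiv> Poly_Mapping.lookup"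
abbreviation term_of :: "monomial \<Rightarrow> 'k \<Rightarrow> 'k::field mpoly" where "term_of \<equiv> Poly_Mapping.single"

definition cst :: "'k \<Rightarrow> 'k::field mpoly" where "cst c = term_of 0 c"
definition var :: "nat \<Rightarrow> 'k::field mpoly" where "var i = term_of (X i) 1"

definition Pol :: "nat set \<Rightarrow> 'k::field mpoly set" where
  "Pol V = {p. \<forall>m\<in>keys p. keys m \<subseteq> V}"

lemma Pol_iff: "p \<in> Pol V \<longleftrightarrow> (\<forall>m. lookup p m \<noteq> 0 \<longrightarrow> keys m \<subseteq> V)"
  by (auto simp: Pol_def lookup_not_eq_zero_eq_in_keys)

lemma keys_add_monomial: "keys (m + m') = keys m \<union> keys (m' :: monomial)"
  by (auto simp: in_keys_iff lookup_add)

lemma mpoly_sum_terms: "(\<Sum>m\<in>keys p. term_of m (lookup p m)) = (p :: 'k::field mpoly)"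
proof (rule poly_mapping_eqI)
  fix k
  have "(\<Sum>m\<in>keys p. lookup (term_of m (lookup p m)) k) = (\<Sum>m\<in>keys p. if m = k then lookup p k else 0)"
    by (rule sum.cong) (auto simp: lookup_single)
  also have "\<dots> = lookup p k" by (simp add: in_keys_iff)
  finally show "lookup (\<Sum>m\<in>keys p. term_of m (lookup p m)) k = lookup p k"
    by (simp add: lookup_sum)
qed

lemma cst_add: "cst (a + b) = cst a + cst b" by (simp add: cst_def single_add)
lemma cst_mult: "cst (a * b) = cst a * cst b" by (simp add: cst_def mult_single)
lemma cst_0 [simp]: "cst 0 = 0" by (simp add: cst_def)
lemma cst_1 [simp]: "cst 1 = 1" by (simp add: cst_def)

lemma Pol_0 [simp]: "0 \<in> Pol V" and Pol_1 [simp]: "1 \<in> Pol V"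
  and Pol_cst [simp]: "cst c \<in> Pol V"
  by (auto simp: Pol_def cst_def)

lemma Pol_term: "keys m \<subseteq> V \<Longrightarrow> term_of m c \<in> Pol V"
  by (auto simp: Pol_def)

lemma Pol_var [simp]: "i \<in> V \<Longrightarrow> var i \<in> Pol V"
  by (auto simp: Pol_def var_def)

lemma Pol_add [simp]: "p \<in> Pol V \<Longrightarrow> q \<in> Pol V \<Longrightarrow> p + q \<in> Pol V"
  using keys_add[of p q] by (auto simp: Pol_def)

lemma Pol_uminus [simp]: "p \<in> Pol V \<Longrightarrow> - p \<in> Pol V"
  by (auto simp: Pol_def in_keys_iff)

lemma Pol_diff [simp]: "p \<in> Pol V \<Longrightarrow> q \<in> Pol V \<Longrightarrow> p - q \<in> Pol V"
  using Pol_add[of p V "-q"] by simp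

lemma Pol_mult [simp]: "p \<in> Pol V \<Longrightarrow> q \<in> Pol V \<Longrightarrow> p * q \<in> Pol V"
  using keys_mult[of p q] by (fastforce simp: Pol_def keys_add_monomial)

lemma Pol_power [simp]: "p \<in> Pol V \<Longrightarrow> p ^ n \<in> Pol V"
  by (induction n) auto

lemma Pol_sum [intro]: "(\<And>i. i \<in> A \<Longrightarrow> f i \<in> Pol V) \<Longrightarrow> sum f A \<in> Pol V"
  by (induction A rule: infinite_finite_induct) auto

lemma Pol_prod [intro]: "(\<And>i. i \<in> A \<Longrightarrow> f i \<in> Pol V) \<Longrightarrow> prod f A \<in> Pol V"
  by (induction A rule: infinite_finite_induct) auto

lemma Pol_mono: "V \<subseteq> W \<Longrightarrow> p \<in> Pol V \<Longrightarrow> p \<in> Pol W"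
  by (auto simp: Pol_def)

lemma Pol_empty: "p \<in> Pol {} \<Longrightarrow> \<exists>c. p = cst c"
proof -
  assume "p \<in> Pol {}"
  then have "lookup p m = 0" if "m \<noteq> 0" for m
    using that by (auto simp: Pol_def in_keys_iff)
  then have "p = cst (lookup p 0)"
    by (intro poly_mapping_eqI) (auto simp: cst_def lookup_single when_def)
  then show ?thesis ..
qed

text \<open>Setting variables to zero and expanding in powers of one variable are both homomorphisms
  that are determined by a homomorphism \<open>\<kappa>\<close> on coefficients and a multiplicative map \<open>\<chi>\<close> on
  monomials, so that additivity and multiplicativity need to be checked only once.\<close>

definition monomial_eval ::
    "('k::field \<Rightarrow> 'b::comm_ring_1) \<Rightarrow> (monomial \<Rightarrow> 'b) \<Rightarrow> 'k mpoly \<Rightarrow> 'b" where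
  "monomial_eval \<kappa> \<chi> p = (\<Sum>m\<in>keys p. \<kappa> (lookup p m) * \<chi> m)"

locale monomial_hom =
  fixes \<kappa> :: "'k::field \<Rightarrow> 'b::comm_ring_1" and \<chi> :: "monomial \<Rightarrow> 'b"
  assumes \<kappa>_0: "\<kappa> 0 = 0" and \<kappa>_1: "\<kappa> 1 = 1"
    and \<kappa>_add: "\<kappa> (a + b) = \<kappa> a + \<kappa> b" and \<kappa>_mult: "\<kappa> (a * b) = \<kappa> a * \<kappa> b"
    and \<chi>_0: "\<chi> 0 = 1" and \<chi>_add: "\<chi> (m + m') = \<chi> m * \<chi> m'"
begin

abbreviation "ev \<equiv> monomial_eval \<kappa> \<chi>"

lemma ev_superset: "finite K \<Longrightarrow> keys p \<subseteq> K \<Longrightarrow> ev p = (\<Sum>m\<in>K. \<kappa> (lookup p m) * \<chi> m)"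
  unfolding monomial_eval_def by (rule sum.mono_neutral_left) (auto simp: in_keys_iff \<kappa>_0)

lemma ev_add: "ev (p + q) = ev p + ev q"
proof -
  let ?K = "keys p \<union> keys q"
  have "ev (p + q) = (\<Sum>m\<in>?K. \<kappa> (lookup (p + q) m) * \<chi> m)"
    by (rule ev_superset) (auto simp: in_keys_iff lookup_add)
  also have "\<dots> = (\<Sum>m\<in>?K. \<kappa> (lookup p m) * \<chi> m) + (\<Sum>m\<in>?K. \<kappa> (lookup q m) * \<chi> m)"
    by (simp add: lookup_add \<kappa>_add algebra_simps sum.distrib)
  also have "\<dots> = ev p + ev q"
    by (simp add: ev_superset[of ?K])
  finally show ?thesis .
qed

lemma ev_0 [simp]: "ev 0 = 0" by (simp add: monomial_eval_def)

lemma ev_term: "ev (term_of m c) = \<kappa> c * \<chi> m"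
  by (simp add: monomial_eval_def \<kappa>_0)

lemma ev_1 [simp]: "ev 1 = 1"
  using ev_term[of 0 1] by (simp add: \<kappa>_1 \<chi>_0)

lemma ev_sum: "ev (sum f A) = (\<Sum>i\<in>A. ev (f i))"
  by (induction A rule: infinite_finite_induct) (auto simp: ev_add)

lemma ev_mult: "ev (p * q) = ev p * ev q"
proof -
  have "ev (p * q) = ev ((\<Sum>m\<in>keys p. term_of m (lookup p m)) * (\<Sum>m\<in>keys q. term_of m (lookup q m)))"
    by (simp add: mpoly_sum_terms)
  also have "\<dots> = (\<Sum>m\<in>keys p. \<Sum>m'\<in>keys q. \<kappa> (lookup p m) * \<chi> m * (\<kappa> (lookup q m') * \<chi> m'))"
    by (simp add: sum_product ev_sum mult_single ev_term \<kappa>_mult \<chi>_add mult_ac)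
  also have "\<dots> = ev p * ev q"
    by (simp add: monomial_eval_def sum_product)
  finally show ?thesis .
qed

lemma ev_uminus: "ev (- p) = - ev p"
  using ev_add[of p "-p"] by (simp add: add_eq_0_iff)

lemma ev_diff: "ev (p - q) = ev p - ev q"
  using ev_add[of p "-q"] by (simp add: ev_uminus)

lemma ev_power: "ev (p ^ n) = ev p ^ n"
  by (induction n) (auto simp: ev_mult)

end

subsection \<open>Setting variables to zero\<close>

definition res :: "nat set \<Rightarrow> 'k::field mpoly \<Rightarrow> 'k mpoly" where
  "res F = monomial_eval cst (\<lambda>m. if keys m \<subseteq> F then term_of m 1 else 0)"

interpretation res: monomial_hom cst "\<lambda>m. if keys m \<subseteq> F then term_of m 1 else 0" for F
  by unfold_locales (auto simp: cst_add cst_mult keys_add_monomial mult_single)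

lemmas res_add = res.ev_add[folded res_def] and res_mult = res.ev_mult[folded res_def]
  and res_diff = res.ev_diff[folded res_def] and res_0 [simp] = res.ev_0[folded res_def]
  and res_1 [simp] = res.ev_1[folded res_def] and res_sum = res.ev_sum[folded res_def]
  and res_power = res.ev_power[folded res_def] and res_uminus = res.ev_uminus[folded res_def]

lemma res_term: "res F (term_of m c) = (if keys m \<subseteq> F then term_of m c else 0)"
  by (simp add: res_def res.ev_term cst_def mult_single)

lemma res_var: "res F (var i) = (if i \<in> F then var i else 0)"
  by (simp add: var_def res_term)

lemma lookup_res: "lookup (res F p) m = (if keys m \<subseteq> F then lookup p m else 0)"
proof -
  have "res F p = (\<Sum>k\<in>keys p. res F (term_of k (lookup p k)))"
    by (subst mpoly_sum_terms[of p, symmetric]) (simp add: res_sum)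
  then have "lookup (res F p) m = (\<Sum>k\<in>keys p. lookup (res F (term_of k (lookup p k))) m)"
    by (simp add: lookup_sum)
  also have "\<dots> = (\<Sum>k\<in>keys p. if k = m then (if keys m \<subseteq> F then lookup p m else 0) else 0)"
    by (rule sum.cong) (auto simp: res_term lookup_single)
  also have "\<dots> = (if keys m \<subseteq> F then lookup p m else 0)" by (simp add: in_keys_iff)
  finally show ?thesis .
qed

lemma res_in_Pol [simp]: "res F p \<in> Pol F"
  by (simp add: Pol_iff lookup_res)

lemma res_id: "p \<in> Pol V \<Longrightarrow> V \<subseteq> F \<Longrightarrow> res F p = p"
  by (intro poly_mapping_eqI) (auto simp: lookup_res Pol_iff)

lemma res_res: "res F (res G p) = res (F \<inter> G) p"
  by (intro poly_mapping_eqI) (auto simp: lookup_res)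

subsection \<open>Expansion in powers of one variable\<close>

definition del :: "nat \<Rightarrow> monomial \<Rightarrow> monomial" where "del t m = Poly_Mapping.update t 0 m"

lemma lookup_del: "lookup (del t m) i = (if i = t then 0 else lookup m i)"
  by (simp add: del_def lookup_update)

lemma del_add_X: "del t m + Poly_Mapping.single t (lookup m t) = m"
  by (rule poly_mapping_eqI) (auto simp: lookup_add lookup_del lookup_single when_def)

text \<open>The coefficients of this expansion are polynomials without \<open>x\<^sub>t\<close>; they stay in the same type,
  so that they can be compared with elements of an ideal.\<close>

definition uni :: "nat \<Rightarrow> 'k::field mpoly \<Rightarrow> 'k mpoly poly" where
  "uni t = monomial_eval (\<lambda>c. [:cst c:]) (\<lambda>m. monom (term_of (del t m) 1) (lookup m t))"

interpretation uni: monomial_hom "\<lambda>c. [:cst c:]" "\<lambda>m. monom (term_of (del t m) 1) (lookup m t)" for t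
proof unfold_locales
  show "monom (term_of (del t 0) (1::'a)) (lookup 0 t) = 1"
  proof -
    have "del t 0 = 0" by (rule poly_mapping_eqI) (simp add: lookup_del)
    then show ?thesis by simp
  qed
  show "monom (term_of (del t (m + m')) (1::'a)) (lookup (m + m') t) =
          monom (term_of (del t m) 1) (lookup m t) * monom (term_of (del t m') 1) (lookup m' t)" for m m'
  proof -
    have "del t (m + m') = del t m + del t m'"
      by (rule poly_mapping_eqI) (simp add: lookup_del lookup_add)
    then show ?thesis by (simp add: mult_monom mult_single lookup_add)
  qed
qed (auto simp: cst_add cst_mult)

lemmas uni_add = uni.ev_add[folded uni_def] and uni_mult = uni.ev_mult[folded uni_def]
  and uni_1 [simp] = uni.ev_1[folded uni_def] and uni_0 [simp] = uni.ev_0[folded uni_def]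
  and uni_sum = uni.ev_sum[folded uni_def] and uni_diff = uni.ev_diff[folded uni_def]

lemma uni_term: "uni t (term_of m c) = monom (term_of (del t m) c) (lookup m t)"
  unfolding uni_def by (subst uni.ev_term) (simp add: cst_def mult_single smult_monom)

lemma uni_var: "uni t (var t) = [:0, 1:]"
proof -
  have "del t (X t) = 0" by (rule poly_mapping_eqI) (auto simp: lookup_del lookup_single)
  then show ?thesis by (simp add: var_def uni_term monom_altdef)
qed

lemma lookup_coeff_uni:
  "lookup (coeff (uni t p) e) m = (if t \<in> keys m then 0 else lookup p (m + Poly_Mapping.single t e))"
proof -
  have "uni t p = (\<Sum>k\<in>keys p. uni t (term_of k (lookup p k)))"
    by (subst mpoly_sum_terms[of p, symmetric]) (simp add: uni_sum)
  then have "lookup (coeff (uni t p) e) m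
      = (\<Sum>k\<in>keys p. lookup (coeff (uni t (term_of k (lookup p k))) e) m)"
    by (simp add: lookup_sum coeff_sum)
  also have "\<dots> = (\<Sum>k\<in>keys p. if k = m + Poly_Mapping.single t e
                   then (if t \<in> keys m then 0 else lookup p k) else 0)"
  proof (rule sum.cong)
    fix k assume "k \<in> keys p"
    have "t \<notin> keys (del t k)" by (simp add: in_keys_iff lookup_del)
    moreover have "del t k = m \<and> lookup k t = e \<longleftrightarrow> k = m + Poly_Mapping.single t e" if "t \<notin> keys m"
    proof
      assume "del t k = m \<and> lookup k t = e"
      then show "k = m + Poly_Mapping.single t e" using del_add_X[of t k] by auto
    next
      assume "k = m + Poly_Mapping.single t e"
      then show "del t k = m \<and> lookup k t = e"
        using that by (auto intro!: poly_mapping_eqI simp: lookup_del lookup_add lookup_single in_keys_iff when_def)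
    qed
    ultimately show "lookup (coeff (uni t (term_of k (lookup p k))) e) m
        = (if k = m + Poly_Mapping.single t e then (if t \<in> keys m then 0 else lookup p k) else 0)"
      by (auto simp: uni_term lookup_single when_def)
  qed simp
  also have "\<dots> = (if t \<in> keys m then 0 else lookup p (m + Poly_Mapping.single t e))"
    by (simp add: in_keys_iff)
  finally show ?thesis .
qed

lemma uni_expand: "p = (\<Sum>e\<le>degree (uni t p). coeff (uni t p) e * var t ^ e)"
proof -
  have *: "poly (uni t (term_of m c)) (var t) = term_of m (c::'a)" for m c
  proof -
    have "(var t :: 'a mpoly) ^ e = term_of (Poly_Mapping.single t e) 1" for e
    proof (induction e)
      case (Suc e)
      then show ?case
        by (simp add: var_def mult_single flip: single_add)
    qed simp
    then show ?thesis by (simp add: uni_term poly_monom mult_single del_add_X)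
  qed
  have "poly (uni t p) (var t) = (\<Sum>m\<in>keys p. poly (uni t (term_of m (lookup p m))) (var t))"
    by (subst mpoly_sum_terms[of p, symmetric]) (simp add: uni_sum poly_sum)
  also have "\<dots> = p" by (simp add: * mpoly_sum_terms)
  finally show ?thesis unfolding poly_altdef by (rule sym)
qed

lemma coeff_uni_Pol: "p \<in> Pol V \<Longrightarrow> coeff (uni t p) e \<in> Pol (V - {t})"
  by (fastforce simp: Pol_iff lookup_coeff_uni keys_add_monomial)

lemma uni_free: "p \<in> Pol V \<Longrightarrow> t \<notin> V \<Longrightarrow> uni t p = [:p:]"
proof (rule poly_eqI)
  fix e assume p: "p \<in> Pol V" "t \<notin> V"
  have "lookup p m = 0" if "lookup m t \<noteq> 0" for m
    using p that unfolding Pol_iff by (metis in_keys_iff subsetD)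
  then show "coeff (uni t p) e = coeff [:p:] e"
    by (cases e) (auto intro!: poly_mapping_eqI simp: lookup_coeff_uni in_keys_iff lookup_add)
qed

lemma uni_eq_0: "uni t p = 0 \<longleftrightarrow> p = 0"
  using uni_expand[of p t] by auto

lemma res_coeff_uni: "t \<in> F \<Longrightarrow> res F (coeff (uni t p) e) = coeff (uni t (res F p)) e"
  by (rule poly_mapping_eqI) (auto simp: lookup_coeff_uni lookup_res keys_add_monomial)

subsection \<open>Ideals\<close>

definition ideal_in :: "'a::comm_ring_1 set \<Rightarrow> 'a set \<Rightarrow> bool" where
  "ideal_in R J \<longleftrightarrow> J \<subseteq> R \<and> 0 \<in> J \<and> (\<forall>x\<in>J. \<forall>y\<in>J. x + y \<in> J) \<and> (\<forall>r\<in>R. \<forall>x\<in>J. r * x \<in> J)"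

lemma ideal_inD:
  assumes "ideal_in R J"
  shows "x \<in> J \<Longrightarrow> x \<in> R" "0 \<in> J" "x \<in> J \<Longrightarrow> y \<in> J \<Longrightarrow> x + y \<in> J"
    "r \<in> R \<Longrightarrow> x \<in> J \<Longrightarrow> r * x \<in> J" "r \<in> R \<Longrightarrow> x \<in> J \<Longrightarrow> x * r \<in> J"
  using assms by (auto simp: ideal_in_def mult.commute[of x r])

lemma ideal_in_Pol_uminus: "ideal_in (Pol V) J \<Longrightarrow> x \<in> J \<Longrightarrow> - x \<in> J"
  using ideal_inD(4)[of "Pol V" J "-1" x] by simp

lemma ideal_in_Pol_diff: "ideal_in (Pol V) J \<Longrightarrow> x \<in> J \<Longrightarrow> y \<in> J \<Longrightarrow> x - y \<in> J"
  using ideal_inD(3)[of "Pol V" J x "-y"] by (simp add: ideal_in_Pol_uminus)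

lemma ideal_in_sum: "ideal_in R J \<Longrightarrow> (\<And>i. i \<in> A \<Longrightarrow> f i \<in> J) \<Longrightarrow> sum f A \<in> J"
  by (induction A rule: infinite_finite_induct) (auto dest: ideal_inD)

definition subring_in :: "'a::comm_ring_1 set \<Rightarrow> bool" where
  "subring_in R \<longleftrightarrow> 1 \<in> R \<and> (\<forall>x\<in>R. \<forall>y\<in>R. x - y \<in> R \<and> x * y \<in> R)"

lemma subring_Pol [simp]: "subring_in (Pol V)"
  by (simp add: subring_in_def)

lemma subring_inD:
  assumes "subring_in R"
  shows "1 \<in> R" "0 \<in> R" "x \<in> R \<Longrightarrow> y \<in> R \<Longrightarrow> x * y \<in> R" "x \<in> R \<Longrightarrow> - x \<in> R"
    "x \<in> R \<Longrightarrow> y \<in> R \<Longrightarrow> x + y \<in> R" "x \<in> R \<Longrightarrow> y \<in> R \<Longrightarrow> x - y \<in> R" "x \<in> R \<Longrightarrow> x ^ n \<in> R"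
proof -
  have R: "1 \<in> R" "\<And>x y. x \<in> R \<Longrightarrow> y \<in> R \<Longrightarrow> x - y \<in> R" "\<And>x y. x \<in> R \<Longrightarrow> y \<in> R \<Longrightarrow> x * y \<in> R"
    using assms by (auto simp: subring_in_def)
  show 0: "0 \<in> R" using R(2)[of 1 1] R(1) by simp
  show m: "- x \<in> R" if "x \<in> R" for x using R(2)[of 0 x] 0 that by simp
  show "x + y \<in> R" if "x \<in> R" "y \<in> R" for x y using R(2)[of x "-y"] m that by simp
  show "x ^ n \<in> R" if "x \<in> R" for x using that by (induction n) (auto intro: R)
qed (use assms in \<open>auto simp: subring_in_def\<close>)

definition ideal_plus :: "'a::comm_ring_1 set \<Rightarrow> 'a set \<Rightarrow> 'a \<Rightarrow> 'a set" where
  "ideal_plus R J g = {x + g * c | x c. x \<in> J \<and> c \<in> R}"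

lemma ideal_in_plus:
  assumes R: "subring_in R" and J: "ideal_in R J" and g: "g \<in> R"
  shows "ideal_in R (ideal_plus R J g)"
proof -
  have "0 \<in> ideal_plus R J g"
    unfolding ideal_plus_def using ideal_inD(2)[OF J] subring_inD(2)[OF R] by force
  moreover have "x + y \<in> ideal_plus R J g" if xy: "x \<in> ideal_plus R J g" "y \<in> ideal_plus R J g" for x y
  proof -
    obtain a c b d where "x = a + g * c" "y = b + g * d" "a \<in> J" "b \<in> J" "c \<in> R" "d \<in> R"
      using xy by (auto simp: ideal_plus_def)
    then have "x + y = (a + b) + g * (c + d)" "a + b \<in> J" "c + d \<in> R"
      using ideal_inD(3)[OF J] subring_inD(5)[OF R] by (auto simp: algebra_simps)
    then show ?thesis by (auto simp: ideal_plus_def)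
  qed
  moreover have "r * x \<in> ideal_plus R J g" if xy: "x \<in> ideal_plus R J g" "r \<in> R" for x r
  proof -
    obtain a c where a: "x = a + g * c" "a \<in> J" "c \<in> R"
      using xy by (auto simp: ideal_plus_def)
    then have "r * x = r * a + g * (r * c)" by (simp add: algebra_simps)
    moreover have "r * a \<in> J" "r * c \<in> R"
      using a xy ideal_inD(4)[OF J] subring_inD(3)[OF R] by auto
    ultimately show ?thesis by (auto simp: ideal_plus_def)
  qed
  moreover have "ideal_plus R J g \<subseteq> R"
    using g ideal_inD(1)[OF J] subring_inD[OF R] by (auto simp: ideal_plus_def)
  ultimately show ?thesis by (auto simp: ideal_in_def)
qed

lemma ideal_plus_superset: "subring_in R \<Longrightarrow> J \<subseteq> ideal_plus R J g"
  unfolding ideal_plus_def by (force dest: subring_inD(2))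

lemma ideal_plus_gen: "subring_in R \<Longrightarrow> ideal_in R J \<Longrightarrow> g \<in> ideal_plus R J g"
  unfolding ideal_plus_def by (force dest: subring_inD(1) ideal_inD(2))

lemma ideal_plus_minimal: "ideal_in R K \<Longrightarrow> J \<subseteq> K \<Longrightarrow> g \<in> K \<Longrightarrow> ideal_plus R J g \<subseteq> K"
  using ideal_inD(3,5)[of R K] by (auto simp: ideal_plus_def)

definition ideal_ext :: "'a::comm_ring_1 set \<Rightarrow> 'a set \<Rightarrow> 'a list \<Rightarrow> 'a set" where
  "ideal_ext R = foldl (ideal_plus R)"

lemma ideal_ext_Nil [simp]: "ideal_ext R J [] = J"
  and ideal_ext_snoc [simp]: "ideal_ext R J (as @ [a]) = ideal_plus R (ideal_ext R J as) a"
  by (simp_all add: ideal_ext_def)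

lemma ideal_in_ext:
  "subring_in R \<Longrightarrow> ideal_in R J \<Longrightarrow> set as \<subseteq> R \<Longrightarrow> ideal_in R (ideal_ext R J as)"
  by (induction as rule: rev_induct) (auto intro: ideal_in_plus)

lemma ideal_ext_superset: "subring_in R \<Longrightarrow> J \<subseteq> ideal_ext R J as"
  by (induction as rule: rev_induct) (use ideal_plus_superset in \<open>fastforce+\<close>)

lemma ideal_ext_gen:
  "subring_in R \<Longrightarrow> ideal_in R J \<Longrightarrow> set as \<subseteq> R \<Longrightarrow> set as \<subseteq> ideal_ext R J as"
proof (induction as rule: rev_induct)
  case (snoc a as)
  then have "ideal_in R (ideal_ext R J as)" by (intro ideal_in_ext) auto
  then show ?case
    using snoc ideal_plus_superset[of R "ideal_ext R J as" a] ideal_plus_gen[of R "ideal_ext R J as" a]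
    by auto
qed simp

lemma ideal_ext_minimal: "ideal_in R K \<Longrightarrow> J \<subseteq> K \<Longrightarrow> set as \<subseteq> K \<Longrightarrow> ideal_ext R J as \<subseteq> K"
  by (induction as rule: rev_induct) (simp_all add: ideal_plus_minimal)

text \<open>For an ideal of \<open>Pol V\<close> with \<open>t \<in> V\<close> this says that it is extended from the polynomial ring
  in the variables other than \<open>x\<^sub>t\<close>.\<close>

definition coeff_stable :: "nat \<Rightarrow> 'k::field mpoly set \<Rightarrow> bool" where
  "coeff_stable t J \<longleftrightarrow> (\<forall>p\<in>J. \<forall>e. coeff (uni t p) e \<in> J)"

lemma coeff_stable_ideal_plus:
  assumes "coeff_stable t J" "g \<in> Pol W" "t \<notin> W"
  shows "coeff_stable t (ideal_plus (Pol V) J g)"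
proof -
  have "coeff (uni t (x + g * c)) e = coeff (uni t x) e + g * coeff (uni t c) e" for x c e
    using uni_free[OF assms(2,3)] by (simp add: uni_add uni_mult)
  then show ?thesis
    using assms(1) coeff_uni_Pol[of _ V t] Pol_mono[of "V - {t}" V]
    by (auto simp: coeff_stable_def ideal_plus_def) blast
qed

text \<open>Compare coefficients of powers of \<open>x\<^sub>t\<close>. If the lowest coefficient of \<open>f\<close> is the constant
  \<open>c\<close> in degree \<open>e\<close>, then the coefficient of \<open>f * a\<close> in degree \<open>n + e\<close> is \<open>c\<close> times the \<open>n\<close>-th
  coefficient of \<open>a\<close> plus multiples of lower coefficients of \<open>a\<close>; so all coefficients of \<open>a\<close> are
  successively seen to lie in \<open>J\<close>. Almost all regular sequences below are found in this way.\<close>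

lemma nonzero_divisor_of_fresh_variable:
  assumes J: "ideal_in (Pol V) J" and st: "coeff_stable t J" and tV: "t \<in> V"
    and f: "f \<in> Pol {t}" "f \<noteq> 0" and a: "a \<in> Pol V" and fa: "f * a \<in> J"
  shows "a \<in> J"
proof -
  have "\<exists>e. coeff (uni t f) e \<noteq> 0" using f(2) uni_eq_0[of t f] by (auto simp: poly_eq_iff)
  define e0 where "e0 = (LEAST e. coeff (uni t f) e \<noteq> 0)"
  have e0: "coeff (uni t f) e0 \<noteq> 0" unfolding e0_def by (rule LeastI_ex) fact
  have small: "coeff (uni t f) e = 0" if "e < e0" for e
    using that not_less_Least unfolding e0_def by blast
  have cst: "\<exists>c. coeff (uni t f) e = cst c" for e
    using coeff_uni_Pol[OF f(1), of t e] Pol_empty by simp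
  have aJ: "coeff (uni t a) n \<in> J" for n
  proof (induction n rule: less_induct)
    case (less n)
    let ?g = "\<lambda>i. coeff (uni t f) i * coeff (uni t a) (n + e0 - i)"
    have "coeff (uni t (f * a)) (n + e0) = (\<Sum>i\<le>n + e0. ?g i)"
      by (simp add: uni_mult coeff_mult)
    also have "\<dots> = ?g e0 + (\<Sum>i\<in>{..n + e0} - {e0}. ?g i)"
      by (subst sum.remove[of _ e0]) auto
    finally have "?g e0 = coeff (uni t (f * a)) (n + e0) - (\<Sum>i\<in>{..n + e0} - {e0}. ?g i)"
      by simp
    moreover have "coeff (uni t (f * a)) (n + e0) \<in> J"
      using st fa by (auto simp: coeff_stable_def)
    moreover have "?g i \<in> J" if i: "i \<in> {..n + e0} - {e0}" for i
    proof (cases "i < e0")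
      case True
      then show ?thesis using small ideal_inD(2)[OF J] by simp
    next
      case False
      then have "n + e0 - i < n" using i by auto
      then have "coeff (uni t a) (n + e0 - i) \<in> J" by (rule less)
      moreover have "coeff (uni t f) i \<in> Pol V" using cst[of i] by auto
      ultimately show ?thesis by (intro ideal_inD(4)[OF J])
    qed
    ultimately have "?g e0 \<in> J"
      using J by (auto intro!: ideal_in_Pol_diff ideal_in_sum)
    then have g: "coeff (uni t f) e0 * coeff (uni t a) n \<in> J" by simp
    obtain c where c: "coeff (uni t f) e0 = cst c" using cst by blast
    then have "c \<noteq> 0" using e0 by auto
    then have "cst (inverse c) * (coeff (uni t f) e0 * coeff (uni t a) n) = coeff (uni t a) n"
      by (simp add: c mult.assoc[symmetric] cst_mult[symmetric])
    then show ?case using ideal_inD(4)[OF J Pol_cst g] by metis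
  qed
  have "(\<Sum>e\<le>degree (uni t a). coeff (uni t a) e * var t ^ e) \<in> J"
    using J aJ tV by (intro ideal_in_sum ideal_inD(5)) auto
  then show ?thesis using uni_expand[of a t] by metis
qed

section \<open>Prime ideals, depth and dimension\<close>

text \<open>An ideal that is maximal among those containing \<open>J\<close> and avoiding the multiplicative set \<open>S\<close>
  is prime; Zorn's lemma provides one.\<close>

lemma (in cring) prime_ideal_avoiding:
  assumes J: "ideal J R" and S: "S \<subseteq> carrier R" "\<one> \<in> S" "\<And>s t. s \<in> S \<Longrightarrow> t \<in> S \<Longrightarrow> s \<otimes> t \<in> S"
    and disj: "J \<inter> S = {}"
  obtains p where "primeideal p R" "J \<subseteq> p" "p \<inter> S = {}"
proof -
  let ?A = "{K. ideal K R \<and> J \<subseteq> K \<and> K \<inter> S = {}}"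
  have "\<exists>M\<in>?A. \<forall>K\<in>?A. M \<subseteq> K \<longrightarrow> K = M"
  proof (rule subset_Zorn_nonempty)
    show "?A \<noteq> {}" using J disj by blast
  next
    fix C assume C: "C \<noteq> {}" "subset.chain ?A C"
    then have "subset.chain {I. ideal I R} C" by (auto simp: subset.chain_def)
    from chain_Union_is_ideal[OF this] C have "ideal (\<Union>C) R" by simp
    with C show "\<Union>C \<in> ?A" by (auto simp: subset.chain_def)
  qed
  then obtain M where MA: "M \<in> ?A" and "\<forall>K\<in>?A. M \<subseteq> K \<longrightarrow> K = M" by (rule bexE)
  then have max: "K = M" if "ideal K R" "J \<subseteq> K" "K \<inter> S = {}" "M \<subseteq> K" for K
    using that by simp
  have M: "ideal M R" "J \<subseteq> M" "M \<inter> S = {}" using MA by simp_all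
  interpret M: ideal M R by fact
  have meets: "\<exists>m r. m \<in> M \<and> r \<in> carrier R \<and> m \<oplus> r \<otimes> a \<in> S" if a: "a \<in> carrier R" "a \<notin> M" for a
  proof -
    have id: "ideal (M <+> (PIdl a)) R" using a by (intro add_ideals M cgenideal_ideal)
    have sub: "M \<subseteq> M <+> (PIdl a)"
    proof
      fix x assume x: "x \<in> M"
      have "\<zero> \<in> PIdl a" using a by (intro additive_subgroup.zero_closed ideal.axioms(1) cgenideal_ideal)
      moreover have "x = x \<oplus> \<zero>" using x M.a_subset by auto
      ultimately show "x \<in> M <+> (PIdl a)" using x unfolding set_add_def' by blast
    qed
    have "a \<in> M <+> (PIdl a)"
    proof -
      have "a = \<zero> \<oplus> a" using a by simp
      then show ?thesis using M.zero_closed cgenideal_self[OF a(1)] unfolding set_add_def' by blast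
    qed
    then have "(M <+> (PIdl a)) \<inter> S \<noteq> {}" using max[OF id] M(2) sub a by blast
    then show ?thesis by (auto simp: set_add_def' cgenideal_def)
  qed
  have "primeideal M R"
  proof (rule primeidealI[OF M(1) is_cring])
    show "carrier R \<noteq> M" using M(3) S by auto
  next
    fix a b assume ab: "a \<in> carrier R" "b \<in> carrier R" "a \<otimes> b \<in> M"
    show "a \<in> M \<or> b \<in> M"
    proof (rule ccontr)
      assume "\<not> (a \<in> M \<or> b \<in> M)"
      then obtain m r m' r' where *: "m \<in> M" "r \<in> carrier R" "m \<oplus> r \<otimes> a \<in> S"
        "m' \<in> M" "r' \<in> carrier R" "m' \<oplus> r' \<otimes> b \<in> S" using meets[OF ab(1)] meets[OF ab(2)] by auto
      then have c: "m \<in> carrier R" "m' \<in> carrier R" using M.a_subset by auto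
      have "(m \<oplus> r \<otimes> a) \<otimes> (m' \<oplus> r' \<otimes> b)
          = (m \<otimes> (m' \<oplus> r' \<otimes> b) \<oplus> (r \<otimes> a) \<otimes> m') \<oplus> (r \<otimes> r') \<otimes> (a \<otimes> b)"
        using c ab * by algebra
      moreover have "m \<otimes> (m' \<oplus> r' \<otimes> b) \<in> M" "(r \<otimes> a) \<otimes> m' \<in> M" "(r \<otimes> r') \<otimes> (a \<otimes> b) \<in> M"
        using c ab * by (auto intro: M.I_l_closed M.I_r_closed)
      ultimately have "(m \<oplus> r \<otimes> a) \<otimes> (m' \<oplus> r' \<otimes> b) \<in> M"
        using M.a_closed by simp
      then show False using S(3)[OF *(3,6)] M(3) by blast
    qed
  qed
  then show ?thesis using that M by blast
qed

text \<open>Below a prime \<open>q\<close> containing the first \<open>k + 1\<close> elements there is a strictly smaller prime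
  containing the first \<open>k\<close> of them. Indeed the last element \<open>a\<close> is regular modulo the ideal \<open>J\<close> of
  the others, and so no product \<open>s * a\<^sup>n\<close> with \<open>s\<close> outside \<open>q\<close> lies in \<open>J\<close>. A prime over \<open>J\<close> that
  avoids all these products is contained in \<open>q\<close> and does not contain \<open>a\<close>. Hence depth is at most
  dimension in every commutative ring.\<close>

lemma regular_sequence_imp_prime_chain:
  assumes A: "cring A" and reg: "regular_sequence A xs"
    and k: "k \<le> length xs" and q: "primeideal q A" "Idl\<^bsub>A\<^esub> (set (take k xs)) \<subseteq> q"
  shows "\<exists>p. p k = q \<and> (\<forall>i\<le>k. primeideal (p i) A) \<and> (\<forall>i<k. p i \<subset> p (Suc i))"
  using k q
proof (induction k arbitrary: q)
  case 0
  then show ?case by (intro exI[of _ "\<lambda>_. q"]) auto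
next
  case (Suc k)
  interpret cring A by fact
  interpret q: primeideal q A by (rule Suc.prems(2))
  define J where "J = Idl\<^bsub>A\<^esub> (set (take k xs))"
  define a where "a = xs ! k"
  define S where "S = {s \<otimes>\<^bsub>A\<^esub> a [^]\<^bsub>A\<^esub> (n::nat) | s n. s \<in> carrier A - q}"
  have kl: "k < length xs" using Suc.prems by simp
  have carr: "set xs \<subseteq> carrier A" using reg by (simp add: regular_sequence_def)
  have a: "a \<in> carrier A" using carr kl by (auto simp: a_def)
  have tk: "set (take k xs) \<subseteq> carrier A" using carr set_take_subset by fast
  have J: "ideal J A" unfolding J_def by (rule genideal_ideal[OF tk])
  have step: "y \<in> J" if "y \<in> carrier A" "a \<otimes>\<^bsub>A\<^esub> y \<in> J" for y
    using reg kl that by (auto simp: regular_sequence_def J_def a_def)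
  have steps: "s \<in> J" if "s \<in> carrier A" "s \<otimes>\<^bsub>A\<^esub> a [^]\<^bsub>A\<^esub> (n::nat) \<in> J" for s n
    using that(2)
  proof (induction n)
    case (Suc n)
    have "a \<otimes>\<^bsub>A\<^esub> (s \<otimes>\<^bsub>A\<^esub> a [^]\<^bsub>A\<^esub> n) = s \<otimes>\<^bsub>A\<^esub> a [^]\<^bsub>A\<^esub> Suc n"
      using a that by (simp add: m_ac)
    then show ?case using Suc step a that by (metis m_closed nat_pow_closed)
  qed (use that in simp)
  have sub: "set (take (Suc k) xs) = insert a (set (take k xs))"
    using kl by (simp add: take_Suc_conv_app_nth a_def)
  have tS: "insert a (set (take k xs)) \<subseteq> q"
    using Suc.prems(3) genideal_self[of "insert a (set (take k xs))"] a tk unfolding sub by blast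
  have Jq: "J \<subseteq> q" unfolding J_def by (rule genideal_minimal) (use q.is_ideal tS in auto)
  have "J \<inter> S = {}" using steps Jq by (auto simp: S_def)
  moreover have "S \<subseteq> carrier A" using a by (auto simp: S_def)
  moreover have one: "\<one>\<^bsub>A\<^esub> \<in> carrier A - q" using q.I_notcarr q.one_imp_carrier by auto
  moreover have "\<one>\<^bsub>A\<^esub> \<in> S" unfolding S_def using one by (force intro!: exI[of _ "\<one>\<^bsub>A\<^esub>"] exI[of _ "0::nat"])
  moreover have "s \<otimes>\<^bsub>A\<^esub> t \<in> S" if st: "s \<in> S" "t \<in> S" for s t
  proof -
    obtain x n where "s = x \<otimes>\<^bsub>A\<^esub> a [^]\<^bsub>A\<^esub> (n::nat)" "x \<in> carrier A - q"
      using st(1) unfolding S_def by blast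
    moreover obtain y m where "t = y \<otimes>\<^bsub>A\<^esub> a [^]\<^bsub>A\<^esub> (m::nat)" "y \<in> carrier A - q"
      using st(2) unfolding S_def by blast
    ultimately have x: "s = x \<otimes>\<^bsub>A\<^esub> a [^]\<^bsub>A\<^esub> n" "t = y \<otimes>\<^bsub>A\<^esub> a [^]\<^bsub>A\<^esub> m"
      "x \<in> carrier A - q" "y \<in> carrier A - q" by auto
    then have "s \<otimes>\<^bsub>A\<^esub> t = (x \<otimes>\<^bsub>A\<^esub> y) \<otimes>\<^bsub>A\<^esub> a [^]\<^bsub>A\<^esub> (n + m)"
      using a by (simp add: nat_pow_mult[symmetric] m_ac)
    moreover have "x \<otimes>\<^bsub>A\<^esub> y \<in> carrier A - q" using x q.I_prime[of x y] by auto
    ultimately show ?thesis unfolding S_def by blast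
  qed
  ultimately obtain p where p: "primeideal p A" "J \<subseteq> p" "p \<inter> S = {}"
    using prime_ideal_avoiding[OF J, of S] by metis
  have inS: "s \<in> S" if "s \<in> carrier A - q" for s
    unfolding S_def using that by (force intro!: exI[of _ s] exI[of _ "0::nat"])
  have "a \<in> S" unfolding S_def using one a by (force intro!: exI[of _ "\<one>\<^bsub>A\<^esub>"] exI[of _ "1::nat"])
  then have "a \<notin> p" using p(3) by blast
  moreover have "p \<subseteq> carrier A" using p(1) by (simp add: primeideal_def ideal.axioms(1) additive_subgroup.a_subset)
  then have "p \<subseteq> q" using inS p(3) by blast
  moreover have "a \<in> q" using tS by blast
  ultimately have pq: "p \<subset> q" by blast
  obtain f where f: "f k = p" "\<forall>i\<le>k. primeideal (f i) A" "\<forall>i<k. f i \<subset> f (Suc i)"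
    using Suc.IH[OF _ p(1)] p(2) Suc.prems by (auto simp: J_def)
  show ?case
  proof (intro exI[of _ "f(Suc k := q)"] conjI allI impI)
    fix i assume "i \<le> Suc k"
    then show "primeideal ((f(Suc k := q)) i) A" using f(2) Suc.prems by (cases "i = Suc k") auto
  next
    fix i assume "i < Suc k"
    then show "(f(Suc k := q)) i \<subset> (f(Suc k := q)) (Suc i)"
      using f pq by (cases "i = k") auto
  qed simp
qed

lemma krull_dim_ge:
  assumes "\<forall>i\<le>r. primeideal (p i) A" "\<forall>i<r. p i \<subset> p (Suc i)"
  shows "enat r \<le> krull_dim A"
  unfolding krull_dim_def by (rule SUP_upper) (use assms in blast)

lemma regular_sequence_length_le_krull_dim:
  assumes A: "cring A" and reg: "regular_sequence A xs"
  shows "enat (length xs) \<le> krull_dim A"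
proof -
  interpret cring A by fact
  have carr: "set xs \<subseteq> carrier A" and ne: "Idl\<^bsub>A\<^esub> (set xs) \<noteq> carrier A"
    using reg by (auto simp: regular_sequence_def)
  have id: "ideal (Idl\<^bsub>A\<^esub> (set xs)) A" by (rule genideal_ideal[OF carr])
  have "\<one>\<^bsub>A\<^esub> \<notin> Idl\<^bsub>A\<^esub> (set xs)" using ne ideal.one_imp_carrier[OF id] by blast
  then obtain q where "primeideal q A" "Idl\<^bsub>A\<^esub> (set xs) \<subseteq> q"
    using prime_ideal_avoiding[OF id, of "{\<one>\<^bsub>A\<^esub>}"] by auto
  then obtain p where "\<forall>i\<le>length xs. primeideal (p i) A" "\<forall>i<length xs. p i \<subset> p (Suc i)"
    using regular_sequence_imp_prime_chain[OF A reg, of "length xs" q] by auto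
  then show ?thesis by (rule krull_dim_ge)
qed

corollary ideal_depth_le_krull_dim: "cring A \<Longrightarrow> ideal_depth A M \<le> krull_dim A"
  unfolding ideal_depth_def by (auto intro!: SUP_least regular_sequence_length_le_krull_dim)

section \<open>Localizations\<close>

definition prime_in :: "'a::comm_ring_1 set \<Rightarrow> 'a set \<Rightarrow> bool" where
  "prime_in R Q \<longleftrightarrow> ideal_in R Q \<and> 1 \<notin> Q \<and> (\<forall>x\<in>R. \<forall>y\<in>R. x * y \<in> Q \<longrightarrow> x \<in> Q \<or> y \<in> Q)"

lemma prime_in_power: "prime_in R Q \<Longrightarrow> subring_in R \<Longrightarrow> x \<in> R \<Longrightarrow> x ^ n \<in> Q \<Longrightarrow> x \<in> Q"
proof (induction n)
  case (Suc n)
  then have "x * x ^ n \<in> Q" "x ^ n \<in> R" by (auto intro: subring_inD)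
  then show ?case using Suc by (auto simp: prime_in_def)
qed (auto simp: prime_in_def)

text \<open>A localization \<open>(R / I)\<^sub>P\<close>, presented by fractions \<open>fr a s\<close> of representatives in \<open>R\<close>. In this
  way a statement about the local ring \<open>B\<close> turns into a membership in \<open>I\<close>, up to a multiplier
  outside \<open>P\<close>, and calculations are identities between polynomials. The ring \<open>R\<close> is a subset of
  a type because polynomial rings in varying sets of variables are compared.\<close>

locale local_quotient =
  fixes R I P :: "'a::comm_ring_1 set" and B :: "('b, 'm) ring_scheme" (structure)
    and fr :: "'a \<Rightarrow> 'a \<Rightarrow> 'b"
  assumes R: "subring_in R" and I: "ideal_in R I" and P: "prime_in R P" and IP: "I \<subseteq> P"
    and carrier_fr: "carrier B = {fr a s | a s. a \<in> R \<and> s \<in> R - P}"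
    and fr_eq: "a \<in> R \<Longrightarrow> b \<in> R \<Longrightarrow> s \<in> R - P \<Longrightarrow> t \<in> R - P \<Longrightarrow>
      fr a s = fr b t \<longleftrightarrow> (\<exists>w\<in>R - P. w * (t * a - s * b) \<in> I)"
    and fr_mult: "a \<in> R \<Longrightarrow> b \<in> R \<Longrightarrow> s \<in> R - P \<Longrightarrow> t \<in> R - P \<Longrightarrow>
      fr a s \<otimes> fr b t = fr (a * b) (s * t)"
    and fr_add: "a \<in> R \<Longrightarrow> b \<in> R \<Longrightarrow> s \<in> R - P \<Longrightarrow> t \<in> R - P \<Longrightarrow>
      fr a s \<oplus> fr b t = fr (t * a + s * b) (s * t)"
    and fr_1: "\<one> = fr 1 1" and fr_0: "\<zero> = fr 0 1"
begin

definition D :: "'a set" where "D = R - P"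

lemmas carrier_D = carrier_fr[folded D_def] and fr_eq_D = fr_eq[folded D_def]
  and fr_mult_D = fr_mult[folded D_def] and fr_add_D = fr_add[folded D_def]

lemma D_iff: "s \<in> D \<longleftrightarrow> s \<in> R \<and> s \<notin> P" by (simp add: D_def)

lemmas R_closed = subring_inD[OF R]

lemma P_ideal: "ideal_in R P" and P1: "1 \<notin> P"
  and P_prime: "x \<in> R \<Longrightarrow> y \<in> R \<Longrightarrow> x * y \<in> P \<Longrightarrow> x \<in> P \<or> y \<in> P"
  using P by (auto simp: prime_in_def)

lemma PR: "P \<subseteq> R" using P_ideal by (auto simp: ideal_in_def)

lemma D_1 [simp]: "1 \<in> D" using P1 R_closed by (simp add: D_iff)

lemma D_mult [simp]: "s \<in> D \<Longrightarrow> t \<in> D \<Longrightarrow> s * t \<in> D"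
  using P_prime R_closed by (auto simp: D_iff)

lemma D_R: "s \<in> D \<Longrightarrow> s \<in> R" by (simp add: D_iff)

lemma fr_closed [simp]: "a \<in> R \<Longrightarrow> s \<in> D \<Longrightarrow> fr a s \<in> carrier B"
  using carrier_D by auto

lemma fr_E: assumes "x \<in> carrier B" obtains a s where "x = fr a s" "a \<in> R" "s \<in> D"
  using assms carrier_D by auto

lemma fr_eqI: "a \<in> R \<Longrightarrow> b \<in> R \<Longrightarrow> s \<in> D \<Longrightarrow> t \<in> D \<Longrightarrow> t * a = s * b \<Longrightarrow> fr a s = fr b t"
  using ideal_inD(2)[OF I] D_1 by (subst fr_eq_D) (auto intro!: bexI[of _ 1])

lemma cring_B: "cring B"
proof (intro cringI abelian_groupI comm_monoidI)
  note [simp] = R_closed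
  show "x \<otimes> y \<in> carrier B" "x \<oplus> y \<in> carrier B" if "x \<in> carrier B" "y \<in> carrier B" for x y
    using that D_mult D_R by (auto elim!: fr_E simp: fr_mult_D fr_add_D)
  show "\<one> \<in> carrier B" "\<zero> \<in> carrier B" by (simp_all add: fr_1 fr_0)
  fix x y z assume x: "x \<in> carrier B"
  obtain a s where xa: "x = fr a s" "a \<in> R" "s \<in> D" using x by (rule fr_E)
  show "\<one> \<otimes> x = x" "\<zero> \<oplus> x = x"
    using xa D_R by (auto simp: fr_1 fr_0 fr_mult_D fr_add_D)
  show "\<exists>y\<in>carrier B. y \<oplus> x = \<zero>"
    using xa D_R by (intro bexI[of _ "fr (-a) s"]) (auto simp: fr_0 fr_add_D intro!: fr_eqI)
  assume y: "y \<in> carrier B"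
  obtain b t where yb: "y = fr b t" "b \<in> R" "t \<in> D" using y by (rule fr_E)
  show "x \<otimes> y = y \<otimes> x" "x \<oplus> y = y \<oplus> x"
    using xa yb D_R by (simp_all add: fr_mult_D fr_add_D mult.commute add.commute)
  assume z: "z \<in> carrier B"
  obtain c u where zc: "z = fr c u" "c \<in> R" "u \<in> D" using z by (rule fr_E)
  note [simp] = xa yb zc D_R D_R[OF xa(3)] D_R[OF yb(3)] D_R[OF zc(3)]
  show "x \<otimes> y \<otimes> z = x \<otimes> (y \<otimes> z)"
    by (simp add: fr_mult_D mult.assoc)
  show "x \<oplus> y \<oplus> z = x \<oplus> (y \<oplus> z)"
    by (simp add: fr_add_D algebra_simps)
  show "(x \<oplus> y) \<otimes> z = x \<otimes> z \<oplus> y \<otimes> z"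
    by (simp add: fr_add_D fr_mult_D) (rule fr_eqI, auto simp: algebra_simps)
qed

sublocale B: cring B by (rule cring_B)

definition loc :: "'a set \<Rightarrow> 'b set" where "loc J = {fr a s | a s. a \<in> J \<and> s \<in> D}"

lemma fr_in_loc:
  assumes J: "ideal_in R J" "I \<subseteq> J" and a: "a \<in> R" "s \<in> D"
  shows "fr a s \<in> loc J \<longleftrightarrow> (\<exists>w\<in>D. w * a \<in> J)"
proof
  assume "fr a s \<in> loc J"
  then obtain b t where b: "fr a s = fr b t" "b \<in> J" "t \<in> D" by (auto simp: loc_def)
  have bR: "b \<in> R" using b ideal_inD(1)[OF J(1)] by blast
  obtain w where w: "w \<in> D" "w * (t * a - s * b) \<in> I"
    using fr_eq_D[OF a(1) bR a(2) b(3)] b(1) by blast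
  have "w * s * b \<in> J"
    using w a b D_R R_closed(3) by (intro ideal_inD(4)[OF J(1)]) auto
  moreover have "w * (t * a - s * b) \<in> J" using w J by blast
  ultimately have "w * (t * a - s * b) + w * s * b \<in> J" by (rule ideal_inD(3)[OF J(1), rotated])
  then have "(w * t) * a \<in> J" by (simp add: algebra_simps)
  then show "\<exists>w\<in>D. w * a \<in> J" using w b by (intro bexI[of _ "w * t"]) (auto)
next
  assume "\<exists>w\<in>D. w * a \<in> J"
  then obtain w where w: "w \<in> D" "w * a \<in> J" by blast
  have "fr a s = fr (w * a) (w * s)"
    using w a D_R R_closed(3) by (intro fr_eqI) (auto simp: mult_ac)
  then show "fr a s \<in> loc J" using w a D_mult unfolding loc_def by blast
qed

lemma fr_in_loc_prime:
  assumes Q: "prime_in R Q" "I \<subseteq> Q" "Q \<subseteq> P" and a: "a \<in> R" "s \<in> D"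
  shows "fr a s \<in> loc Q \<longleftrightarrow> a \<in> Q"
proof -
  have J: "ideal_in R Q" using Q by (simp add: prime_in_def)
  have "w * a \<in> Q \<longleftrightarrow> a \<in> Q" if "w \<in> D" for w
    using that Q a ideal_inD(4)[OF J, of w a] unfolding prime_in_def D_iff by blast
  then show ?thesis using fr_in_loc[OF J Q(2) a] D_1 by blast
qed

lemma ideal_loc:
  assumes J: "ideal_in R J" "I \<subseteq> J"
  shows "ideal (loc J) B"
proof -
  note JR = ideal_inD(1)[OF J(1)]
  have mult: "x \<otimes> a \<in> loc J" if ax: "a \<in> loc J" "x \<in> carrier B" for a x
  proof -
    obtain b t where "a = fr b t" "b \<in> J" "t \<in> D" using ax(1) unfolding loc_def by blast
    moreover obtain c u where "x = fr c u" "c \<in> R" "u \<in> D" using ax(2) by (rule fr_E)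
    ultimately have "x \<otimes> a = fr (c * b) (u * t)" "c * b \<in> J" "u * t \<in> D"
      using ideal_inD(4)[OF J(1)] JR by (simp_all add: fr_mult_D)
    then show ?thesis unfolding loc_def by blast
  qed
  have sub: "loc J \<subseteq> carrier B" using JR by (auto simp: loc_def)
  show ?thesis
  proof (rule idealI[OF B.ring_axioms])
    show "subgroup (loc J) (add_monoid B)"
    proof (rule B.add.subgroupI)
      have "fr 0 1 \<in> loc J" using ideal_inD(2)[OF J(1)] D_1 unfolding loc_def by blast
      then show "loc J \<noteq> {}" by blast
      show "\<ominus> a \<in> loc J" if "a \<in> loc J" for a
      proof -
        have "\<ominus> a = (\<ominus> \<one>) \<otimes> a" using that sub B.l_minus[of \<one> a] by auto
        then show ?thesis using mult[OF that, of "\<ominus> \<one>"] by simp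
      qed
      show "a \<oplus> b \<in> loc J" if ab: "a \<in> loc J" "b \<in> loc J" for a b
      proof -
        obtain c s where c: "a = fr c s" "c \<in> J" "s \<in> D" using ab(1) unfolding loc_def by blast
        obtain d t where d: "b = fr d t" "d \<in> J" "t \<in> D" using ab(2) unfolding loc_def by blast
        have "a \<oplus> b = fr (t * c + s * d) (s * t)" using c d JR by (simp add: fr_add_D)
        moreover have "t * c + s * d \<in> J"
          using c d D_R by (intro ideal_inD(3)[OF J(1)] ideal_inD(4)[OF J(1)]) auto
        ultimately show ?thesis using D_mult[OF c(3) d(3)] unfolding loc_def by blast
      qed
    qed (rule sub)
    show "x \<otimes> a \<in> loc J" if "a \<in> loc J" "x \<in> carrier B" for a x by (rule mult[OF that])
    show "a \<otimes> x \<in> loc J" if "a \<in> loc J" "x \<in> carrier B" for a x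
      using mult[OF that] B.m_comm[of a x] that sub by auto
  qed
qed

definition M :: "'b set" where "M = loc P"

lemma fr_in_M: "a \<in> R \<Longrightarrow> s \<in> D \<Longrightarrow> fr a s \<in> M \<longleftrightarrow> a \<in> P"
  unfolding M_def by (rule fr_in_loc_prime) (use P IP in auto)

lemma M_E: assumes "x \<in> M" obtains a s where "x = fr a s" "a \<in> P" "s \<in> D"
  using assms by (auto simp: M_def loc_def)

lemma fr_inverse: "a \<in> D \<Longrightarrow> s \<in> D \<Longrightarrow> fr s a \<otimes> fr a s = \<one>"
  by (simp add: fr_mult_D fr_1 D_R) (intro fr_eqI; simp add: R_closed D_R mult_ac)

lemma ideal_not_in_M: "ideal N B \<Longrightarrow> \<not> N \<subseteq> M \<Longrightarrow> N = carrier B"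
proof -
  assume N: "ideal N B" "\<not> N \<subseteq> M"
  interpret N: ideal N B by (rule N)
  obtain x where x: "x \<in> N" "x \<notin> M" using N by blast
  then have "x \<in> carrier B" using N.a_subset by blast
  then obtain a s where a: "x = fr a s" "a \<in> R" "s \<in> D" by (rule fr_E)
  then have aD: "a \<in> D" using x fr_in_M by (auto simp: D_iff)
  have "fr s a \<otimes> x \<in> N" using x a aD by (intro N.I_l_closed) (auto simp: D_R)
  then have "\<one> \<in> N" using fr_inverse a aD by simp
  then show "N = carrier B" by (rule N.one_imp_carrier)
qed

lemma one_notin_M: "\<one> \<notin> M"
  using fr_in_M[of 1 1] P1 R_closed by (simp add: fr_1)

lemma M_ideal: "ideal M B" unfolding M_def by (rule ideal_loc[OF P_ideal IP])

lemma local_ring_B: "local_ring B M"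
proof -
  have ne: "carrier B \<noteq> M" using one_notin_M by auto
  have "maximalideal M B"
    by (rule maximalidealI[OF M_ideal ne]) (use ideal_not_in_M in blast)
  moreover have "N = M" if N: "maximalideal N B" for N
  proof -
    interpret N: maximalideal N B by fact
    have "N \<subseteq> M" using ideal_not_in_M[OF N.is_ideal] N.I_notcarr by blast
    moreover have "M \<subseteq> carrier B" using M_ideal by (simp add: ideal.axioms(1) additive_subgroup.a_subset)
    ultimately show ?thesis using N.I_maximal[OF M_ideal] ne by blast
  qed
  ultimately show ?thesis unfolding local_ring_def using cring_B by blast
qed

lemma local_ring_unique: "local_ring B M' \<Longrightarrow> M' = M"
  using local_ring_B by (auto simp: local_ring_def)

text \<open>An element of the local ring matters only up to units, that is, up to the denominator of a
  fraction that represents it.\<close>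

definition repr :: "'b \<Rightarrow> 'a \<Rightarrow> bool" where "repr x a \<longleftrightarrow> a \<in> R \<and> (\<exists>s\<in>D. x = fr a s)"

lemma list_all2_setD:
  assumes "list_all2 Q xs ys"
  shows "x \<in> set xs \<Longrightarrow> \<exists>y\<in>set ys. Q x y" "y \<in> set ys \<Longrightarrow> \<exists>x\<in>set xs. Q x y"
  using assms by (induction rule: list_all2_induct) auto

lemma loc_ext_eq_Idl:
  assumes xs: "list_all2 repr xs as"
  shows "Idl (set xs) = loc (ideal_ext R I as)"
proof
  have as: "set as \<subseteq> R" using list_all2_setD(2)[OF xs] by (auto simp: repr_def)
  have E: "ideal_in R (ideal_ext R I as)" "I \<subseteq> ideal_ext R I as"
    by (rule ideal_in_ext[OF R I as]) (rule ideal_ext_superset[OF R])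
  have "x \<in> loc (ideal_ext R I as)" if "x \<in> set xs" for x
  proof -
    obtain a where a: "a \<in> set as" "repr x a"
      using list_all2_setD(1)[OF xs \<open>x \<in> set xs\<close>] by blast
    then have "a \<in> ideal_ext R I as" using ideal_ext_gen[OF R I as] by blast
    with a(2) show ?thesis unfolding loc_def repr_def by blast
  qed
  then show "Idl (set xs) \<subseteq> loc (ideal_ext R I as)"
    by (intro B.genideal_minimal ideal_loc E) auto
  have xc: "set xs \<subseteq> carrier B"
    using list_all2_setD(1)[OF xs] unfolding repr_def by (metis fr_closed subsetI)
  interpret N: ideal "Idl (set xs)" B by (rule B.genideal_ideal[OF xc])
  define K where "K = {a\<in>R. fr a 1 \<in> Idl (set xs)}"
  have unit: "fr a 1 \<in> Idl (set xs) \<longleftrightarrow> fr a s \<in> Idl (set xs)" if "a \<in> R" "s \<in> D" for a s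
  proof -
    have "fr a s = fr 1 s \<otimes> fr a 1" "fr a 1 = fr s 1 \<otimes> fr a s"
      using that by (auto simp: fr_mult_D R_closed D_R intro!: fr_eqI)
    then show ?thesis using N.I_l_closed that fr_closed R_closed(1) D_1 D_R by metis
  qed
  have "ideal_in R K"
    unfolding ideal_in_def
  proof (intro conjI ballI)
    show "K \<subseteq> R" by (auto simp: K_def)
    show "0 \<in> K" using N.zero_closed by (simp add: K_def fr_0 R_closed)
    show "x + y \<in> K" if "x \<in> K" "y \<in> K" for x y
      using that N.a_closed[of "fr x 1" "fr y 1"] by (auto simp: K_def fr_add_D R_closed P1)
    show "r * x \<in> K" if "r \<in> R" "x \<in> K" for r x
      using that N.I_l_closed[of "fr x 1" "fr r 1"] by (auto simp: K_def fr_mult_D R_closed P1)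
  qed
  moreover have "I \<subseteq> K"
  proof
    fix a assume a: "a \<in> I"
    then have aR: "a \<in> R" using ideal_inD(1)[OF I] by blast
    have "fr a 1 = fr 0 1" using a aR by (subst fr_eq_D) (auto intro!: bexI[of _ 1] simp: R_closed P1)
    then show "a \<in> K" using N.zero_closed aR by (simp add: K_def fr_0)
  qed
  moreover have "set as \<subseteq> K"
  proof
    fix a assume a: "a \<in> set as"
    then obtain x where "x \<in> set xs" "repr x a" using list_all2_setD(2)[OF xs] by blast
    then show "a \<in> K" using B.genideal_self[OF xc] unit by (auto simp: repr_def K_def)
  qed
  ultimately have sub: "ideal_ext R I as \<subseteq> K" by (rule ideal_ext_minimal)
  show "loc (ideal_ext R I as) \<subseteq> Idl (set xs)"
  proof
    fix x assume "x \<in> loc (ideal_ext R I as)"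
    then obtain a s where "x = fr a s" "a \<in> K" "s \<in> D" using sub by (auto simp: loc_def)
    then show "x \<in> Idl (set xs)" using unit by (auto simp: K_def)
  qed
qed

lemma fr_in_Idl:
  assumes "list_all2 repr xs as" "a \<in> R" "s \<in> D"
  shows "fr a s \<in> Idl (set xs) \<longleftrightarrow> (\<exists>w\<in>D. w * a \<in> ideal_ext R I as)"
proof -
  have as: "set as \<subseteq> R"
    using list_all2_setD(2)[OF assms(1)] by (auto simp: repr_def)
  show ?thesis unfolding loc_ext_eq_Idl[OF assms(1)]
    by (intro fr_in_loc ideal_in_ext[OF R I as] ideal_ext_superset[OF R] assms)
qed

lemma repr_fr: "set as \<subseteq> R \<Longrightarrow> list_all2 repr (map (\<lambda>a. fr a 1) as) as"
  using D_1 by (auto simp: list_all2_conv_all_nth repr_def simp del: D_1)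

lemma repr_obtain:
  assumes "set xs \<subseteq> M" obtains as where "list_all2 repr xs as" "set as \<subseteq> P"
proof -
  have "\<exists>as. list_all2 repr xs as \<and> set as \<subseteq> P"
    using assms
  proof (induction xs)
    case (Cons x xs)
    then obtain as where "list_all2 repr xs as" "set as \<subseteq> P" by auto
    moreover obtain a s where "x = fr a s" "a \<in> P" "s \<in> D" using Cons.prems by (auto elim: M_E)
    ultimately show ?case using PR by (intro exI[of _ "a # as"]) (auto simp: repr_def[of "fr a s"])
  qed auto
  then show ?thesis using that by blast
qed

lemma regular_sequence_fr:
  assumes as: "set as \<subseteq> P"
    and reg: "\<And>i f. i < length as \<Longrightarrow> f \<in> R \<Longrightarrow> as ! i * f \<in> ideal_ext R I (take i as) \<Longrightarrow>
      f \<in> ideal_ext R I (take i as)"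
  shows "regular_sequence B (map (\<lambda>a. fr a 1) as)"
proof -
  let ?xs = "map (\<lambda>a. fr a 1) as"
  have asR: "set as \<subseteq> R" using as PR by blast
  have "Idl (set ?xs) \<subseteq> M"
    using as asR M_ideal fr_in_M[OF _ D_1] by (intro B.genideal_minimal) auto
  then have "Idl (set ?xs) \<noteq> carrier B" using one_notin_M by auto
  moreover have "y \<in> Idl (set (take i ?xs))"
    if i: "i < length ?xs" and y: "y \<in> carrier B" "?xs ! i \<otimes> y \<in> Idl (set (take i ?xs))" for i y
  proof -
    have rep: "list_all2 repr (take i ?xs) (take i as)"
      using list_all2_takeI[OF repr_fr[OF asR]] by simp
    obtain f s where f: "y = fr f s" "f \<in> R" "s \<in> D" using y(1) by (rule fr_E)
    have ai: "as ! i \<in> R" using asR i by auto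
    have "?xs ! i \<otimes> y = fr (as ! i * f) (1 * s)"
      using i f ai by (simp add: fr_mult_D del: mult_1)
    then have "\<exists>w\<in>D. w * (as ! i * f) \<in> ideal_ext R I (take i as)"
      using y(2) fr_in_Idl[OF rep, of "as ! i * f" "1 * s"] f ai R_closed(3) by simp
    then obtain w where w: "w \<in> D" "as ! i * (w * f) \<in> ideal_ext R I (take i as)"
      by (auto simp: mult_ac)
    then have "w * f \<in> ideal_ext R I (take i as)" using reg i f R_closed(3) D_R by auto
    then show ?thesis using fr_in_Idl[OF rep f(2,3)] w f by blast
  qed
  ultimately show ?thesis
    unfolding regular_sequence_def using asR D_1 by auto
qed

lemma primeideal_loc:
  assumes Q: "prime_in R Q" "I \<subseteq> Q" "Q \<subseteq> P"
  shows "primeideal (loc Q) B"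
proof (rule primeidealI)
  have Qi: "ideal_in R Q" using Q by (simp add: prime_in_def)
  show "ideal (loc Q) B" by (rule ideal_loc[OF Qi Q(2)])
  show "cring B" by (rule cring_B)
  have "\<one> \<notin> loc Q" using fr_in_loc_prime[OF Q, of 1 1] Q(1) R_closed D_1 by (simp add: fr_1 prime_in_def)
  then show "carrier B \<noteq> loc Q" by auto
  fix x y assume xy: "x \<in> carrier B" "y \<in> carrier B" "x \<otimes> y \<in> loc Q"
  obtain a s b t where *: "x = fr a s" "a \<in> R" "s \<in> D" "y = fr b t" "b \<in> R" "t \<in> D"
    using xy by (metis fr_E)
  then have "a * b \<in> Q" using xy(3) fr_in_loc_prime[OF Q, of "a * b" "s * t"] R_closed(3) D_mult
    by (simp add: fr_mult_D)
  then show "x \<in> loc Q \<or> y \<in> loc Q"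
    using * Q(1) fr_in_loc_prime[OF Q] by (auto simp: prime_in_def)
qed

lemma krull_dim_ge_chain:
  assumes q: "\<And>i. i \<le> r \<Longrightarrow> prime_in R (q i) \<and> I \<subseteq> q i \<and> q i \<subseteq> P" "\<And>i. i < r \<Longrightarrow> q i \<subset> q (Suc i)"
  shows "enat r \<le> krull_dim B"
proof (rule krull_dim_ge)
  show "\<forall>i\<le>r. primeideal (loc (q i)) B" using q(1) primeideal_loc by blast
  show "\<forall>i<r. loc (q i) \<subset> loc (q (Suc i))"
  proof (intro allI impI)
    fix i assume i: "i < r"
    obtain a where a: "a \<in> q (Suc i)" "a \<notin> q i" using q(2)[OF i] by blast
    have "a \<in> R" using a q(1)[of "Suc i"] i PR by (meson Suc_leI subsetD)
    then have "fr a 1 \<notin> loc (q i)" "fr a 1 \<in> loc (q (Suc i))"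
      using a q(1)[of i] q(1)[of "Suc i"] i fr_in_loc_prime D_1 by auto
    moreover have "loc (q i) \<subseteq> loc (q (Suc i))" using q(2)[OF i] by (auto simp: loc_def)
    ultimately show "loc (q i) \<subset> loc (q (Suc i))" by blast
  qed
qed

text \<open>Contraction along \<open>a \<mapsto> fr a 1\<close> is strictly monotone on primes, so that a chain in the local
  ring yields a chain of the same length of primes of \<open>R\<close> containing \<open>I\<close>.\<close>

lemma krull_dim_le_chain:
  assumes "\<And>r q. (\<And>i. i \<le> r \<Longrightarrow> prime_in R (q i) \<and> I \<subseteq> q i) \<Longrightarrow>
      (\<And>i. i < r \<Longrightarrow> q i \<subset> q (Suc i)) \<Longrightarrow> r \<le> d"
  shows "krull_dim B \<le> enat d"
  unfolding krull_dim_def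
proof (rule SUP_least, clarify)
  fix r p assume p: "\<forall>i\<le>r. primeideal (p i) B" "\<forall>i<r. p i \<subset> p (Suc i)"
  define q where "q i = {a\<in>R. fr a 1 \<in> p i}" for i :: nat
  have "prime_in R (q i) \<and> I \<subseteq> q i" if i: "i \<le> r" for i
  proof -
    interpret p: primeideal "p i" B using p i by blast
    have "ideal_in R (q i)"
      unfolding ideal_in_def
    proof (intro conjI ballI)
      show "q i \<subseteq> R" by (auto simp: q_def)
      show "0 \<in> q i" using p.zero_closed by (simp add: q_def fr_0 R_closed)
      show "x + y \<in> q i" if "x \<in> q i" "y \<in> q i" for x y
        using that p.a_closed[of "fr x 1" "fr y 1"] by (auto simp: q_def fr_add_D R_closed P1)
      show "r * x \<in> q i" if "r \<in> R" "x \<in> q i" for r x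
        using that p.I_l_closed[of "fr x 1" "fr r 1"] by (auto simp: q_def fr_mult_D R_closed P1)
    qed
    moreover have "1 \<notin> q i" using p.I_notcarr p.one_imp_carrier by (auto simp: q_def fr_1)
    moreover have "x \<in> q i \<or> y \<in> q i" if "x \<in> R" "y \<in> R" "x * y \<in> q i" for x y
      using that p.I_prime[of "fr x 1" "fr y 1"] by (auto simp: q_def fr_mult_D R_closed P1)
    moreover have "I \<subseteq> q i"
    proof
      fix a assume a: "a \<in> I"
      then have aR: "a \<in> R" using ideal_inD(1)[OF I] by blast
      have "fr a 1 = fr 0 1" using a aR by (subst fr_eq_D) (auto intro!: bexI[of _ 1] simp: R_closed P1)
      then show "a \<in> q i" using p.zero_closed aR by (simp add: q_def fr_0)
    qed
    ultimately show ?thesis by (auto simp: prime_in_def)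
  qed
  moreover have "q i \<subset> q (Suc i)" if i: "i < r" for i
  proof -
    have sub: "p i \<subset> p (Suc i)" using p i by blast
    obtain x where x: "x \<in> p (Suc i)" "x \<notin> p i" using sub by blast
    interpret p: primeideal "p i" B using p i by auto
    interpret p': primeideal "p (Suc i)" B using p i by auto
    obtain a s where a: "x = fr a s" "a \<in> R" "s \<in> D" using x(1) p'.a_subset fr_E by blast
    have "fr a s = fr 1 s \<otimes> fr a 1" "fr a 1 = fr s 1 \<otimes> fr a s"
      using a by (auto simp: fr_mult_D R_closed D_R intro!: fr_eqI)
    then have "fr a 1 \<in> p (Suc i)" "fr a 1 \<notin> p i"
      using x a p'.I_l_closed p.I_l_closed fr_closed R_closed(1) D_1 D_R by metis+
    then show ?thesis using sub a by (auto simp: q_def)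
  qed
  ultimately show "enat r \<le> enat d" using assms[of r q] by simp
qed

end

section \<open>The localizations of a quotient of a polynomial ring\<close>

lemma mpoly_ring_simps:
  "carrier (mpoly_ring V) = Pol V" "x \<otimes>\<^bsub>mpoly_ring V\<^esub> y = x * y" "x \<oplus>\<^bsub>mpoly_ring V\<^esub> y = x + y"
  "\<one>\<^bsub>mpoly_ring V\<^esub> = 1" "\<zero>\<^bsub>mpoly_ring V\<^esub> = 0"
  by (auto simp: mpoly_ring_def Pol_def)

lemma cring_mpoly_ring: "cring (mpoly_ring V :: 'k::field mpoly ring)"
proof (intro cringI abelian_groupI comm_monoidI)
  show "\<exists>y\<in>carrier (mpoly_ring V). y \<oplus>\<^bsub>mpoly_ring V\<^esub> x = \<zero>\<^bsub>mpoly_ring V\<^esub>"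
    if "x \<in> carrier (mpoly_ring V)" for x :: "'k mpoly"
    using that by (intro bexI[of _ "-x"]) (auto simp: mpoly_ring_simps)
qed (auto simp: mpoly_ring_simps algebra_simps)

lemma ideal_mpoly_ring:
  assumes "ideal_in (Pol V) I"
  shows "ideal I (mpoly_ring V)"
proof (rule idealI)
  interpret cring "mpoly_ring V :: 'a mpoly ring" by (rule cring_mpoly_ring)
  show "ring (mpoly_ring V :: 'a mpoly ring)" by (rule ring_axioms)
  note D = ideal_inD[OF assms]
  have um: "\<ominus>\<^bsub>mpoly_ring V\<^esub> a = - a" if "a \<in> Pol V" for a :: "'a mpoly"
    using that by (intro minus_equality) (auto simp: mpoly_ring_simps)
  show "subgroup I (add_monoid (mpoly_ring V))"
    using D(1,2,3) ideal_in_Pol_uminus[OF assms] um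
    by (intro add.subgroupI) (auto simp: mpoly_ring_simps)
qed (auto simp: mpoly_ring_simps intro: ideal_inD(4,5)[OF assms])

lemma ideal_in_of_ideal:
  assumes "ideal J (mpoly_ring V)"
  shows "ideal_in (Pol V) J"
proof -
  interpret ideal J "mpoly_ring V" by fact
  show ?thesis
    using a_subset additive_subgroup.zero_closed[OF additive_subgroup_axioms]
      additive_subgroup.a_closed[OF additive_subgroup_axioms] I_l_closed by (auto simp: ideal_in_def mpoly_ring_simps)
qed

locale mpoly_quotient =
  fixes V :: "nat set" and I :: "'k::field mpoly set" and A
  assumes I: "ideal_in (Pol V) I" and A: "A = mpoly_ring V Quot I"
begin

definition coset :: "'k mpoly \<Rightarrow> 'k mpoly set" where "coset f = I +>\<^bsub>mpoly_ring V\<^esub> f"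

sublocale Rg: cring "mpoly_ring V :: 'k mpoly ring" by (rule cring_mpoly_ring)
sublocale Ig: ideal I "mpoly_ring V" by (rule ideal_mpoly_ring[OF I])
sublocale A: cring A unfolding A by (rule Ig.quotient_is_cring[OF cring_mpoly_ring])

lemma coset_mem: "x \<in> coset f \<longleftrightarrow> x - f \<in> I"
  unfolding coset_def a_r_coset_def r_coset_def
  by (force simp: mpoly_ring_simps algebra_simps)

lemma I0: "0 \<in> I" and I_add: "x \<in> I \<Longrightarrow> y \<in> I \<Longrightarrow> x + y \<in> I" and I_diff: "x \<in> I \<Longrightarrow> y \<in> I \<Longrightarrow> x - y \<in> I"
  and I_um: "x \<in> I \<Longrightarrow> - x \<in> I"
  using I by (auto intro: ideal_inD ideal_in_Pol_diff ideal_in_Pol_uminus)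

lemma coset_eq: "coset f = coset g \<longleftrightarrow> f - g \<in> I"
proof
  assume "coset f = coset g"
  then show "f - g \<in> I" using coset_mem[of f f] coset_mem[of f g] I0 by simp
next
  assume *: "f - g \<in> I"
  have "x - f \<in> I \<longleftrightarrow> x - g \<in> I" for x
    using I_add[OF _ *, of "x - f"] I_diff[OF _ *, of "x - g"] by auto
  then show "coset f = coset g" by (auto simp: coset_mem)
qed

lemma carrier_A: "carrier A = coset ` Pol V"
  unfolding A FactRing_def A_RCOSETS_def' coset_def by (auto simp: mpoly_ring_simps)

lemma coset_mult: "f \<in> Pol V \<Longrightarrow> g \<in> Pol V \<Longrightarrow> coset f \<otimes>\<^bsub>A\<^esub> coset g = coset (f * g)"
  unfolding A coset_def using Ig.rcoset_mult_add[of f g] by (simp add: FactRing_def mpoly_ring_simps)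

lemma coset_add: "f \<in> Pol V \<Longrightarrow> g \<in> Pol V \<Longrightarrow> coset f \<oplus>\<^bsub>A\<^esub> coset g = coset (f + g)"
  unfolding A coset_def using Ig.a_rcos_sum[of f g] by (simp add: FactRing_def mpoly_ring_simps)

lemma coset_1: "\<one>\<^bsub>A\<^esub> = coset 1" and coset_0: "\<zero>\<^bsub>A\<^esub> = coset 0"
proof -
  show "\<one>\<^bsub>A\<^esub> = coset 1" unfolding A coset_def by (simp add: FactRing_def mpoly_ring_simps)
  have "coset 0 = I" by (auto simp: coset_mem)
  then show "\<zero>\<^bsub>A\<^esub> = coset 0" unfolding A by (simp add: FactRing_def)
qed

end

locale quotient_at_maximal = mpoly_quotient +
  fixes Pm
  assumes Pm: "maximalideal Pm A"
begin

definition S where "S = carrier A - Pm"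
definition P where "P = {f \<in> Pol V. coset f \<in> Pm}"
definition frac where "frac a s = fraction A S (coset a) (coset s)"

sublocale Pm: maximalideal Pm A by (rule Pm)
sublocale Pp: primeideal Pm A by (rule A.maximalideal_prime[OF Pm])

lemma coset_S: "s \<in> Pol V \<Longrightarrow> coset s \<in> S \<longleftrightarrow> s \<in> Pol V - P"
  by (auto simp: S_def P_def carrier_A)

lemma ideal_P: "ideal_in (Pol V) P"
  unfolding ideal_in_def
proof (intro conjI ballI)
  show "P \<subseteq> Pol V" by (auto simp: P_def)
  show "0 \<in> P" using Pm.zero_closed by (simp add: P_def coset_0)
  show "x + y \<in> P" if "x \<in> P" "y \<in> P" for x y
    using that Pm.a_closed[of "coset x" "coset y"] by (auto simp: P_def coset_add)
  show "r * x \<in> P" if "r \<in> Pol V" "x \<in> P" for r x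
    using that Pm.I_l_closed[of "coset x" "coset r"] by (auto simp: P_def coset_mult carrier_A)
qed

lemma prime_P: "prime_in (Pol V) P"
proof -
  have "1 \<notin> P" using Pm.I_notcarr Pm.one_imp_carrier by (auto simp: P_def coset_1)
  moreover have "x \<in> P \<or> y \<in> P" if "x \<in> Pol V" "y \<in> Pol V" "x * y \<in> P" for x y
    using that Pp.I_prime[of "coset x" "coset y"] by (auto simp: P_def coset_mult carrier_A)
  ultimately show ?thesis using ideal_P by (auto simp: prime_in_def)
qed

lemma I_sub_P: "I \<subseteq> P"
proof
  fix x assume x: "x \<in> I"
  then have "coset x = coset 0" by (simp add: coset_eq)
  then show "x \<in> P" using ideal_inD(1)[OF I x] Pm.zero_closed by (simp add: P_def coset_0)
qed

lemma inverse_mod_P: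
  assumes q: "q \<in> Pol V" "q \<notin> P"
  shows "\<exists>g\<in>Pol V. g * q - 1 \<in> P"
proof -
  have qA: "coset q \<in> carrier A" using q by (auto simp: carrier_A)
  have id: "ideal (Pm <+>\<^bsub>A\<^esub> (PIdl\<^bsub>A\<^esub> (coset q))) A"
    using qA by (intro A.add_ideals Pm.is_ideal A.cgenideal_ideal)
  have sub: "Pm \<subseteq> Pm <+>\<^bsub>A\<^esub> (PIdl\<^bsub>A\<^esub> (coset q))"
  proof
    fix x assume x: "x \<in> Pm"
    have "\<zero>\<^bsub>A\<^esub> \<in> PIdl\<^bsub>A\<^esub> (coset q)"
      using qA by (intro additive_subgroup.zero_closed ideal.axioms(1) A.cgenideal_ideal)
    moreover have "x = x \<oplus>\<^bsub>A\<^esub> \<zero>\<^bsub>A\<^esub>" using x Pm.a_subset by auto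
    ultimately show "x \<in> Pm <+>\<^bsub>A\<^esub> (PIdl\<^bsub>A\<^esub> (coset q))" using x unfolding set_add_def' by blast
  qed
  have "coset q \<in> Pm <+>\<^bsub>A\<^esub> (PIdl\<^bsub>A\<^esub> (coset q))"
  proof -
    have "coset q = \<zero>\<^bsub>A\<^esub> \<oplus>\<^bsub>A\<^esub> coset q" using qA by simp
    then show ?thesis using Pm.zero_closed A.cgenideal_self[OF qA] unfolding set_add_def' by blast
  qed
  moreover have "coset q \<notin> Pm" using q by (simp add: P_def)
  ultimately have "Pm <+>\<^bsub>A\<^esub> (PIdl\<^bsub>A\<^esub> (coset q)) = carrier A"
    using Pm.I_maximal[OF id sub] ideal.Icarr[OF id] by blast
  then have "\<one>\<^bsub>A\<^esub> \<in> Pm <+>\<^bsub>A\<^esub> (PIdl\<^bsub>A\<^esub> (coset q))" by simp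
  then obtain p r where p: "p \<in> Pm" "r \<in> carrier A" "\<one>\<^bsub>A\<^esub> = p \<oplus>\<^bsub>A\<^esub> r \<otimes>\<^bsub>A\<^esub> coset q"
    unfolding set_add_def' cgenideal_def by blast
  obtain h where h: "p = coset h" "h \<in> Pol V" using p Pm.a_subset carrier_A by blast
  obtain g where g: "r = coset g" "g \<in> Pol V" using p carrier_A by blast
  have "coset 1 = coset (h + g * q)" using p h g q by (simp add: coset_1 coset_mult coset_add)
  then have "1 - (h + g * q) \<in> P" using I_sub_P by (auto simp: coset_eq)
  moreover have "h \<in> P" using h p by (simp add: P_def)
  ultimately have "(1 - (h + g * q)) + h \<in> P" using ideal_inD(3)[OF ideal_P] by blast
  then have "- ((1 - (h + g * q)) + h) \<in> P" by (rule ideal_in_Pol_uminus[OF ideal_P])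
  then have "g * q - 1 \<in> P" by simp
  then show ?thesis using g by blast
qed

lemma S_E: assumes "z \<in> S" obtains s where "z = coset s" "s \<in> Pol V - P"
  using assms coset_S by (auto simp: S_def carrier_A)

lemma D1: "1 \<in> Pol V - P" using prime_P by (simp add: prime_in_def)

lemma D_m: "s \<in> Pol V - P \<Longrightarrow> t \<in> Pol V - P \<Longrightarrow> s * t \<in> Pol V - P"
  using prime_P by (auto simp: prime_in_def)

lemma frac_mem:
  assumes "a \<in> Pol V" "s \<in> Pol V - P" "b \<in> Pol V" "t \<in> Pol V - P"
  shows "(coset b, coset t) \<in> frac a s \<longleftrightarrow> (\<exists>w\<in>Pol V - P. w * (t * a - s * b) \<in> I)"
proof -
  have eq: "coset w \<otimes>\<^bsub>A\<^esub> (coset t \<otimes>\<^bsub>A\<^esub> coset a) = coset w \<otimes>\<^bsub>A\<^esub> (coset s \<otimes>\<^bsub>A\<^esub> coset b)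
      \<longleftrightarrow> w * (t * a - s * b) \<in> I" if "w \<in> Pol V" for w
    using assms that by (simp add: coset_mult coset_eq right_diff_distrib)
  have "coset b \<in> carrier A" "coset t \<in> S" using assms by (auto simp: carrier_A coset_S)
  then have "(coset b, coset t) \<in> frac a s \<longleftrightarrow>
      (\<exists>z\<in>S. z \<otimes>\<^bsub>A\<^esub> (coset t \<otimes>\<^bsub>A\<^esub> coset a) = z \<otimes>\<^bsub>A\<^esub> (coset s \<otimes>\<^bsub>A\<^esub> coset b))"
    by (simp add: frac_def fraction_def)
  also have "\<dots> \<longleftrightarrow> (\<exists>w\<in>Pol V - P. w * (t * a - s * b) \<in> I)" (is "?l \<longleftrightarrow> ?r")
  proof
    assume ?l
    then obtain z where "z \<in> S" "z \<otimes>\<^bsub>A\<^esub> (coset t \<otimes>\<^bsub>A\<^esub> coset a) = z \<otimes>\<^bsub>A\<^esub> (coset s \<otimes>\<^bsub>A\<^esub> coset b)" ..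
    then show ?r using eq by (auto elim!: S_E)
  next
    assume ?r
    then obtain w where w: "w \<in> Pol V - P" "w * (t * a - s * b) \<in> I" ..
    then show ?l using eq[of w] coset_S[of w] by (intro bexI[of _ "coset w"]) auto
  qed
  finally show ?thesis .
qed

lemma frac_E:
  assumes "z \<in> frac a s"
  obtains b t where "z = (coset b, coset t)" "b \<in> Pol V" "t \<in> Pol V - P"
  using assms coset_S by (auto simp: frac_def fraction_def carrier_A elim!: S_E)

lemma frac_eq:
  assumes a: "a \<in> Pol V" "s \<in> Pol V - P" and b: "b \<in> Pol V" "t \<in> Pol V - P"
  shows "frac a s = frac b t \<longleftrightarrow> (\<exists>w\<in>Pol V - P. w * (t * a - s * b) \<in> I)"
proof
  assume "frac a s = frac b t"
  moreover have "(coset b, coset t) \<in> frac b t"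
    using frac_mem[OF b b] D1 I0 by (auto intro!: bexI[of _ 1])
  ultimately show "\<exists>w\<in>Pol V - P. w * (t * a - s * b) \<in> I" using frac_mem[OF a b] by simp
next
  have sub: "frac b t \<subseteq> frac a s"
    if a: "a \<in> Pol V" "s \<in> Pol V - P" and b: "b \<in> Pol V" "t \<in> Pol V - P"
      and w: "w \<in> Pol V - P" "w * (t * a - s * b) \<in> I" for a s b t w
  proof
    fix z assume z: "z \<in> frac b t"
    then obtain c u where c: "z = (coset c, coset u)" "c \<in> Pol V" "u \<in> Pol V - P" by (rule frac_E)
    obtain w' where w': "w' \<in> Pol V - P" "w' * (u * b - t * c) \<in> I"
      using z c frac_mem[OF b c(2,3)] by auto
    have "(w * w' * t) * (u * a - s * c)
        = (w' * u) * (w * (t * a - s * b)) + (w * s) * (w' * (u * b - t * c))"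
      by (simp add: algebra_simps)
    moreover have "\<dots> \<in> I" using a b c w w'
      by (intro I_add ideal_inD(4)[OF I _ w(2)] ideal_inD(4)[OF I _ w'(2)]) auto
    ultimately have "(w * w' * t) * (u * a - s * c) \<in> I" by simp
    moreover have "w * w' * t \<in> Pol V - P" using w w' b by (intro D_m)
    ultimately show "z \<in> frac a s" unfolding c(1) using frac_mem[OF a c(2,3)] by blast
  qed
  assume "\<exists>w\<in>Pol V - P. w * (t * a - s * b) \<in> I"
  then obtain w where w: "w \<in> Pol V - P" "w * (t * a - s * b) \<in> I" ..
  have "w * (s * b - t * a) \<in> I" using I_um[OF w(2)] by (simp add: algebra_simps)
  then show "frac a s = frac b t" using sub[OF a b w] sub[OF b a w(1)] by blast
qed

lemma frac_self: "a \<in> Pol V \<Longrightarrow> s \<in> Pol V - P \<Longrightarrow> (coset a, coset s) \<in> frac a s"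
  using frac_mem[of a s a s] D1 I0 by (auto intro!: bexI[of _ 1])

lemma UN_frac:
  assumes a: "a \<in> Pol V" "s \<in> Pol V - P" and b: "b \<in> Pol V" "t \<in> Pol V - P"
    and const: "\<And>a' s' b' t'. a' \<in> Pol V \<Longrightarrow> s' \<in> Pol V - P \<Longrightarrow> b' \<in> Pol V \<Longrightarrow> t' \<in> Pol V - P \<Longrightarrow>
      \<exists>w\<in>Pol V - P. w * (s' * a - s * a') \<in> I \<Longrightarrow> \<exists>w\<in>Pol V - P. w * (t' * b - t * b') \<in> I \<Longrightarrow>
      g (coset a') (coset s') (coset b') (coset t') = K"
  shows "(\<Union>(x, y)\<in>frac a s. \<Union>(x', y')\<in>frac b t. g x y x' y') = K"
proof -
  have "g x y x' y' = K" if xy: "(x, y) \<in> frac a s" "(x', y') \<in> frac b t" for x y x' y'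
  proof -
    obtain a' s' where 1: "x = coset a'" "y = coset s'" "a' \<in> Pol V" "s' \<in> Pol V - P"
      using frac_E[OF xy(1)] by (metis prod.inject)
    obtain b' t' where 2: "x' = coset b'" "y' = coset t'" "b' \<in> Pol V" "t' \<in> Pol V - P"
      using frac_E[OF xy(2)] by (metis prod.inject)
    show ?thesis unfolding 1 2
      using xy 1 2 by (intro const) (simp_all add: frac_mem[OF a, symmetric] frac_mem[OF b, symmetric])
  qed
  then have *: "(\<Union>(x, y)\<in>frac a s. \<Union>(x', y')\<in>frac b t. g x y x' y')
      = (\<Union>z\<in>frac a s. \<Union>z'\<in>frac b t. K)"
    by (intro SUP_cong refl) (auto split: prod.splits)
  show ?thesis unfolding * using frac_self[OF a] frac_self[OF b] by auto
qed

lemma localization_simps: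
  assumes a: "a \<in> Pol V" "s \<in> Pol V - P" and b: "b \<in> Pol V" "t \<in> Pol V - P"
  shows "frac a s \<otimes>\<^bsub>localization A S\<^esub> frac b t = frac (a * b) (s * t)"
    and "frac a s \<oplus>\<^bsub>localization A S\<^esub> frac b t = frac (t * a + s * b) (s * t)"
proof -
  have m: "frac a s \<otimes>\<^bsub>localization A S\<^esub> frac b t
      = (\<Union>(x, y)\<in>frac a s. \<Union>(x', y')\<in>frac b t. fraction A S (x \<otimes>\<^bsub>A\<^esub> x') (y \<otimes>\<^bsub>A\<^esub> y'))"
    by (simp add: localization_def)
  show "frac a s \<otimes>\<^bsub>localization A S\<^esub> frac b t = frac (a * b) (s * t)"
    unfolding m
  proof (rule UN_frac[OF a b])
    fix a' s' b' t' assume *: "a' \<in> Pol V" "s' \<in> Pol V - P" "b' \<in> Pol V" "t' \<in> Pol V - P"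
      "\<exists>w\<in>Pol V - P. w * (s' * a - s * a') \<in> I" "\<exists>w\<in>Pol V - P. w * (t' * b - t * b') \<in> I"
    then obtain w w' where w: "w \<in> Pol V - P" "w' \<in> Pol V - P"
      "w * (s' * a - s * a') \<in> I" "w' * (t' * b - t * b') \<in> I" by blast
    have "(w * w') * ((s * t) * (a' * b') - (s' * t') * (a * b))
        = - ((w' * t' * b) * (w * (s' * a - s * a')) + (w * s * a') * (w' * (t' * b - t * b')))"
      by (simp add: algebra_simps)
    moreover have "\<dots> \<in> I" using a b w *(1-4)
      by (intro I_um I_add ideal_inD(4)[OF I _ w(3)] ideal_inD(4)[OF I _ w(4)]) auto
    ultimately have "(w * w') * ((s * t) * (a' * b') - (s' * t') * (a * b)) \<in> I" by simp
    then have "frac (a' * b') (s' * t') = frac (a * b) (s * t)"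
      using a b *(1-4) D_m[OF w(1,2)] D_m[OF *(2,4)] D_m[OF a(2) b(2)]
      by (subst frac_eq) auto
    then show "fraction A S (coset a' \<otimes>\<^bsub>A\<^esub> coset b') (coset s' \<otimes>\<^bsub>A\<^esub> coset t') = frac (a * b) (s * t)"
      using * by (simp add: coset_mult frac_def)
  qed
  have p: "frac a s \<oplus>\<^bsub>localization A S\<^esub> frac b t
      = (\<Union>(x, y)\<in>frac a s. \<Union>(x', y')\<in>frac b t.
           fraction A S ((y' \<otimes>\<^bsub>A\<^esub> x) \<oplus>\<^bsub>A\<^esub> (y \<otimes>\<^bsub>A\<^esub> x')) (y \<otimes>\<^bsub>A\<^esub> y'))"
    by (simp add: localization_def)
  show "frac a s \<oplus>\<^bsub>localization A S\<^esub> frac b t = frac (t * a + s * b) (s * t)"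
    unfolding p
  proof (rule UN_frac[OF a b])
    fix a' s' b' t' assume *: "a' \<in> Pol V" "s' \<in> Pol V - P" "b' \<in> Pol V" "t' \<in> Pol V - P"
      "\<exists>w\<in>Pol V - P. w * (s' * a - s * a') \<in> I" "\<exists>w\<in>Pol V - P. w * (t' * b - t * b') \<in> I"
    then obtain w w' where w: "w \<in> Pol V - P" "w' \<in> Pol V - P"
      "w * (s' * a - s * a') \<in> I" "w' * (t' * b - t * b') \<in> I" by blast
    have "(w * w') * ((s * t) * (t' * a' + s' * b') - (s' * t') * (t * a + s * b))
        = - ((w' * t * t') * (w * (s' * a - s * a')) + (w * s * s') * (w' * (t' * b - t * b')))"
      by (simp add: algebra_simps)
    moreover have "\<dots> \<in> I" using a b w *(1-4)
      by (intro I_um I_add ideal_inD(4)[OF I _ w(3)] ideal_inD(4)[OF I _ w(4)]) auto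
    ultimately have "(w * w') * ((s * t) * (t' * a' + s' * b') - (s' * t') * (t * a + s * b)) \<in> I" by simp
    then have "frac (t' * a' + s' * b') (s' * t') = frac (t * a + s * b) (s * t)"
      using a b *(1-4) D_m[OF w(1,2)] D_m[OF *(2,4)] D_m[OF a(2) b(2)]
      by (subst frac_eq) auto
    then show "fraction A S ((coset t' \<otimes>\<^bsub>A\<^esub> coset a') \<oplus>\<^bsub>A\<^esub> (coset s' \<otimes>\<^bsub>A\<^esub> coset b')) (coset s' \<otimes>\<^bsub>A\<^esub> coset t')
        = frac (t * a + s * b) (s * t)"
      using * by (simp add: coset_mult coset_add frac_def)
  qed
qed

sublocale lq: local_quotient "Pol V" I P "localization A S" frac
proof unfold_locales
  show "carrier (localization A S) = {frac a s |a s. a \<in> Pol V \<and> s \<in> Pol V - P}"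
  proof -
    have "carrier (localization A S) = {fraction A S a s | a s. a \<in> carrier A \<and> s \<in> S}"
      by (simp add: localization_def)
    also have "\<dots> = {frac a s |a s. a \<in> Pol V \<and> s \<in> Pol V - P}"
      using coset_S by (auto simp: frac_def carrier_A elim!: S_E)
    finally show ?thesis .
  qed
  show "\<one>\<^bsub>localization A S\<^esub> = frac 1 1" "\<zero>\<^bsub>localization A S\<^esub> = frac 0 1"
    by (simp_all add: localization_def frac_def coset_1 coset_0)
qed (simp_all add: I prime_P I_sub_P frac_eq localization_simps)

end

section \<open>The dimension of a polynomial ring\<close>

interpretation mpoly_vs: vector_space "\<lambda>c p. cst c * (p :: 'k::field mpoly)"
  by unfold_locales (auto simp: cst_add cst_mult algebra_simps)

lemma linear_relation:
  fixes f :: "'i \<Rightarrow> 'k::field mpoly"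
  assumes K: "finite K" and B: "finite B" and f: "f ` K \<subseteq> mpoly_vs.span B" and card: "card B < card K"
  shows "\<exists>c. (\<exists>k\<in>K. c k \<noteq> 0) \<and> (\<Sum>k\<in>K. cst (c k) * f k) = 0"
proof (cases "inj_on f K")
  case True
  have "mpoly_vs.dependent (f ` K)"
    using mpoly_vs.independent_span_bound[OF B _ f] card card_image[OF True] by force
  then obtain T u where T: "T \<subseteq> f ` K" "(\<Sum>v\<in>T. cst (u v) * v) = 0" "\<exists>v\<in>T. u v \<noteq> 0" "finite T"
    unfolding mpoly_vs.dependent_explicit by blast
  define c where "c k = (if f k \<in> T then u (f k) else 0)" for k
  have "(\<Sum>k\<in>K. cst (c k) * f k) = (\<Sum>v\<in>f ` K. cst (if v \<in> T then u v else 0) * v)"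
    using True by (simp add: sum.reindex c_def)
  also have "\<dots> = (\<Sum>v\<in>T. cst (u v) * v)"
    using T K by (intro sum.mono_neutral_cong_right) auto
  finally have "(\<Sum>k\<in>K. cst (c k) * f k) = 0" using T by simp
  moreover have "\<exists>k\<in>K. c k \<noteq> 0" using T by (auto simp: c_def)
  ultimately show ?thesis by blast
next
  case False
  then obtain k l where kl: "k \<in> K" "l \<in> K" "k \<noteq> l" "f k = f l" by (auto simp: inj_on_def)
  define c where "c i = (if i = k then 1 else if i = l then -1 else (0::'k))" for i
  have "(\<Sum>i\<in>K. cst (c i) * f i) = (\<Sum>i\<in>{k, l}. cst (c i) * f i)"
    using K kl by (intro sum.mono_neutral_right) (auto simp: c_def)
  also have "\<dots> = cst (1 + (-1)) * f k" using kl by (simp add: c_def cst_add distrib_right del: add.right_inverse)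
  finally have "(\<Sum>i\<in>K. cst (c i) * f i) = 0" by simp
  moreover have "c k \<noteq> 0" by (simp add: c_def)
  ultimately show ?thesis using kl by blast
qed

text \<open>Bounding every exponent separately, instead of the total degree, makes the number of admissible
  monomials a power of \<open>K + 1\<close>.\<close>

definition bounded_exponents :: "nat set \<Rightarrow> nat \<Rightarrow> 'k::field mpoly \<Rightarrow> bool" where
  "bounded_exponents G K p \<longleftrightarrow> (\<forall>m\<in>keys p. keys m \<subseteq> G \<and> (\<forall>v. lookup m v \<le> K))"

lemma bounded_exponents_mult:
  assumes "bounded_exponents G K p" "bounded_exponents G L q"
  shows "bounded_exponents G (K + L) (p * q)"
  unfolding bounded_exponents_def
proof
  fix m assume "m \<in> keys (p * q)"
  then obtain a b where "m = a + b" "a \<in> keys p" "b \<in> keys q" using keys_mult[of p q] by auto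
  then show "keys m \<subseteq> G \<and> (\<forall>v. lookup m v \<le> K + L)"
    using assms by (auto simp: bounded_exponents_def keys_add_monomial lookup_add add_mono)
qed

lemma bounded_exponents_power:
  "bounded_exponents G K p \<Longrightarrow> bounded_exponents G (n * K) (p ^ n)"
proof (induction n)
  case (Suc n)
  then show ?case using bounded_exponents_mult[of G K p "n * K" "p ^ n"] by simp
qed (simp add: bounded_exponents_def)

lemma bounded_exponents_prod:
  "(\<And>i. i < r \<Longrightarrow> bounded_exponents G K (f i)) \<Longrightarrow> bounded_exponents G (r * K) (\<Prod>i<r. f i)"
proof (induction r)
  case (Suc r)
  then have "bounded_exponents G (r * K + K) (prod f {..<r} * f r)"
    by (intro bounded_exponents_mult) auto
  then show ?case by (simp add: add.commute)
qed (simp add: bounded_exponents_def)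

lemma bounded_exponents_exists:
  assumes "p \<in> Pol G" shows "\<exists>K. bounded_exponents G K p"
proof -
  have "finite (\<Union>m\<in>keys p. (\<lambda>v. lookup m v) ` keys m)" by simp
  then obtain K where K: "\<And>e. e \<in> (\<Union>m\<in>keys p. (\<lambda>v. lookup m v) ` keys m) \<Longrightarrow> e \<le> K"
    by (meson finite_nat_set_iff_bounded_le)
  have "lookup m v \<le> K" if "m \<in> keys p" for m v
  proof (cases "v \<in> keys m")
    case True
    then show ?thesis using that by (intro K) blast
  qed (simp add: in_keys_iff)
  then show ?thesis using assms by (auto simp: bounded_exponents_def Pol_def)
qed

lemma bounded_exponents_span:
  assumes "finite G"
  obtains B :: "'k::field mpoly set" where "finite B" "card B \<le> (K + 1) ^ card G"
    "\<And>p. bounded_exponents G K p \<Longrightarrow> p \<in> mpoly_vs.span B"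
proof -
  let ?M = "{m :: monomial. keys m \<subseteq> G \<and> (\<forall>v. lookup m v \<le> K)}"
  let ?E = "PiE G (\<lambda>_. {..K})"
  have inj: "inj_on (\<lambda>m. restrict (lookup m) G) ?M"
  proof (rule inj_onI)
    fix m m' assume m: "m \<in> ?M" "m' \<in> ?M" "restrict (lookup m) G = restrict (lookup m') G"
    show "m = m'"
    proof (rule poly_mapping_eqI)
      fix v
      have "restrict (lookup m) G v = restrict (lookup m') G v" using m(3) by simp
      then show "lookup m v = lookup m' v"
        using m(1,2) by (cases "v \<in> G") (simp, simp add: in_keys_iff subset_iff, metis not_gr_zero)
    qed
  qed
  have sub: "(\<lambda>m. restrict (lookup m) G) ` ?M \<subseteq> ?E" by auto
  have fE: "finite ?E" using assms by (intro finite_PiE) auto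
  have fM: "finite ?M" using inj sub fE by (rule inj_on_finite)
  have "card ?M \<le> card ?E" using card_inj_on_le[OF inj sub fE] .
  also have "\<dots> = (K + 1) ^ card G" using assms by (simp add: card_PiE)
  finally have c: "card ?M \<le> (K + 1) ^ card G" .
  let ?B = "(\<lambda>m. term_of m (1::'k)) ` ?M"
  have "p \<in> mpoly_vs.span ?B" if p: "bounded_exponents G K p" for p
  proof -
    have "(\<Sum>m\<in>keys p. cst (lookup p m) * term_of m 1) \<in> mpoly_vs.span ?B"
      using p by (intro mpoly_vs.span_sum mpoly_vs.span_scale mpoly_vs.span_base)
        (auto simp: bounded_exponents_def)
    then show ?thesis by (simp add: cst_def mult_single mpoly_sum_terms)
  qed
  then show ?thesis using that[of ?B] fM c card_image_le[OF fM, of "\<lambda>m. term_of m (1::'k)"] by fastforce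
qed

text \<open>There are \<open>(N + 1) ^ r\<close> products of powers of the \<open>r\<close> elements with exponents at most \<open>N\<close>, but
  they lie in a space spanned by at most \<open>((N + 1) * C) ^ g\<close> monomials, where \<open>g < r\<close> is the number
  of variables and \<open>C\<close> depends only on the elements. For large \<open>N\<close> they are linearly dependent.\<close>

lemma algebraic_dependence:
  fixes a :: "nat \<Rightarrow> 'k::field mpoly"
  assumes G: "finite G" and a: "\<And>i. i < r \<Longrightarrow> a i \<in> Pol G" and r: "card G < r"
  shows "\<exists>E c. finite E \<and> E \<noteq> {} \<and> E \<subseteq> extensional {..<r} \<and> (\<forall>m\<in>E. c m \<noteq> 0) \<and>
    (\<Sum>m\<in>E. cst (c m) * (\<Prod>i<r. a i ^ m i)) = 0"
proof -
  have "\<forall>i. \<exists>K. i < r \<longrightarrow> bounded_exponents G K (a i)" using a bounded_exponents_exists by blast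
  then obtain k where k: "\<And>i. i < r \<Longrightarrow> bounded_exponents G (k i) (a i)" by metis
  define d where "d = (\<Sum>i<r. k i)"
  have bd: "bounded_exponents G d (a i)" if "i < r" for i
  proof -
    have "k i \<le> d" unfolding d_def using that by (intro member_le_sum) auto
    then show ?thesis using k[OF that] unfolding bounded_exponents_def by (meson order_trans)
  qed
  \<comment> \<open>with this \<open>N\<close> and \<open>g = card G\<close>, \<open>((N + 1) * C) ^ g = (N + 1) ^ g * N < (N + 1) ^ (g + 1)\<close>\<close>
  define C where "C = r * d + 1"
  define N where "N = C ^ card G"
  let ?E = "PiE {..<r} (\<lambda>_. {..N})"
  obtain B :: "'k mpoly set" where B: "finite B" "card B \<le> (r * (N * d) + 1) ^ card G"
    "\<And>p. bounded_exponents G (r * (N * d)) p \<Longrightarrow> p \<in> mpoly_vs.span B"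
    using bounded_exponents_span[OF G] by blast
  have span: "(\<lambda>m. \<Prod>i<r. a i ^ m i) ` ?E \<subseteq> mpoly_vs.span B"
  proof clarify
    fix m assume m: "m \<in> ?E"
    have "bounded_exponents G (N * d) (a i ^ m i)" if "i < r" for i
    proof -
      have "m i \<le> N" using m that by auto
      then have "m i * d \<le> N * d" by simp
      then show ?thesis using bounded_exponents_power[OF bd[OF that], of "m i"]
        unfolding bounded_exponents_def by (meson order_trans)
    qed
    then show "(\<Prod>i<r. a i ^ m i) \<in> mpoly_vs.span B" by (intro B(3) bounded_exponents_prod)
  qed
  have "card B \<le> (r * (N * d) + 1) ^ card G" by (rule B)
  also have "\<dots> \<le> ((N + 1) * C) ^ card G"
    by (rule power_mono) (auto simp: C_def algebra_simps)
  also have "\<dots> = (N + 1) ^ card G * N" by (simp only: power_mult_distrib N_def)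
  also have "\<dots> < (N + 1) ^ Suc (card G)" by simp
  also have "\<dots> \<le> (N + 1) ^ r" using r by (intro power_increasing) auto
  also have "\<dots> = card ?E" by (simp add: card_PiE)
  finally have "card B < card ?E" .
  moreover have fE: "finite ?E" by (intro finite_PiE) auto
  ultimately obtain c where c: "\<exists>m\<in>?E. c m \<noteq> 0" "(\<Sum>m\<in>?E. cst (c m) * (\<Prod>i<r. a i ^ m i)) = 0"
    using linear_relation[OF _ B(1) span] by blast
  have "(\<Sum>m\<in>{m\<in>?E. c m \<noteq> 0}. cst (c m) * (\<Prod>i<r. a i ^ m i)) = 0"
    using c(2) sum.mono_neutral_right[OF fE, of "{m\<in>?E. c m \<noteq> 0}" "\<lambda>m. cst (c m) * (\<Prod>i<r. a i ^ m i)"]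
    by simp
  moreover have "{m\<in>?E. c m \<noteq> 0} \<subseteq> extensional {..<r}" by (auto simp: PiE_def)
  moreover have "finite {m\<in>?E. c m \<noteq> 0}" using fE by simp
  moreover have "{m\<in>?E. c m \<noteq> 0} \<noteq> {}" using c(1) by blast
  ultimately show ?thesis by (intro exI[of _ "{m\<in>?E. c m \<noteq> 0}"] exI[of _ c]) blast
qed

text \<open>Suppose that a relation with nonzero coefficients between monomials in \<open>a\<^sub>k, \<dots>\<close> holds modulo
  \<open>q\<^sub>k\<close>. Since \<open>a\<^sub>k\<close> is not in the prime \<open>q\<^sub>k\<close>, the highest power of \<open>a\<^sub>k\<close> dividing all terms can be
  cancelled; modulo \<open>q\<^sub>k\<^sub>+\<^sub>1\<close>, which contains \<open>a\<^sub>k\<close>, there remains a relation between monomials in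
  \<open>a\<^sub>k\<^sub>+\<^sub>1, \<dots>\<close>. At the end of the chain a nonzero constant would lie in a prime. Injectivity of
  restriction on \<open>E\<close> expresses that distinct exponents stay distinct in the remaining monomials.\<close>

lemma no_relation_along_prime_chain:
  fixes a :: "nat \<Rightarrow> 'k::field mpoly"
  assumes q: "\<And>i. i \<le> r \<Longrightarrow> prime_in (Pol V) (q i)" "\<And>i. i < r \<Longrightarrow> q i \<subseteq> q (Suc i)"
    and a: "\<And>i. i < r \<Longrightarrow> a i \<in> q (Suc i)" "\<And>i. i < r \<Longrightarrow> a i \<notin> q i"
  shows "k \<le> r \<Longrightarrow> (\<forall>E c. finite E \<longrightarrow> E \<noteq> {} \<longrightarrow> (\<forall>m\<in>E. c m \<noteq> 0) \<longrightarrow>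
    inj_on (\<lambda>m. restrict m {k..<r}) E \<longrightarrow> (\<Sum>m\<in>E. cst (c m) * (\<Prod>i=k..<r. a i ^ m i)) \<notin> q k)"
proof (induction rule: inc_induct)
  case base
  show ?case
  proof (intro allI impI notI)
    fix E :: "(nat \<Rightarrow> nat) set" and c :: "_ \<Rightarrow> 'k"
    assume *: "finite E" "E \<noteq> {}" "\<forall>m\<in>E. c m \<noteq> 0" "inj_on (\<lambda>m. restrict m {r..<r}) E"
      "(\<Sum>m\<in>E. cst (c m) * (\<Prod>i=r..<r. a i ^ m i)) \<in> q r"
    then obtain m where "m \<in> E" by blast
    then have m: "E = {m}" using *(4) by (auto simp: inj_on_def restrict_def)
    have Q: "ideal_in (Pol V) (q r)" using q(1) by (simp add: prime_in_def)
    have "cst (inverse (c m)) * cst (c m) \<in> q r"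
      using * m by (intro ideal_inD(4)[OF Q]) auto
    then have "1 \<in> q r" using * m by (simp add: cst_mult[symmetric])
    then show False using q(1)[of r] by (simp add: prime_in_def)
  qed
next
  case (step k)
  have qk: "prime_in (Pol V) (q k)" "prime_in (Pol V) (q (Suc k))" using q step by auto
  then have Q: "ideal_in (Pol V) (q k)" "ideal_in (Pol V) (q (Suc k))" by (auto simp: prime_in_def)
  have aV: "a i \<in> Pol V" if "i < r" for i
    using a(1)[OF that] q(1)[of "Suc i"] that ideal_inD(1) by (fastforce simp: prime_in_def)
  show ?case
  proof (intro allI impI notI)
    fix E :: "(nat \<Rightarrow> nat) set" and c :: "_ \<Rightarrow> 'k"
    assume *: "finite E" "E \<noteq> {}" "\<forall>m\<in>E. c m \<noteq> 0" "inj_on (\<lambda>m. restrict m {k..<r}) E"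
      "(\<Sum>m\<in>E. cst (c m) * (\<Prod>i=k..<r. a i ^ m i)) \<in> q k"
    define e where "e = Min ((\<lambda>m. m k) ` E)"
    have e: "e \<in> (\<lambda>m. m k) ` E" "e \<le> m k" if "m \<in> E" for m
      using * that by (auto simp: e_def)
    define g where "g m = cst (c m) * (a k ^ (m k - e) * (\<Prod>i=Suc k..<r. a i ^ m i))" for m
    have prodV: "(\<Prod>i=Suc k..<r. a i ^ m i) \<in> Pol V" for m using aV by (intro Pol_prod) auto
    have gV: "g m \<in> Pol V" for m unfolding g_def using aV step prodV by auto
    have "cst (c m) * (\<Prod>i=k..<r. a i ^ m i) = a k ^ e * g m" if "m \<in> E" for m
    proof -
      have "a k ^ m k = a k ^ e * a k ^ (m k - e)" using e(2)[OF that] by (simp flip: power_add)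
      then show ?thesis using step by (simp add: g_def prod.atLeast_Suc_lessThan mult_ac)
    qed
    then have "(\<Sum>m\<in>E. cst (c m) * (\<Prod>i=k..<r. a i ^ m i)) = a k ^ e * sum g E"
      by (simp add: sum_distrib_left)
    then have "a k ^ e * sum g E \<in> q k" using * by simp
    moreover have "a k ^ e \<notin> q k"
      using prime_in_power[OF qk(1) subring_Pol aV] step a(2) by blast
    moreover have "sum g E \<in> Pol V" "a k ^ e \<in> Pol V" using gV aV step by auto
    ultimately have "sum g E \<in> q k" using qk(1) unfolding prime_in_def by blast
    then have gE: "sum g E \<in> q (Suc k)" using q(2) step by blast
    define E' where "E' = {m\<in>E. m k = e}"
    have "g m \<in> q (Suc k)" if "m \<in> E - E'" for m
    proof -
      have "m k - e = Suc (m k - e - 1)" using that e(2)[of m] by (auto simp: E'_def)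
      then have "g m = (cst (c m) * (a k ^ (m k - e - 1) * (\<Prod>i=Suc k..<r. a i ^ m i))) * a k"
        unfolding g_def by (metis (no_types, lifting) mult.assoc mult.commute power_Suc)
      then show ?thesis using a(1) step aV prodV by (auto intro!: ideal_inD(4)[OF Q(2)])
    qed
    then have "sum g (E - E') \<in> q (Suc k)" by (intro ideal_in_sum[OF Q(2)])
    moreover have "sum g E' = sum g E - sum g (E - E')"
      using * sum.subset_diff[of E' E g] by (auto simp: E'_def)
    ultimately have mem: "sum g E' \<in> q (Suc k)" using gE ideal_in_Pol_diff[OF Q(2)] by simp
    have eq: "sum g E' = (\<Sum>m\<in>E'. cst (c m) * (\<Prod>i=Suc k..<r. a i ^ m i))"
      by (rule sum.cong) (auto simp: g_def E'_def)
    have inj: "inj_on (\<lambda>m. restrict m {Suc k..<r}) E'"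
    proof (rule inj_onI)
      fix m m' assume m: "m \<in> E'" "m' \<in> E'" "restrict m {Suc k..<r} = restrict m' {Suc k..<r}"
      have "restrict m {k..<r} = restrict m' {k..<r}"
      proof
        fix i show "restrict m {k..<r} i = restrict m' {k..<r} i"
          using m(1,2) fun_cong[OF m(3), of i] by (cases "i = k") (auto simp: E'_def restrict_def split: if_splits)
      qed
      then show "m = m'" using *(4) m by (auto simp: inj_on_def E'_def)
    qed
    have "finite E'" "E' \<noteq> {}" "\<forall>m\<in>E'. c m \<noteq> 0" using * e by (auto simp: E'_def)
    from step(3)[THEN spec[of _ E'], THEN spec[of _ c], THEN mp, THEN mp, THEN mp, THEN mp, OF this inj]
    show False using mem unfolding eq by contradiction
  qed
qed

lemma term_factor: "v \<in> keys m \<Longrightarrow> term_of m c = var v * term_of (m - X v) c"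
proof -
  assume "v \<in> keys m"
  then have "X v + (m - X v) = m"
    by (intro poly_mapping_eqI) (auto simp: lookup_add lookup_minus lookup_single in_keys_iff when_def)
  then show ?thesis by (simp add: var_def mult_single)
qed

lemma diff_res_in_ideal:
  assumes p: "p \<in> Pol V" and Q: "ideal_in (Pol V) Q" and v: "\<And>v. v \<in> V - G \<Longrightarrow> var v \<in> Q"
  shows "p - res G p \<in> Q"
proof -
  have "p - res G p = (\<Sum>m\<in>keys p. term_of m (lookup p m)) - (\<Sum>m\<in>keys p. res G (term_of m (lookup p m)))"
    by (simp add: res_sum[symmetric] mpoly_sum_terms)
  also have "\<dots> = (\<Sum>m\<in>keys p. term_of m (lookup p m) - res G (term_of m (lookup p m)))"
    by (simp add: sum_subtractf)
  also have "\<dots> \<in> Q"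
  proof (rule ideal_in_sum[OF Q])
    fix m assume m: "m \<in> keys p"
    show "term_of m (lookup p m) - res G (term_of m (lookup p m)) \<in> Q"
    proof (cases "keys m \<subseteq> G")
      case True
      then show ?thesis using ideal_inD(2)[OF Q] by (simp add: res_term)
    next
      case False
      then obtain v where v': "v \<in> keys m" "v \<notin> G" by blast
      have "keys m \<subseteq> V" using p m by (auto simp: Pol_def)
      moreover have "keys (m - X v) \<subseteq> keys m"
        by (auto simp: in_keys_iff lookup_minus)
      ultimately have "term_of (m - X v) (lookup p m) \<in> Pol V" "var v \<in> Q"
        using v' v by (auto intro!: Pol_term)
      then have "var v * term_of (m - X v) (lookup p m) \<in> Q" by (rule ideal_inD(5)[OF Q])
      then show ?thesis using False unfolding res_term by (simp add: term_factor[OF v'(1)])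
    qed
  qed
  finally show ?thesis .
qed

text \<open>Setting the variables outside \<open>G\<close> to zero changes a polynomial only by an element of \<open>q 0\<close>, so
  elements that separate consecutive primes may be chosen in the variables \<open>G\<close>. More than
  \<open>card G\<close> of them would be algebraically dependent, which cannot happen along a chain.\<close>

lemma prime_chain_length:
  fixes q :: "nat \<Rightarrow> 'k::field mpoly set"
  assumes q: "\<And>i. i \<le> r \<Longrightarrow> prime_in (Pol V) (q i)" "\<And>i. i < r \<Longrightarrow> q i \<subset> q (Suc i)"
    and G: "finite G" and v: "\<And>v. v \<in> V - G \<Longrightarrow> var v \<in> q 0"
  shows "r \<le> card G"
proof (rule ccontr)
  assume "\<not> r \<le> card G"
  have "\<forall>i. \<exists>b. i < r \<longrightarrow> b \<in> q (Suc i) \<and> b \<notin> q i" using q(2) by blast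
  then obtain b where b: "\<And>i. i < r \<Longrightarrow> b i \<in> q (Suc i) \<and> b i \<notin> q i" by metis
  have q0: "q 0 \<subseteq> q i" if "i \<le> r" for i
    using that
  proof (induction i)
    case (Suc i)
    then show ?case using q(2)[of i] by auto
  qed simp
  define a where "a i = res G (b i)" for i
  have aG: "a i \<in> Pol G" for i by (simp add: a_def)
  have Q: "ideal_in (Pol V) (q i)" if "i \<le> r" for i using q(1)[OF that] by (simp add: prime_in_def)
  have ab: "b i - a i \<in> q 0" if "i < r" for i
  proof -
    have "b i \<in> Pol V" using b[OF that] ideal_inD(1)[OF Q[of "Suc i"]] that by auto
    then show ?thesis unfolding a_def using diff_res_in_ideal[OF _ Q[of 0] v] by simp
  qed
  have a1: "a i \<in> q (Suc i)" if "i < r" for i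
    using ideal_in_Pol_diff[OF Q[of "Suc i"], of "b i" "b i - a i"] b[OF that] ab[OF that] q0[of "Suc i"] that by auto
  have a2: "a i \<notin> q i" if "i < r" for i
    using ideal_inD(3)[OF Q[of i], of "b i - a i" "a i"] b[OF that] ab[OF that] q0[of i] that by auto
  have "card G < r" using \<open>\<not> r \<le> card G\<close> by simp
  from algebraic_dependence[of G r a, OF G aG this]
  obtain E c where E: "finite E" "E \<noteq> {}" "E \<subseteq> extensional {..<r}" "\<forall>m\<in>E. c m \<noteq> 0"
    "(\<Sum>m\<in>E. cst (c m) * (\<Prod>i<r. a i ^ m i)) = 0"
    by (elim exE conjE)
  have "restrict m {0..<r} = m" if "m \<in> E" for m
    using E(3) that extensional_restrict[of m "{..<r}"] by (auto simp: lessThan_atLeast0)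
  then have inj: "inj_on (\<lambda>m. restrict m {0..<r}) E" by (simp add: inj_on_def)
  have sub: "q i \<subseteq> q (Suc i)" if "i < r" for i using q(2)[OF that] by blast
  have "\<forall>E c. finite E \<longrightarrow> E \<noteq> {} \<longrightarrow> (\<forall>m\<in>E. c m \<noteq> 0) \<longrightarrow> inj_on (\<lambda>m. restrict m {0..<r}) E \<longrightarrow>
      (\<Sum>m\<in>E. cst (c m) * (\<Prod>i=0..<r. a i ^ m i)) \<notin> q 0"
    by (rule no_relation_along_prime_chain[of r V q a 0]) (use q(1) sub a1 a2 in auto)
  from this[THEN spec[of _ E], THEN spec[of _ c], THEN mp, THEN mp, THEN mp, THEN mp, OF E(1,2,4) inj]
  have "(\<Sum>m\<in>E. cst (c m) * (\<Prod>i=0..<r. a i ^ m i)) \<notin> q 0" .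
  then show False using E(5) ideal_inD(2)[OF Q[of 0]] by (simp add: lessThan_atLeast0)
qed

section \<open>Maximal ideals meet every coordinate ring\<close>

text \<open>The variables in \<open>T\<close> are algebraically independent modulo the prime \<open>P\<close>.\<close>

locale transcendence_base =
  fixes V T :: "nat set" and P :: "'k::field mpoly set"
  assumes V: "finite V" and TV: "T \<subseteq> V" and P: "prime_in (Pol V) P"
    and indep: "\<And>f. f \<in> Pol T \<Longrightarrow> f \<in> P \<Longrightarrow> f = 0"
begin

lemma P_ideal: "ideal_in (Pol V) P" using P by (simp add: prime_in_def)

lemma PolT_V: "f \<in> Pol T \<Longrightarrow> f \<in> Pol V" using Pol_mono[OF TV] by blast

text \<open>The submodule over \<open>Pol T\<close> that is generated by \<open>E\<close> modulo \<open>P\<close>, as a set of representatives.\<close>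

inductive_set span :: "'k mpoly set \<Rightarrow> 'k mpoly set" for E where
  span_P: "p \<in> P \<Longrightarrow> p \<in> span E"
| span_step: "c \<in> Pol T \<Longrightarrow> e \<in> E \<Longrightarrow> y \<in> span E \<Longrightarrow> c * e + y \<in> span E"

lemma span_0: "0 \<in> span E" by (rule span_P) (rule ideal_inD(2)[OF P_ideal])

lemma span_base: "c \<in> Pol T \<Longrightarrow> e \<in> E \<Longrightarrow> c * e \<in> span E"
  using span_step[OF _ _ span_0] by fastforce

lemma span_P_add: "x \<in> span E \<Longrightarrow> p \<in> P \<Longrightarrow> x + p \<in> span E"
proof (induction rule: span.induct)
  case (span_P q)
  then show ?case by (intro span.span_P ideal_inD(3)[OF P_ideal])
next
  case (span_step c e y)
  then show ?case by (simp add: add.assoc span.span_step)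
qed

lemma span_add: "x \<in> span E \<Longrightarrow> y \<in> span E \<Longrightarrow> x + y \<in> span E"
proof (induction rule: span.induct)
  case (span_P p)
  then show ?case using span_P_add[of y E p] by (simp add: add.commute)
next
  case (span_step c e z)
  then show ?case by (simp add: add.assoc span.span_step)
qed

lemma span_scale: "x \<in> span E \<Longrightarrow> r \<in> Pol T \<Longrightarrow> r * x \<in> span E"
proof (induction rule: span.induct)
  case (span_P p)
  then show ?case by (intro span.span_P ideal_inD(4)[OF P_ideal] PolT_V)
next
  case (span_step c e z)
  then have "(r * c) * e + r * z \<in> span E" by (intro span.span_step) auto
  then show ?case by (simp add: algebra_simps)
qed

lemma span_diff: "x \<in> span E \<Longrightarrow> y \<in> span E \<Longrightarrow> x - y \<in> span E"
  using span_add[of x E "(-1) * y"] span_scale[of y E "-1"] by simp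

lemma span_sum: "(\<And>i. i \<in> A \<Longrightarrow> f i \<in> span E) \<Longrightarrow> sum f A \<in> span E"
  by (induction A rule: infinite_finite_induct) (auto simp: span_0 span_add)

lemma span_sub_V: "x \<in> span E \<Longrightarrow> E \<subseteq> Pol V \<Longrightarrow> x \<in> Pol V"
  by (induction rule: span.induct) (auto simp: PolT_V ideal_inD(1)[OF P_ideal])

lemma span_mult1:
  assumes "y \<in> span F" "F \<subseteq> Pol V" "e \<in> E" "E \<subseteq> Pol V"
  shows "e * y \<in> span {e * f | e f. e \<in> E \<and> f \<in> F}"
  using assms(1)
proof (induction rule: span.induct)
  case (span_P p)
  then show ?case using assms by (intro span.span_P ideal_inD(4)[OF P_ideal]) auto
next
  case (span_step c f z)
  then have "c * (e * f) + e * z \<in> span {e * f | e f. e \<in> E \<and> f \<in> F}"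
    using assms by (intro span.span_step) auto
  then show ?case by (simp add: algebra_simps)
qed

lemma span_mult:
  assumes "x \<in> span E" "y \<in> span F" "E \<subseteq> Pol V" "F \<subseteq> Pol V"
  shows "x * y \<in> span {e * f | e f. e \<in> E \<and> f \<in> F}"
  using assms(1)
proof (induction rule: span.induct)
  case (span_P p)
  then show ?case using assms span_sub_V by (intro span.span_P ideal_inD(5)[OF P_ideal]) auto
next
  case (span_step c e z)
  then have "c * (e * y) + z * y \<in> span {e * f | e f. e \<in> E \<and> f \<in> F}"
    using span_step.IH by (intro span_add span_scale[OF span_mult1 span_step.hyps(1)] assms span_step.hyps)
  then show ?case by (simp add: algebra_simps)
qed

lemma span_insert: "f \<in> span (insert x E) \<Longrightarrow> \<exists>c\<in>Pol T. f - c * x \<in> span E"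
proof (induction rule: span.induct)
  case (span_P p)
  then show ?case using span.span_P by (intro bexI[of _ 0]) auto
next
  case (span_step c e z)
  then obtain c' where c': "c' \<in> Pol T" "z - c' * x \<in> span E" by blast
  show ?case
  proof (cases "e = x")
    case True
    then show ?thesis using c' span_step by (intro bexI[of _ "c + c'"]) (auto simp: algebra_simps)
  next
    case False
    then have "c * e + (z - c' * x) \<in> span E" using span_step c' by (intro span.span_step) auto
    then show ?thesis using c' by (intro bexI[of _ c']) (auto simp: algebra_simps)
  qed
qed

lemma span_empty: "f \<in> span {} \<Longrightarrow> f \<in> P"
  by (induction rule: span.induct) auto

lemma one_mod:
  fixes q :: "'k mpoly"
  assumes "s = 1 + q * a" "s' = 1 + q * b"
  shows "s * s' = 1 + q * (a + b + q * (a * b))"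
  using assms by (simp add: algebra_simps)

text \<open>In the module generated by \<open>1\<close> and \<open>E\<close> modulo \<open>P\<close>, multipliers congruent to \<open>1\<close> modulo \<open>q\<close>
  move every generator into \<open>q\<close> times the module. Generators are eliminated one after the other:
  the relation of \<open>x\<close> reads \<open>(1 + q * (a - c)) * x = q * y\<close> with \<open>y\<close> free of \<open>x\<close>, and the other
  relations are multiplied by this factor, which keeps their form. The relation of the last
  generator \<open>1\<close> is \<open>1 + q * a = q * c\<close>, an identity in \<open>Pol T\<close> by independence.\<close>

lemma nakayama:
  assumes q: "q \<in> Pol T" and E: "finite E"
    and gen: "\<And>e. e \<in> insert 1 E \<Longrightarrow> \<exists>a\<in>Pol T. \<exists>y\<in>span (insert 1 E). (1 + q * a) * e - q * y \<in> P"
  shows "\<exists>r\<in>Pol T. q * r = 1"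
  using E gen
proof (induction E rule: finite_induct)
  case empty
  obtain a y where a: "a \<in> Pol T" "y \<in> span {1}" "(1 + q * a) * 1 - q * y \<in> P"
    using empty(1)[of 1] by blast
  obtain c where c: "c \<in> Pol T" "y - c * 1 \<in> P" using span_insert[of y 1 "{}"] a(2) span_empty by blast
  have "1 + q * a - q * c = ((1 + q * a) * 1 - q * y) + q * (y - c * 1)" by (simp add: algebra_simps)
  also have "\<dots> \<in> P"
    using a(3) c(2) q by (intro ideal_inD(3)[OF P_ideal] ideal_inD(4)[OF P_ideal] PolT_V)
  finally have "1 + q * a - q * c = 0" using a c q by (intro indep) auto
  then have "q * (c - a) = 1" by (simp add: algebra_simps)
  then show ?case using a c by (intro bexI[of _ "c - a"]) auto
next
  case (insert x E)
  have gen': "\<exists>a\<in>Pol T. \<exists>c\<in>Pol T. \<exists>y\<in>span (insert 1 E). (1 + q * a) * e - (q * (c * x) + q * y) \<in> P"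
    if e: "e \<in> insert 1 (insert x E)" for e
  proof -
    obtain a y where a: "a \<in> Pol T" "y \<in> span (insert 1 (insert x E))" "(1 + q * a) * e - q * y \<in> P"
      using insert(4)[OF e] by blast
    have "y \<in> span (insert x (insert 1 E))" using a(2) by (simp add: insert_commute)
    then obtain c where "c \<in> Pol T" "y - c * x \<in> span (insert 1 E)" using span_insert by blast
    then show ?thesis using a
      by (intro bexI[of _ a] bexI[of _ c] bexI[of _ "y - c * x"]) (auto simp: algebra_simps)
  qed
  obtain a c y where x: "a \<in> Pol T" "c \<in> Pol T" "y \<in> span (insert 1 E)"
    "(1 + q * a) * x - (q * (c * x) + q * y) \<in> P" using gen'[of x] by blast
  have "\<exists>a\<in>Pol T. \<exists>y\<in>span (insert 1 E). (1 + q * a) * e - q * y \<in> P" if e: "e \<in> insert 1 E" for e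
  proof -
    obtain b d z where b: "b \<in> Pol T" "d \<in> Pol T" "z \<in> span (insert 1 E)"
      "(1 + q * b) * e - (q * (d * x) + q * z) \<in> P" using gen'[of e] e by blast
    let ?s = "1 + q * (a - c)"
    have s: "?s \<in> Pol V" "q * d \<in> Pol V" using x b q by (auto intro: PolT_V)
    have "(1 + q * ((a - c) + b + q * ((a - c) * b))) * e - q * ((d * q) * y + ?s * z)
        = ?s * ((1 + q * b) * e - (q * (d * x) + q * z))
          + (q * d) * ((1 + q * a) * x - (q * (c * x) + q * y))"
      by (simp add: algebra_simps)
    also have "\<dots> \<in> P"
      by (rule ideal_inD(3)[OF P_ideal]) (rule ideal_inD(4)[OF P_ideal s(1) b(4)], rule ideal_inD(4)[OF P_ideal s(2) x(4)])
    finally have "(1 + q * ((a - c) + b + q * ((a - c) * b))) * e - q * ((d * q) * y + ?s * z) \<in> P" .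
    moreover have "(d * q) * y + ?s * z \<in> span (insert 1 E)"
      using x b q by (intro span_add span_scale) auto
    moreover have "(a - c) + b + q * ((a - c) * b) \<in> Pol T" using x b q by auto
    ultimately show ?thesis by blast
  qed
  then show ?case by (rule insert(3))
qed

text \<open>A variable outside \<open>T\<close> satisfies modulo \<open>P\<close> a polynomial equation over \<open>Pol T\<close>, which becomes
  integral when its leading coefficient is inverted; \<open>h\<close> is the product of these leading
  coefficients. Denominators are cleared by powers of \<open>h\<close>.\<close>

lemma finite_over_localization:
  assumes alg: "\<And>i. i \<in> V - T \<Longrightarrow> \<exists>f. f \<in> Pol (insert i T) \<and> f \<in> P \<and> f \<noteq> 0"
    and W: "finite W" "W \<subseteq> V - T"
  shows "\<exists>h E. h \<in> Pol T \<and> h \<noteq> 0 \<and> finite E \<and> 1 \<in> E \<and> E \<subseteq> Pol V \<and>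
    (\<forall>f\<in>Pol (T \<union> W). \<exists>N. h ^ N * f \<in> span E)"
  using W
proof (induction W rule: finite_induct)
  case empty
  have "\<exists>N. 1 ^ N * f \<in> span {1}" if "f \<in> Pol T" for f using span_base[of f 1 "{1}"] that by simp
  then show ?case by (intro exI[of _ 1] exI[of _ "{1}"]) simp
next
  case (insert i W)
  then have i: "i \<in> V" "i \<notin> T" by auto
  obtain h E where h: "h \<in> Pol T" "h \<noteq> 0" "finite E" "1 \<in> E" "E \<subseteq> Pol V"
    "\<And>f. f \<in> Pol (T \<union> W) \<Longrightarrow> \<exists>N. h ^ N * f \<in> span E" using insert by auto
  obtain g where g: "g \<in> Pol (insert i T)" "g \<in> P" "g \<noteq> 0" using alg[of i] i by blast
  define d where "d = degree (uni i g)"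
  define l where "l = coeff (uni i g) d"
  have gT: "coeff (uni i g) e \<in> Pol T" for e using coeff_uni_Pol[OF g(1), of i e] i by simp
  have l: "l \<in> Pol T" "l \<noteq> 0" using gT g(3) uni_eq_0[of i g] by (auto simp: l_def d_def)
  have gexp: "g = (\<Sum>e\<le>d. coeff (uni i g) e * var i ^ e)" unfolding d_def by (rule uni_expand)
  have d: "d > 0"
  proof (rule ccontr)
    assume "\<not> d > 0"
    then have "g = l" using gexp by (simp add: l_def)
    then show False using indep[of g] g l by simp
  qed
  define F :: "'k mpoly set" where "F = (\<lambda>e. var i ^ e) ` {..<d}"
  have FV: "F \<subseteq> Pol V" using i by (auto simp: F_def)
  have top: "l * var i ^ d \<in> span F"
  proof -
    have "g = (\<Sum>e<d. coeff (uni i g) e * var i ^ e) + l * var i ^ d"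
      using gexp by (simp add: l_def lessThan_Suc_atMost[symmetric])
    then have "l * var i ^ d = g - (\<Sum>e<d. coeff (uni i g) e * var i ^ e)" by (simp add: algebra_simps)
    also have "\<dots> \<in> span F"
      using g gT by (intro span_diff span_sum span_base span_P) (auto simp: F_def)
    finally show ?thesis .
  qed
  have up: "(l * var i) * y \<in> span F" if "y \<in> span F" for y
    using that
  proof (induction rule: span.induct)
    case (span_P p)
    then show ?case using PolT_V[OF l(1)] i by (intro span.span_P ideal_inD(4)[OF P_ideal]) auto
  next
    case (span_step c e z)
    then obtain k where k: "e = var i ^ k" "k < d" by (auto simp: F_def)
    have "c * (l * var i ^ Suc k) \<in> span F"
    proof (cases "Suc k = d")
      case True
      then show ?thesis using top span_step by (metis span_scale)
    next
      case False
      then have "var i ^ Suc k \<in> F" using k by (auto simp: F_def simp del: power_Suc)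
      then show ?thesis using span_base[of "c * l" "var i ^ Suc k" F] span_step l by (simp add: mult.assoc)
    qed
    then have "c * (l * var i ^ Suc k) + (l * var i) * z \<in> span F" using span_step by (intro span_add)
    then show ?case by (simp add: k algebra_simps)
  qed
  have pow: "(l * var i) ^ k \<in> span F" for k
  proof (induction k)
    case 0
    have "(1::'k mpoly) \<in> F" using d by (force simp: F_def)
    then show ?case using span_base[of 1 1 F] by simp
  qed (simp add: up)
  let ?E = "{e * f | e f. e \<in> E \<and> f \<in> F}"
  have "\<exists>N. (h * l) ^ N * f \<in> span ?E" if f: "f \<in> Pol (T \<union> insert i W)" for f
  proof -
    let ?n = "degree (uni i f)" and ?c = "\<lambda>k. coeff (uni i f) k"
    have c: "?c k \<in> Pol (T \<union> W)" for k
      using coeff_uni_Pol[OF f, of i k] Pol_mono[of "T \<union> insert i W - {i}" "T \<union> W"] by blast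
    then have "\<forall>k. \<exists>N. h ^ N * ?c k \<in> span E" using h(6) by blast
    from choice[OF this] obtain N where "\<forall>k. h ^ N k * ?c k \<in> span E" by (rule exE)
    then have N: "h ^ N k * ?c k \<in> span E" for k by (rule spec)
    define K where "K = (\<Sum>k\<le>?n. N k) + ?n"
    have "(h * l) ^ K * (?c k * var i ^ k) \<in> span ?E" if k: "k \<le> ?n" for k
    proof -
      have "N k \<le> (\<Sum>k\<le>?n. N k)" using k by (intro member_le_sum) auto
      then obtain a b where K: "K = a + N k" "K = b + k"
        using k by (metis K_def le_add_diff_inverse2 trans_le_add1 trans_le_add2)
      have "(h * l) ^ K = h ^ K * l ^ K" by (simp add: power_mult_distrib)
      also have "\<dots> = (h ^ a * h ^ N k) * (l ^ b * l ^ k)" using K by (metis power_add)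
      finally have eq: "(h * l) ^ K * (?c k * var i ^ k)
          = (h ^ a * l ^ b) * ((h ^ N k * ?c k) * (l * var i) ^ k)"
        by (simp add: power_mult_distrib mult_ac)
      show ?thesis unfolding eq
        by (rule span_scale[OF span_mult[OF N pow h(5) FV]]) (use h l in auto)
    qed
    then have "(\<Sum>k\<le>?n. (h * l) ^ K * (?c k * var i ^ k)) \<in> span ?E" by (intro span_sum) auto
    then have "(h * l) ^ K * (\<Sum>k\<le>?n. ?c k * var i ^ k) \<in> span ?E" by (simp add: sum_distrib_left)
    then have "(h * l) ^ K * f \<in> span ?E" by (simp only: uni_expand[symmetric])
    then show ?thesis by blast
  qed
  moreover have "h * l \<in> Pol T" "h * l \<noteq> 0" using h l by auto
  moreover have "finite ?E"
  proof -
    have "?E = (\<lambda>(e, f). e * f) ` (E \<times> F)" by auto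
    then show ?thesis using h by (simp add: F_def)
  qed
  moreover have "1 \<in> ?E" using h d by (force simp: F_def intro!: exI[of _ 1])
  moreover have "?E \<subseteq> Pol V" using h(5) FV by (auto intro!: Pol_mult)
  ultimately show ?case by blast
qed

text \<open>If \<open>T\<close> contained \<open>t\<close>, the polynomial \<open>q = 1 + x\<^sub>t * h\<close> would be nonzero, hence not in \<open>P\<close>, hence
  invertible modulo \<open>P\<close>. Modulo \<open>q\<close> the denominator \<open>h\<close> is a unit, so that the finiteness over the
  localization at \<open>h\<close> lets Nakayama's lemma apply to \<open>q\<close>: it would be a unit of \<open>Pol T\<close>, although its
  degree in \<open>x\<^sub>t\<close> is positive.\<close>

lemma T_empty:
  assumes alg: "\<And>i. i \<in> V - T \<Longrightarrow> \<exists>f. f \<in> Pol (insert i T) \<and> f \<in> P \<and> f \<noteq> 0"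
    and inv: "\<And>q. q \<in> Pol V \<Longrightarrow> q \<notin> P \<Longrightarrow> \<exists>g\<in>Pol V. g * q - 1 \<in> P"
  shows "T = {}"
proof (rule ccontr)
  assume "T \<noteq> {}"
  then obtain t where t: "t \<in> T" by blast
  obtain h E where h: "h \<in> Pol T" "h \<noteq> 0" "finite E" "1 \<in> E" "E \<subseteq> Pol V"
    "\<And>f. f \<in> Pol (T \<union> (V - T)) \<Longrightarrow> \<exists>N. h ^ N * f \<in> span E"
    using finite_over_localization[OF alg, of "V - T"] V by auto
  have TVV: "T \<union> (V - T) = V" using TV by blast
  define q where "q = 1 + var t * h"
  have q: "q \<in> Pol T" using h t by (simp add: q_def)
  have deg: "degree (uni t q * uni t r) > 0" if "r \<noteq> 0" for r
  proof -
    have "uni t q = 1 + [:0, 1:] * uni t h" by (simp add: q_def uni_add uni_mult uni_var)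
    moreover have "uni t h \<noteq> 0" using h uni_eq_0 by blast
    then have "degree ([:0, 1:] * uni t h) > 0" by (subst degree_mult_eq) auto
    then have "degree (1 + [:0, 1:] * uni t h) > 0"
      by (subst degree_add_eq_right) auto
    ultimately have "degree (uni t q) > 0" by simp
    moreover have "uni t r \<noteq> 0" using that uni_eq_0 by blast
    ultimately show ?thesis by (subst degree_mult_eq) auto
  qed
  have nounit: "q * r \<noteq> 1" for r
  proof
    assume *: "q * r = 1"
    then have "r \<noteq> 0" by auto
    then have "degree (uni t q * uni t r) > 0" by (rule deg)
    moreover have "uni t q * uni t r = 1" using * by (simp flip: uni_mult)
    ultimately show False by simp
  qed
  have "q \<noteq> 0"
  proof
    assume "q = 0"
    then show False using deg[of 1] by simp
  qed
  then have "q \<notin> P" using indep[OF q] by blast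
  then obtain g where g: "g \<in> Pol V" "g * q - 1 \<in> P" using inv[OF PolT_V[OF q]] by blast
  have "\<exists>a\<in>Pol T. \<exists>y\<in>span (insert 1 E). (1 + q * a) * e - q * y \<in> P" if "e \<in> insert 1 E" for e
  proof -
    have e: "e \<in> Pol V" using that h by auto
    obtain N where N: "h ^ N * (g * e) \<in> span E" using h(6)[of "g * e"] g e TVV by auto
    have "h ^ N * e - q * (h ^ N * (g * e)) = - ((h ^ N * e) * (g * q - 1))" by (simp add: algebra_simps)
    also have "\<dots> \<in> P"
      using g e PolT_V[OF h(1)] by (intro ideal_in_Pol_uminus[OF P_ideal] ideal_inD(4)[OF P_ideal]) auto
    finally have p: "h ^ N * e - q * (h ^ N * (g * e)) \<in> P" .
    \<comment> \<open>since \<open>q = 1 + x\<^sub>t * h\<close>, the product \<open>- x\<^sub>t * h\<close> is congruent to \<open>1\<close> modulo \<open>q\<close>\<close>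
    obtain a where a: "a \<in> Pol T" "(- var t * h) ^ N = 1 + q * a"
    proof -
      have "\<exists>a\<in>Pol T. (- var t * h) ^ N = 1 + q * a"
      proof (induction N)
        case (Suc N)
        then obtain a where a: "a \<in> Pol T" "(- var t * h) ^ N = 1 + q * a" by blast
        have "- var t * h = 1 + q * (-1)" by (simp add: q_def)
        then have "(- var t * h) ^ Suc N = 1 + q * (-1 + a + q * (-1 * a))"
          using one_mod[of "- var t * h" q "-1" "(- var t * h) ^ N" a] a by simp
        then show ?case using a q by (intro bexI[of _ "-1 + a + q * (-1 * a)"]) auto
      qed (auto intro!: bexI[of _ 0])
      then show ?thesis using that by blast
    qed
    define u where "u = (- var t :: 'k mpoly) ^ N"
    have u: "u \<in> Pol T" using t by (simp add: u_def)
    have ua: "u * h ^ N = 1 + q * a" using a(2) unfolding u_def by (simp only: power_mult_distrib)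
    have "u * (h ^ N * e - q * (h ^ N * (g * e))) \<in> P"
      using p by (intro ideal_inD(4)[OF P_ideal] PolT_V[OF u])
    also have "u * (h ^ N * e - q * (h ^ N * (g * e))) = (1 + q * a) * e - q * (u * (h ^ N * (g * e)))"
      unfolding ua[symmetric] by (simp add: algebra_simps)
    finally have "(1 + q * a) * e - q * (u * (h ^ N * (g * e))) \<in> P" .
    moreover have "u * (h ^ N * (g * e)) \<in> span (insert 1 E)"
      using span_scale[OF N u] h(4) by (simp add: insert_absorb)
    ultimately show ?thesis using a by blast
  qed
  then obtain r where "q * r = 1" using nakayama[OF q h(3)] by blast
  then show False using nounit by blast
qed

end

text \<open>Hilbert's Nullstellensatz over an arbitrary field: the coordinates of the residue field at a
  maximal ideal are algebraic. Otherwise \<open>{i}\<close> extends to a maximal set of variables that are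
  independent modulo \<open>P\<close>, and such a set is empty.\<close>

theorem maximal_ideal_meets_coordinate_ring:
  fixes P :: "'k::field mpoly set"
  assumes V: "finite V" and P: "prime_in (Pol V) P"
    and inv: "\<And>q. q \<in> Pol V \<Longrightarrow> q \<notin> P \<Longrightarrow> \<exists>g\<in>Pol V. g * q - 1 \<in> P" and i: "i \<in> V"
  shows "\<exists>f\<in>Pol {i}. f \<noteq> 0 \<and> f \<in> P"
proof (rule ccontr)
  assume no: "\<not> ?thesis"
  let ?I = "{T. T \<subseteq> V \<and> (\<forall>f\<in>Pol T. f \<in> P \<longrightarrow> f = 0)}"
  have "finite ?I" using V by (auto intro: finite_subset[of _ "Pow V"])
  moreover have "{i} \<in> ?I" using no i by blast
  ultimately have "\<exists>T\<in>?I. {i} \<subseteq> T \<and> (\<forall>U\<in>?I. T \<subseteq> U \<longrightarrow> T = U)" by (rule finite_has_maximal2)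
  then obtain T where T: "T \<in> ?I" "{i} \<subseteq> T" and max0: "\<forall>U\<in>?I. T \<subseteq> U \<longrightarrow> T = U" by (elim bexE conjE)
  have max: "U = T" if "U \<in> ?I" "T \<subseteq> U" for U using max0[rule_format, OF that] by simp
  interpret transcendence_base V T P using V P T by unfold_locales auto
  have "T = {}"
  proof (rule T_empty)
    fix j assume j: "j \<in> V - T"
    then have "insert j T \<notin> ?I" using max[of "insert j T"] by auto
    then show "\<exists>f. f \<in> Pol (insert j T) \<and> f \<in> P \<and> f \<noteq> 0" using j T by auto
  qed (rule inv)
  then show False using T by simp
qed

section \<open>Face ideals\<close>

lemma var_neq_0 [simp]: "var i \<noteq> (0 :: 'k::field mpoly)"
  unfolding var_def by (metis lookup_single_eq lookup_zero zero_neq_one)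

definition face_ideal :: "nat set \<Rightarrow> nat set set \<Rightarrow> 'k::field mpoly set" where
  "face_ideal V Fs = {p \<in> Pol V. \<forall>F\<in>Fs. res F p = 0}"

lemma face_ideal_ideal: "ideal_in (Pol V) (face_ideal V Fs)"
  by (auto simp: ideal_in_def face_ideal_def res_add res_mult)

lemma coeff_stable_face_ideal: "(\<And>F. F \<in> Fs \<Longrightarrow> t \<in> F) \<Longrightarrow> coeff_stable t (face_ideal V Fs)"
  unfolding coeff_stable_def face_ideal_def
  using coeff_uni_Pol[of _ V t] Pol_mono[of "V - {t}" V] by (auto simp: res_coeff_uni)

lemma coeff_stable_0: "coeff_stable t {0}"
  by (simp add: coeff_stable_def)

lemma coeff_stable_ext:
  assumes "coeff_stable t J" "\<And>a. a \<in> set as \<Longrightarrow> \<exists>W. a \<in> Pol W \<and> t \<notin> W"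
  shows "coeff_stable t (ideal_ext (Pol V) J as)"
  using assms(2)
proof (induction as rule: rev_induct)
  case (snoc a as)
  then obtain W where "a \<in> Pol W" "t \<notin> W" by auto
  then show ?case using snoc coeff_stable_ideal_plus[of t "ideal_ext (Pol V) J as" a W V] by auto
qed (use assms(1) in simp)

lemma prime_in_prod:
  assumes Q: "prime_in (Pol V) Q" and "finite A" "\<And>i. i \<in> A \<Longrightarrow> f i \<in> Pol V" "prod f A \<in> Q"
  shows "\<exists>i\<in>A. f i \<in> Q"
  using assms(2-)
proof (induction A rule: finite_induct)
  case (insert i A)
  have "prod f A \<in> Pol V" using insert by auto
  then have "f i \<in> Q \<or> prod f A \<in> Q" using Q insert by (auto simp: prime_in_def)
  then show ?case using insert by auto
qed (use Q in \<open>simp add: prime_in_def\<close>)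

lemma res_prod: "res F (prod f A) = (\<Prod>i\<in>A. res F (f i))"
  by (induction A rule: infinite_finite_induct) (auto simp: res_mult)

text \<open>Otherwise the product of all variables outside \<open>Q\<close> vanishes on every face and so lies in the
  prime \<open>Q\<close>.\<close>

lemma prime_over_face_ideal:
  assumes V: "finite V" and Q: "prime_in (Pol V) Q" "face_ideal V Fs \<subseteq> Q"
  shows "\<exists>F\<in>Fs. \<forall>v\<in>V - F. var v \<in> Q"
proof (rule ccontr)
  assume no: "\<not> ?thesis"
  define G where "G = {v\<in>V. var v \<notin> Q}"
  have "finite G" using V by (simp add: G_def)
  have "(\<Prod>v\<in>G. var v) \<in> face_ideal V Fs"
    unfolding face_ideal_def
  proof (intro CollectI conjI ballI)
    fix F assume "F \<in> Fs"
    then obtain v where "v \<in> G" "v \<notin> F" using no by (auto simp: G_def)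
    then show "res F (\<Prod>v\<in>G. var v) = 0"
      using \<open>finite G\<close> by (auto simp: res_prod res_var)
  qed (auto simp: G_def)
  then have "(\<Prod>v\<in>G. var v) \<in> Q" using Q by blast
  then obtain v where "v \<in> G" "var v \<in> Q"
    using prime_in_prod[OF Q(1) \<open>finite G\<close>, of var] by (auto simp: G_def)
  then show False by (simp add: G_def)
qed

lemma res_0_in_prime:
  assumes Q: "prime_in (Pol V) Q" and F: "\<forall>v\<in>V - F. var v \<in> Q" and p: "p \<in> Pol V" "res F p = 0"
  shows "p \<in> Q"
  using diff_res_in_ideal[OF p(1), of Q F] Q F p by (simp add: prime_in_def)

text \<open>The coefficient of a monomial is copied from any face that contains its support; agreement on
  intersections makes the choice irrelevant.\<close>

lemma glue_along_faces:
  fixes e :: "'i \<Rightarrow> 'k::field mpoly"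
  assumes K: "finite K" and e: "\<And>k. k \<in> K \<Longrightarrow> e k \<in> Pol (F k)" and FV: "\<And>k. k \<in> K \<Longrightarrow> F k \<subseteq> V"
    and agree: "\<And>k l. k \<in> K \<Longrightarrow> l \<in> K \<Longrightarrow> res (F k \<inter> F l) (e k) = res (F k \<inter> F l) (e l)"
  shows "\<exists>p\<in>Pol V. \<forall>k\<in>K. res (F k) p = e k"
proof -
  define s where "s m = (SOME k. k \<in> K \<and> keys m \<subseteq> F k)" for m :: monomial
  have s: "s m \<in> K \<and> keys m \<subseteq> F (s m)" if "k \<in> K" "keys m \<subseteq> F k" for m k
    unfolding s_def by (rule someI[of _ k]) (use that in simp)
  define c where "c m = (if \<exists>k\<in>K. keys m \<subseteq> F k then lookup (e (s m)) m else 0)" for m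
  have "{m. c m \<noteq> 0} \<subseteq> (\<Union>k\<in>K. keys (e k))"
  proof
    fix m assume "m \<in> {m. c m \<noteq> 0}"
    then obtain k where "k \<in> K" "keys m \<subseteq> F k" "lookup (e (s m)) m \<noteq> 0"
      by (auto simp: c_def split: if_splits)
    then show "m \<in> (\<Union>k\<in>K. keys (e k))" using s by (auto simp: in_keys_iff)
  qed
  then have fin: "finite {m. c m \<noteq> 0}" using K by (auto intro: finite_subset)
  define p where "p = Abs_poly_mapping c"
  have lp: "lookup p m = c m" for m using fin by (simp add: p_def)
  have "p \<in> Pol V" using FV by (auto simp: Pol_iff lp c_def split: if_splits)
  moreover have "res (F k) p = e k" if k: "k \<in> K" for k
  proof (rule poly_mapping_eqI)
    fix m
    show "lookup (res (F k) p) m = lookup (e k) m"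
    proof (cases "keys m \<subseteq> F k")
      case True
      then have sm: "s m \<in> K" "keys m \<subseteq> F k \<inter> F (s m)" using s k by auto
      have "lookup (res (F k \<inter> F (s m)) (e k)) m = lookup (res (F k \<inter> F (s m)) (e (s m))) m"
        using agree[OF k sm(1)] by simp
      then show ?thesis using True k sm by (auto simp: lookup_res lp c_def)
    next
      case False
      then have "lookup (e k) m = 0" using e[OF k] by (auto simp: Pol_iff)
      then show ?thesis using False by (simp add: lookup_res)
    qed
  qed
  ultimately show ?thesis by blast
qed

lemma monomial_ideal_eq:
  assumes V: "\<And>s. s \<in> S \<Longrightarrow> keys s \<subseteq> V"
  shows "(monomial_ideal V S :: 'k::field mpoly set)
    = {p \<in> Pol V. \<forall>m\<in>keys p. \<exists>s\<in>S. \<forall>i. lookup s i \<le> lookup m i}" (is "_ = ?J")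
proof
  interpret cring "mpoly_ring V :: 'k mpoly ring" by (rule cring_mpoly_ring)
  let ?g = "(\<lambda>m. term_of m (1::'k)) ` S"
  have gV: "?g \<subseteq> carrier (mpoly_ring V)" using V by (auto simp: mpoly_ring_simps intro!: Pol_term)
  have "ideal_in (Pol V) ?J"
    unfolding ideal_in_def
  proof (intro conjI ballI)
    show "?J \<subseteq> Pol V" "0 \<in> ?J" by auto
    show "x + y \<in> ?J" if "x \<in> ?J" "y \<in> ?J" for x y using that keys_add[of x y] by auto
    show "r * x \<in> ?J" if r: "r \<in> Pol V" "x \<in> ?J" for r x
    proof (intro CollectI conjI ballI)
      show "r * x \<in> Pol V" using r by auto
      fix m assume "m \<in> keys (r * x)"
      then obtain a b where ab: "m = a + b" "b \<in> keys x" using keys_mult[of r x] by blast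
      then obtain s where "s \<in> S" "\<forall>i. lookup s i \<le> lookup b i" using r by auto
      then show "\<exists>s\<in>S. \<forall>i. lookup s i \<le> lookup m i"
        unfolding ab(1) by (auto simp: lookup_add intro: trans_le_add2)
    qed
  qed
  moreover have "?g \<subseteq> ?J" using V by (auto intro!: Pol_term)
  ultimately show "monomial_ideal V S \<subseteq> ?J"
    unfolding monomial_ideal_def by (intro genideal_minimal ideal_mpoly_ring)
  have J: "ideal_in (Pol V) (monomial_ideal V S :: 'k mpoly set)"
    unfolding monomial_ideal_def by (rule ideal_in_of_ideal) (rule genideal_ideal[OF gV])
  show "?J \<subseteq> monomial_ideal V S"
  proof
    fix p assume p: "p \<in> ?J"
    have "term_of m (lookup p m) \<in> monomial_ideal V S" if m: "m \<in> keys p" for m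
    proof -
      obtain s where s: "s \<in> S" "\<forall>i. lookup s i \<le> lookup m i" using p m by auto
      have "m = s + (m - s)"
        using s by (intro poly_mapping_eqI) (simp add: lookup_add lookup_minus)
      then have "term_of m (lookup p m) = term_of (m - s) (lookup p m) * term_of s 1"
        by (simp add: mult_single add.commute)
      moreover have "term_of s (1 :: 'k) \<in> monomial_ideal V S"
        unfolding monomial_ideal_def by (rule subsetD[OF genideal_self[OF gV] imageI[OF s(1)]])
      moreover have "keys (m - s) \<subseteq> V"
      proof -
        have "keys (m - s) \<subseteq> keys m" by (auto simp: in_keys_iff lookup_minus)
        then show ?thesis using p m by (auto simp: Pol_def)
      qed
      ultimately show ?thesis by (simp add: ideal_inD(4)[OF J Pol_term])
    qed
    then have "(\<Sum>m\<in>keys p. term_of m (lookup p m)) \<in> monomial_ideal V S"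
      by (intro ideal_in_sum[OF J])
    then show "p \<in> monomial_ideal V S" by (simp add: mpoly_sum_terms)
  qed
qed

lemma lookup_sum_X: "finite F \<Longrightarrow> lookup (\<Sum>i\<in>F. X i) j = (if j \<in> F then 1 else 0)"
proof -
  assume F: "finite F"
  have "lookup (\<Sum>i\<in>F. X i) j = (\<Sum>i\<in>F. if i = j then 1 else 0)"
    unfolding lookup_sum by (rule sum.cong) (auto simp: lookup_single)
  then show ?thesis using F by simp
qed

lemma keys_sum_X: "finite F \<Longrightarrow> keys (\<Sum>i\<in>F. X i) = F"
  by (auto simp: in_keys_iff lookup_sum_X split: if_splits simp del: One_nat_def)

text \<open>Both ideals are spanned by the monomials whose support is not a face. The description by
  restrictions replaces ideal membership by the vanishing of polynomials.\<close>

lemma stanley_reisner_ideal_eq: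
  assumes V: "finite V" and \<Delta>: "simplicial_complex V \<Delta>"
  shows "(stanley_reisner_ideal V \<Delta> :: 'k::field mpoly set) = face_ideal V \<Delta>"
proof -
  let ?S = "{\<Sum>i\<in>F. X i | F. F \<subseteq> V \<and> F \<notin> \<Delta>}"
  have fin: "finite F" if "F \<subseteq> V" for F using V that by (rule finite_subset[rotated])
  have dvd: "(\<exists>s\<in>?S. \<forall>i. lookup s i \<le> lookup m i) \<longleftrightarrow> keys m \<notin> \<Delta>" if m: "keys m \<subseteq> V" for m
  proof
    assume "\<exists>s\<in>?S. \<forall>i. lookup s i \<le> lookup m i"
    then obtain F where F: "F \<subseteq> V" "F \<notin> \<Delta>" "\<forall>i. lookup (\<Sum>i\<in>F. X i) i \<le> lookup m i" by blast
    then have "\<forall>i. (if i \<in> F then 1 else 0) \<le> lookup m i" using lookup_sum_X[OF fin[OF F(1)]] by simp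
    then have "F \<subseteq> keys m" by (force simp: in_keys_iff split: if_splits)
    then show "keys m \<notin> \<Delta>" using F(2) \<Delta> by (auto simp: simplicial_complex_def)
  next
    assume "keys m \<notin> \<Delta>"
    then have "(\<Sum>i\<in>keys m. X i) \<in> ?S" using m by blast
    moreover have "lookup (\<Sum>i\<in>keys m. X i) i \<le> lookup m i" for i
      using lookup_sum_X[of "keys m" i] by (auto simp: in_keys_iff)
    ultimately show "\<exists>s\<in>?S. \<forall>i. lookup s i \<le> lookup m i" by blast
  qed
  have "(stanley_reisner_ideal V \<Delta> :: 'k mpoly set) = {p \<in> Pol V. \<forall>m\<in>keys p. \<exists>s\<in>?S. \<forall>i. lookup s i \<le> lookup m i}"
    unfolding stanley_reisner_ideal_def using keys_sum_X[OF fin] by (intro monomial_ideal_eq) blast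
  also have "\<dots> = {p \<in> Pol V. \<forall>m\<in>keys p. keys m \<notin> \<Delta>}"
    using dvd unfolding Pol_def by blast
  also have "\<dots> = face_ideal V \<Delta>"
  proof -
    have "(\<forall>m\<in>keys p. keys m \<notin> \<Delta>) \<longleftrightarrow> (\<forall>F\<in>\<Delta>. res F p = 0)" for p :: "'k mpoly"
    proof
      assume *: "\<forall>m\<in>keys p. keys m \<notin> \<Delta>"
      show "\<forall>F\<in>\<Delta>. res F p = 0"
      proof (intro ballI poly_mapping_eqI)
        fix F and m :: monomial assume F: "F \<in> \<Delta>"
        have "keys m \<subseteq> F \<Longrightarrow> keys m \<in> \<Delta>" using F \<Delta> by (auto simp: simplicial_complex_def)
        then show "lookup (res F p) m = lookup 0 m"
          using * by (auto simp: lookup_res in_keys_iff)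
      qed
    next
      assume *: "\<forall>F\<in>\<Delta>. res F p = 0"
      show "\<forall>m\<in>keys p. keys m \<notin> \<Delta>"
      proof (intro ballI notI)
        fix m assume m: "m \<in> keys p" "keys m \<in> \<Delta>"
        then have "lookup (res (keys m) p) m = 0" using * by simp
        then show False using m by (simp add: lookup_res in_keys_iff)
      qed
    qed
    then show ?thesis by (auto simp: face_ideal_def)
  qed
  finally show ?thesis .
qed

lemma face_ideal_cong:
  assumes "\<And>F. F \<in> \<Delta> \<Longrightarrow> \<exists>G\<in>Fs. F \<subseteq> G" "Fs \<subseteq> \<Delta>"
  shows "(face_ideal V \<Delta> :: 'k::field mpoly set) = face_ideal V Fs"
proof -
  have "res F p = 0" if "F \<subseteq> G" "res G p = 0" for F G and p :: "'k mpoly"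
    using res_res[of F G p] that by (simp add: Int_absorb2)
  then have "(\<forall>F\<in>\<Delta>. res F p = 0) \<longleftrightarrow> (\<forall>F\<in>Fs. res F p = 0)" for p :: "'k mpoly"
    using assms by (meson subsetD)
  then show ?thesis by (simp add: face_ideal_def)
qed

section \<open>Cohen-Macaulay complexes\<close>

context quotient_at_maximal
begin

lemma coordinate_in_P:
  assumes "finite V" "i \<in> V" shows "\<exists>f\<in>Pol {i}. f \<noteq> 0 \<and> f \<in> P"
  using maximal_ideal_meets_coordinate_ring[OF assms(1) prime_P inverse_mod_P assms(2)] by blast

lemma krull_dim_face_ring:
  assumes V: "finite V" and IF: "I = face_ideal V Fs" and Fs: "\<And>F. F \<in> Fs \<Longrightarrow> finite F \<and> card F \<le> d"
  shows "krull_dim (localization A S) \<le> enat d"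
proof (rule lq.krull_dim_le_chain)
  fix r q assume q: "\<And>i. i \<le> r \<Longrightarrow> prime_in (Pol V) (q i) \<and> I \<subseteq> q i" "\<And>i. i < r \<Longrightarrow> q i \<subset> q (Suc i)"
  have "prime_in (Pol V) (q 0)" "face_ideal V Fs \<subseteq> q 0" using q(1)[of 0] IF by auto
  then obtain F where "F \<in> Fs" "\<forall>v\<in>V - F. var v \<in> q 0" using prime_over_face_ideal[OF V] by blast
  then show "r \<le> d" using prime_chain_length[of r V q F] q Fs by (meson order_trans)
qed

lemma cohen_macaulay_localI:
  assumes as: "set as \<subseteq> P"
    and reg: "\<And>i f. i < length as \<Longrightarrow> f \<in> Pol V \<Longrightarrow> as ! i * f \<in> ideal_ext (Pol V) I (take i as) \<Longrightarrow>
      f \<in> ideal_ext (Pol V) I (take i as)"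
    and dim: "krull_dim (localization A S) \<le> enat (length as)"
  shows "cohen_macaulay_local (localization A S)"
proof -
  let ?xs = "map (\<lambda>a. frac a 1) as"
  have "regular_sequence (localization A S) ?xs" by (rule lq.regular_sequence_fr[OF as reg])
  moreover have "set ?xs \<subseteq> lq.M" using as ideal_inD(1)[OF ideal_P] D1 by (auto simp: lq.fr_in_M lq.D_iff)
  ultimately have "enat (length ?xs) \<le> ideal_depth (localization A S) lq.M"
    unfolding ideal_depth_def by (intro SUP_upper) auto
  then have "ideal_depth (localization A S) lq.M = krull_dim (localization A S)"
    using dim ideal_depth_le_krull_dim[OF lq.cring_B, of lq.M] by simp
  then show ?thesis using lq.local_ring_B by (auto simp: cohen_macaulay_local_def)
qed

end

lemma cohen_macaulay_complexI:
  assumes V: "finite V" and \<Delta>: "simplicial_complex V \<Delta>"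
    and *: "\<And>Pm. quotient_at_maximal V (face_ideal V \<Delta>) (mpoly_ring V Quot face_ideal V \<Delta>) Pm \<Longrightarrow>
      cohen_macaulay_local (localization (mpoly_ring V Quot face_ideal V \<Delta>)
        (carrier (mpoly_ring V Quot (face_ideal V \<Delta> :: 'k::field mpoly set)) - Pm))"
  shows "cohen_macaulay_complex TYPE('k) V \<Delta>"
  unfolding cohen_macaulay_complex_def cohen_macaulay_ring_def stanley_reisner_ring_def
    stanley_reisner_ideal_eq[OF V \<Delta>]
  by (intro allI impI *) (auto simp: quotient_at_maximal_def quotient_at_maximal_axioms_def mpoly_quotient_def face_ideal_ideal)

text \<open>The local rings have dimension at most one, and at each point the element \<open>f = (\<Sum>v. x\<^sub>v * \<phi>\<^sub>v)\<close>
  restricts to the nonzero polynomial \<open>x\<^sub>v * \<phi>\<^sub>v\<close>, hence is regular. The factor \<open>\<phi>\<^sub>v\<close> puts \<open>f\<close> into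
  the given maximal ideal, the factor \<open>x\<^sub>v\<close> makes it vanish on the other points.\<close>

theorem cohen_macaulay_points:
  assumes V: "finite V" and \<Delta>: "\<Delta> = insert {} ((\<lambda>v. {v}) ` V)" and ne: "V \<noteq> {}"
  shows "cohen_macaulay_complex TYPE('k::field) V \<Delta>"
proof (rule cohen_macaulay_complexI[OF V])
  show "simplicial_complex V \<Delta>"
    using \<Delta> by (auto simp: simplicial_complex_def subset_singleton_iff)
  let ?I = "face_ideal V \<Delta> :: 'k mpoly set"
  fix Pm assume "quotient_at_maximal V ?I (mpoly_ring V Quot ?I) Pm"
  then interpret quotient_at_maximal V ?I "mpoly_ring V Quot ?I" Pm .
  let ?Fs = "(\<lambda>v. {v}) ` V"
  have IF: "?I = face_ideal V ?Fs" using \<Delta> ne by (intro face_ideal_cong) auto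
  have "\<forall>i\<in>V. \<exists>f\<in>Pol {i}. f \<noteq> 0 \<and> f \<in> P" using coordinate_in_P[OF V] by blast
  then obtain \<phi> where \<phi>: "\<And>i. i \<in> V \<Longrightarrow> \<phi> i \<in> Pol {i} \<and> \<phi> i \<noteq> 0 \<and> \<phi> i \<in> P" by metis
  define f where "f = (\<Sum>v\<in>V. var v * \<phi> v)"
  have resf: "res {v} f = var v * \<phi> v" if v: "v \<in> V" for v
  proof -
    have "res {v} (var w * \<phi> w) = (if w = v then var v * \<phi> v else 0)" if "w \<in> V" for w
      using \<phi>[OF that] by (auto simp: res_mult res_var res_id)
    then have "res {v} f = (\<Sum>w\<in>V. if w = v then var v * \<phi> v else 0)"
      unfolding f_def res_sum by (intro sum.cong) auto
    then show ?thesis using v V by simp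
  qed
  have fP: "f \<in> P" unfolding f_def using \<phi> by (intro ideal_in_sum[OF ideal_P] ideal_inD(4)[OF ideal_P]) auto
  have "cohen_macaulay_local (localization (mpoly_ring V Quot ?I) S)"
  proof (rule cohen_macaulay_localI[of "[f]"])
    show "set [f] \<subseteq> P" using fP by simp
    show "krull_dim (localization (mpoly_ring V Quot ?I) S) \<le> enat (length [f])"
      by (rule krull_dim_face_ring[OF V IF]) auto
    fix i g assume "i < length [f]" "g \<in> Pol V" "[f] ! i * g \<in> ideal_ext (Pol V) ?I (take i [f])"
    moreover have "var v * \<phi> v \<noteq> 0" if "v \<in> V" for v
      using \<phi>[OF that] by simp
    ultimately show "g \<in> ideal_ext (Pol V) ?I (take i [f])"
      unfolding IF by (auto simp: face_ideal_def res_mult resf)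
  qed
  then show "cohen_macaulay_local (localization (mpoly_ring V Quot ?I)
      (carrier (mpoly_ring V Quot ?I) - Pm))" by (simp add: S_def)
qed

text \<open>The join of a simplex \<open>T\<close> with a connected bipartite graph. Edges are pairs of a red and a
  blue vertex; connectedness says that any two edges are linked by a sequence of edges in which
  neighbours share an endpoint.\<close>

locale bipartite_join =
  fixes V T :: "nat set" and Es :: "(nat \<times> nat) set"
  assumes V: "finite V" and T: "T \<subseteq> V" and EsV: "Es \<subseteq> V \<times> V" and Es: "Es \<noteq> {}"
    and disj: "\<And>r b r' b'. (r, b) \<in> Es \<Longrightarrow> (r', b') \<in> Es \<Longrightarrow> r \<notin> T \<and> b \<notin> T \<and> r \<noteq> b'"
    and conn: "\<And>e e'. e \<in> Es \<Longrightarrow> e' \<in> Es \<Longrightarrow>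
      (e, e') \<in> {(e, e'). e \<in> Es \<and> e' \<in> Es \<and> (fst e = fst e' \<or> snd e = snd e')}\<^sup>*"
begin

definition facet :: "nat \<times> nat \<Rightarrow> nat set" where "facet e = insert (fst e) (insert (snd e) T)"

abbreviation J :: "'k::field mpoly set" where "J \<equiv> face_ideal V (facet ` Es)"

text \<open>Such a function sees only the vertex of one colour on every facet. The two colours provide the
  first two elements of a regular sequence.\<close>

definition coloured :: "(nat \<times> nat \<Rightarrow> nat) \<Rightarrow> 'k::field mpoly \<Rightarrow> bool" where
  "coloured c f \<longleftrightarrow> f \<in> Pol V \<and> (\<forall>e\<in>Es. res (facet e) f \<in> Pol {c e} \<and> res (facet e) f \<noteq> 0)"

lemma facet_V: "e \<in> Es \<Longrightarrow> facet e \<subseteq> V" using T EsV by (auto simp: facet_def)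

lemma fin_Es: "finite Es" using V EsV by (auto intro: finite_subset)

lemma card_facet: "e \<in> Es \<Longrightarrow> card (facet e) = card T + 2"
proof -
  assume e: "e \<in> Es"
  then have "fst e \<notin> T" "snd e \<notin> T" "fst e \<noteq> snd e"
    using disj[of "fst e" "snd e" "fst e" "snd e"] by auto
  moreover have "finite T" using T V by (rule finite_subset)
  ultimately show ?thesis by (simp add: facet_def)
qed

lemma J_ideal: "ideal_in (Pol V) J" by (rule face_ideal_ideal)

lemma coloured_regular_1:
  assumes "coloured c f" "a \<in> Pol V" "f * a \<in> J" shows "a \<in> J"
  using assms by (auto simp: coloured_def face_ideal_def res_mult)

text \<open>Facets with the same vertex of colour \<open>c\<close> carry the same nonzero restriction of \<open>f\<close>, by which one
  may divide on their intersection.\<close>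

lemma common_quotient:
  assumes f: "coloured c f" and e: "e \<in> Es" "e' \<in> Es" "c e = c e'" "c e \<in> facet e" "c e' \<in> facet e'"
    and a: "res (facet e) a = res (facet e) f * x" "res (facet e') a = res (facet e') f * y"
  shows "res (facet e \<inter> facet e') x = res (facet e \<inter> facet e') y"
proof -
  let ?H = "facet e \<inter> facet e'"
  have fe: "res (facet e) f \<in> Pol {c e}" "res (facet e) f \<noteq> 0" using f e by (auto simp: coloured_def)
  have "res ?H f = res ?H (res (facet e) f)" by (simp add: res_res Int_ac)
  also have "\<dots> = res (facet e) f" by (rule res_id[OF fe(1)]) (use e in auto)
  finally have nz: "res ?H f \<noteq> 0" using fe by simp
  have "res ?H a = res ?H f * res ?H x" "res ?H a = res ?H f * res ?H y"
    using arg_cong[OF a(1), of "res ?H"] arg_cong[OF a(2), of "res ?H"]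
    by (simp_all add: res_res res_mult Int_ac)
  then show ?thesis using nz by simp
qed

text \<open>On one facet \<open>f\<close> and \<open>g\<close> are polynomials in different variables, so \<open>a\<close> is there a multiple
  \<open>f * q\<^sub>e\<close>. The quotients \<open>q\<^sub>e\<close> agree for edges with a common red vertex, because \<open>f\<close> is the same
  there, and for edges with a common blue vertex, because \<open>q\<^sub>e\<close> is also a quotient by \<open>g\<close>. Facets of
  disjoint edges meet in \<open>T\<close>, and connectedness carries the value on \<open>T\<close> from edge to edge. Thus
  the quotients glue.\<close>

lemma coloured_regular_2:
  assumes f: "coloured fst f" and g: "coloured snd g" and a: "a \<in> Pol V"
    and ga: "g * a \<in> ideal_plus (Pol V) J f"
  shows "a \<in> ideal_plus (Pol V) J f"
proof -
  obtain x c where x: "g * a = x + f * c" "x \<in> J" "c \<in> Pol V" using ga by (auto simp: ideal_plus_def)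
  have eq: "res (facet e) g * res (facet e) a = res (facet e) f * res (facet e) c" if "e \<in> Es" for e
    using arg_cong[OF x(1), of "res (facet e)"] x(2) that by (simp add: res_mult res_add face_ideal_def)
  have "\<exists>q\<in>Pol (facet e). res (facet e) a = res (facet e) f * q \<and> res (facet e) c = res (facet e) g * q"
    if e: "e \<in> Es" for e
  proof -
    have fe: "res (facet e) f \<in> Pol {fst e}" "res (facet e) f \<noteq> 0"
      and ge: "res (facet e) g \<in> Pol {snd e}" "res (facet e) g \<noteq> 0"
      using f g e by (auto simp: coloured_def)
    have ne: "snd e \<notin> {fst e}" using disj[of "fst e" "snd e" "fst e" "snd e"] e by auto
    have "res (facet e) a \<in> ideal_plus (Pol (facet e)) {0} (res (facet e) f)"
    proof (rule nonzero_divisor_of_fresh_variable[OF _ _ _ ge])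
      show "ideal_in (Pol (facet e)) (ideal_plus (Pol (facet e)) {0} (res (facet e) f))"
        by (intro ideal_in_plus) (auto simp: ideal_in_def)
      show "coeff_stable (snd e) (ideal_plus (Pol (facet e)) {0} (res (facet e) f))"
        by (rule coeff_stable_ideal_plus[OF coeff_stable_0 fe(1) ne])
      show "res (facet e) g * res (facet e) a \<in> ideal_plus (Pol (facet e)) {0} (res (facet e) f)"
        unfolding eq[OF e] ideal_plus_def by auto
    qed (auto simp: facet_def)
    then obtain q where q: "q \<in> Pol (facet e)" "res (facet e) a = res (facet e) f * q"
      by (auto simp: ideal_plus_def)
    have "res (facet e) f * (res (facet e) g * q) = res (facet e) f * res (facet e) c"
      using eq[OF e] q by (simp add: mult_ac)
    then show ?thesis using q fe by auto
  qed
  then obtain q where q: "\<And>e. e \<in> Es \<Longrightarrow> q e \<in> Pol (facet e) \<and>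
      res (facet e) a = res (facet e) f * q e \<and> res (facet e) c = res (facet e) g * q e" by metis
  have near: "res (facet e \<inter> facet e') (q e) = res (facet e \<inter> facet e') (q e')"
    if e: "e \<in> Es" "e' \<in> Es" and sh: "fst e = fst e' \<or> snd e = snd e'" for e e'
    using sh
  proof
    assume "fst e = fst e'"
    then show ?thesis
      by (rule common_quotient[OF f e, of a]) (use q e in \<open>auto simp: facet_def\<close>)
  next
    assume "snd e = snd e'"
    then show ?thesis
      by (rule common_quotient[OF g e, of c]) (use q e in \<open>auto simp: facet_def\<close>)
  qed
  have onT: "res T (q e) = res T (q e')" if "e \<in> Es" "e' \<in> Es" for e e'
    using conn[OF that]
  proof (induction rule: rtrancl_induct)
    case (step e' e'')
    have "T \<inter> (facet e' \<inter> facet e'') = T" by (auto simp: facet_def)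
    then have "res T (q e') = res T (q e'')"
      using arg_cong[OF near[of e' e''], of "res T"] step(2) by (simp add: res_res)
    then show ?case using step by simp
  qed simp
  have "res (facet e \<inter> facet e') (q e) = res (facet e \<inter> facet e') (q e')"
    if e: "e \<in> Es" "e' \<in> Es" for e e'
  proof (cases "fst e = fst e' \<or> snd e = snd e'")
    case False
    then have "facet e \<inter> facet e' = T"
      using disj[of "fst e" "snd e" "fst e'" "snd e'"] disj[of "fst e'" "snd e'" "fst e" "snd e"] e
      by (auto simp: facet_def)
    then show ?thesis using onT[OF e] by simp
  qed (use near e in blast)
  then obtain p where p: "p \<in> Pol V" "\<And>e. e \<in> Es \<Longrightarrow> res (facet e) p = q e"
    using glue_along_faces[OF fin_Es, of q facet V] q facet_V by metis
  have "a - f * p \<in> J"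
    using a p q f by (auto simp: face_ideal_def res_diff res_mult coloured_def)
  moreover have "a = (a - f * p) + f * p" by simp
  ultimately show ?thesis using p unfolding ideal_plus_def by blast
qed

text \<open>A facet contains a single vertex of each colour, so only one summand survives restriction.\<close>

lemma coloured_sum:
  fixes \<phi> :: "nat \<Rightarrow> 'k::field mpoly"
  assumes c: "c = fst \<or> c = snd" and \<phi>: "\<And>i. i \<in> V \<Longrightarrow> \<phi> i \<in> Pol {i} \<and> \<phi> i \<noteq> 0"
  shows "coloured c (\<Sum>v\<in>c ` Es. var v * \<phi> v)"
  unfolding coloured_def
proof (intro conjI ballI)
  have cV: "c e \<in> V" if "e \<in> Es" for e using c EsV that by auto
  then show "(\<Sum>v\<in>c ` Es. var v * \<phi> v) \<in> Pol V"
    using \<phi> Pol_mono[OF _ conjunct1[OF \<phi>], of _ V] by (intro Pol_sum Pol_mult) auto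
  fix e assume e: "e \<in> Es"
  have "res (facet e) (var v * \<phi> v) = (if v = c e then var v * \<phi> v else 0)" if v: "v \<in> c ` Es" for v
  proof -
    obtain e' where e': "e' \<in> Es" "v = c e'" using v by blast
    have "v \<notin> facet e" if "v \<noteq> c e"
      using that c e e' disj[of "fst e" "snd e" "fst e'" "snd e'"] disj[of "fst e'" "snd e'" "fst e" "snd e"]
      by (auto simp: facet_def)
    moreover have "c e \<in> facet e" using c by (auto simp: facet_def)
    ultimately show ?thesis using \<phi>[OF cV[OF e]] by (auto simp: res_mult res_var res_id)
  qed
  then have "res (facet e) (\<Sum>v\<in>c ` Es. var v * \<phi> v) = (\<Sum>v\<in>c ` Es. if v = c e then var v * \<phi> v else 0)"
    unfolding res_sum by (intro sum.cong) auto
  then have "res (facet e) (\<Sum>v\<in>c ` Es. var v * \<phi> v) = var (c e) * \<phi> (c e)"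
    using e fin_Es by simp
  then show "res (facet e) (\<Sum>v\<in>c ` Es. var v * \<phi> v) \<in> Pol {c e}"
    "res (facet e) (\<Sum>v\<in>c ` Es. var v * \<phi> v) \<noteq> 0"
    using \<phi>[OF cV[OF e]] by auto
qed

text \<open>A red function, a blue function and one polynomial in each cone variable, all chosen inside the
  maximal ideal, form a regular sequence: the cone variables are fresh for the ideal generated by
  \<open>J\<close> and the first two elements. Its length is the number of vertices of a facet, which bounds the
  dimension.\<close>

theorem cohen_macaulay:
  assumes \<Delta>: "\<Delta> = {F. \<exists>e\<in>Es. F \<subseteq> facet e}"
  shows "cohen_macaulay_complex TYPE('k::field) V \<Delta>"
proof (rule cohen_macaulay_complexI[OF V])
  show "simplicial_complex V \<Delta>"
    unfolding simplicial_complex_def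
  proof (intro conjI ballI allI impI)
    show "\<Delta> \<subseteq> Pow V" using \<Delta> facet_V by blast
    show "{} \<in> \<Delta>" using \<Delta> Es by blast
    show "G \<in> \<Delta>" if "F \<in> \<Delta>" "G \<subseteq> F" for F G using that \<Delta> by blast
  qed
  let ?I = "face_ideal V \<Delta> :: 'k mpoly set"
  fix Pm assume "quotient_at_maximal V ?I (mpoly_ring V Quot ?I) Pm"
  then interpret quotient_at_maximal V ?I "mpoly_ring V Quot ?I" Pm .
  have IF: "?I = J" using \<Delta> by (intro face_ideal_cong) auto
  have "\<forall>i\<in>V. \<exists>f\<in>Pol {i}. f \<noteq> 0 \<and> f \<in> P" using coordinate_in_P[OF V] by blast
  then obtain \<phi> where \<phi>: "\<And>i. i \<in> V \<Longrightarrow> \<phi> i \<in> Pol {i} \<and> \<phi> i \<noteq> 0 \<and> \<phi> i \<in> P" by metis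
  define h where "h c = (\<Sum>v\<in>c ` Es. var v * \<phi> v)" for c :: "nat \<times> nat \<Rightarrow> nat"
  have hP: "h c \<in> P" if "c = fst \<or> c = snd" for c
  proof -
    have "c ` Es \<subseteq> V" using that EsV by auto
    then show ?thesis unfolding h_def using \<phi>
      by (intro ideal_in_sum[OF ideal_P] ideal_inD(4)[OF ideal_P]) auto
  qed
  have hc: "coloured fst (h fst)" "coloured snd (h snd)"
    unfolding h_def using \<phi> by (auto intro!: coloured_sum)
  have hfree: "\<exists>W. h c \<in> Pol W \<and> t \<notin> W" if "c = fst \<or> c = snd" "t \<in> T" for c t
  proof (intro exI[of _ "V - {t}"] conjI)
    have "c e \<in> V - {t}" if "e \<in> Es" for e
      using that \<open>c = fst \<or> c = snd\<close> \<open>t \<in> T\<close> EsV disj[of "fst e" "snd e" "fst e" "snd e"] by auto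
    then show "h c \<in> Pol (V - {t})"
      unfolding h_def using Pol_mono[OF _ conjunct1[OF \<phi>], of _ "V - {t}"]
      by (intro Pol_sum Pol_mult) auto
  qed simp
  obtain ts where ts: "set ts = T" "distinct ts"
    using finite_distinct_list[of T] T V by (meson finite_subset)
  let ?as = "h fst # h snd # map \<phi> ts"
  have "cohen_macaulay_local (localization (mpoly_ring V Quot ?I) S)"
  proof (rule cohen_macaulay_localI[of ?as])
    show "set ?as \<subseteq> P" using hP \<phi> ts T by auto
    show "krull_dim (localization (mpoly_ring V Quot ?I) S) \<le> enat (length ?as)"
    proof (rule krull_dim_face_ring[OF V IF])
      have "card T = length ts" using ts distinct_card by fastforce
      then show "finite F \<and> card F \<le> length ?as" if "F \<in> facet ` Es" for F
        using that facet_V V card_facet by (auto intro: finite_subset)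
    qed
    fix i a assume i: "i < length ?as" and a: "a \<in> Pol V" "?as ! i * a \<in> ideal_ext (Pol V) ?I (take i ?as)"
    consider "i = 0" | "i = 1" | k where "i = k + 2" "k < length ts"
      using i by (metis One_nat_def Suc_1 Suc_eq_plus1 Suc_less_eq add_2_eq_Suc' length_Cons length_map not0_implies_Suc)
    then show "a \<in> ideal_ext (Pol V) ?I (take i ?as)"
    proof cases
      case 1
      then show ?thesis using a coloured_regular_1[OF hc(1)] IF by simp
    next
      case 2
      then show ?thesis using a coloured_regular_2[OF hc] IF by (simp add: ideal_ext_def)
    next
      case (3 k)
      let ?t = "ts ! k"
      have t: "?t \<in> T" using 3 ts by auto
      have tk: "take i ?as = h fst # h snd # map \<phi> (take k ts)" using 3 by (simp add: take_map)
      show ?thesis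
      proof (rule nonzero_divisor_of_fresh_variable[of V _ ?t "\<phi> ?t"])
        have "set (take i ?as) \<subseteq> Pol V"
          using \<open>set ?as \<subseteq> P\<close> ideal_inD(1)[OF ideal_P] by (meson in_set_takeD subset_iff)
        then show "ideal_in (Pol V) (ideal_ext (Pol V) ?I (take i ?as))"
          by (intro ideal_in_ext face_ideal_ideal) auto
        show "coeff_stable ?t (ideal_ext (Pol V) ?I (take i ?as))"
          unfolding IF
        proof (rule coeff_stable_ext)
          show "coeff_stable ?t J" by (rule coeff_stable_face_ideal) (use t in \<open>auto simp: facet_def\<close>)
          fix b assume "b \<in> set (take i ?as)"
          then consider "b = h fst" | "b = h snd" | l where "l < k" "b = \<phi> (ts ! l)"
            unfolding tk using 3 by (auto simp: in_set_conv_nth)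
          then show "\<exists>W. b \<in> Pol W \<and> ?t \<notin> W"
          proof cases
            case l: 3
            then have "ts ! l \<noteq> ?t" using ts(2) 3 by (auto simp: nth_eq_iff_index_eq)
            moreover have "ts ! l \<in> V" using l 3 ts T by auto
            ultimately show ?thesis using \<phi> l by (intro exI[of _ "{ts ! l}"]) auto
          qed (use hfree t in auto)
        qed
        show "\<phi> ?t * a \<in> ideal_ext (Pol V) ?I (take i ?as)" using a(2) 3 by simp
      qed (use t T \<phi> a in auto)
    qed
  qed
  then show "cohen_macaulay_local (localization (mpoly_ring V Quot ?I)
      (carrier (mpoly_ring V Quot ?I) - Pm))" by (simp add: S_def)
qed

end

section \<open>Systems of parameters of a localization\<close>

context local_quotient
begin

lemma D_power: "s \<in> D \<Longrightarrow> s ^ n \<in> D"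
  by (induction n) auto

lemma fr_pow: "a \<in> R \<Longrightarrow> s \<in> D \<Longrightarrow> fr a s [^] (n::nat) = fr (a ^ n) (s ^ n)"
proof (induction n)
  case (Suc n)
  then show ?case using D_power R_closed by (simp add: fr_mult_D mult.commute)
qed (simp add: fr_1)

lemma radical_of_system_of_parameters:
  assumes xs: "system_of_parameters B M xs" and rep: "list_all2 repr xs as" and a: "a \<in> P"
  shows "\<exists>w\<in>D. \<exists>n. w * a ^ n \<in> ideal_ext R I as"
proof -
  have aR: "a \<in> R" using a PR by blast
  then have "fr a 1 \<in> M" using a by (simp add: fr_in_M)
  then obtain n :: nat where "fr a 1 [^] n \<in> Idl (set xs)" using xs by (auto simp: system_of_parameters_def)
  then have "fr (a ^ n) 1 \<in> Idl (set xs)" using aR by (simp add: fr_pow)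
  then show ?thesis using fr_in_Idl[OF rep, of "a ^ n" 1] aR R_closed by auto
qed

lemma system_of_parametersI:
  assumes as: "set as \<subseteq> P" and dim: "krull_dim B = enat (length as)"
    and rad: "\<And>a. a \<in> P \<Longrightarrow> \<exists>w\<in>D. \<exists>n. w * a ^ n \<in> ideal_ext R I as"
  shows "system_of_parameters B M (map (\<lambda>a. fr a 1) as)"
  unfolding system_of_parameters_def
proof (intro conjI ballI)
  have asR: "set as \<subseteq> R" using as PR by blast
  show "set (map (\<lambda>a. fr a 1) as) \<subseteq> M" using as asR fr_in_M[OF _ D_1] by auto
  show "enat (length (map (\<lambda>a. fr a 1) as)) = krull_dim B" using dim by simp
  fix x assume "x \<in> M"
  then obtain a s where a: "x = fr a s" "a \<in> P" "s \<in> D" by (rule M_E)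
  have aR: "a \<in> R" using a PR by blast
  obtain w n where "w \<in> D" "w * a ^ n \<in> ideal_ext R I as" using rad a by blast
  then have "fr (a ^ n) (s ^ n) \<in> Idl (set (map (\<lambda>a. fr a 1) as))"
    using fr_in_Idl[OF repr_fr[OF asR], of "a ^ n" "s ^ n"] aR R_closed(7) D_power a by blast
  then show "\<exists>n::nat. x [^] n \<in> Idl (set (map (\<lambda>a. fr a 1) as))"
    using a aR fr_pow by (intro exI[of _ n]) simp
qed

lemma weak_sequenceI:
  assumes rep: "list_all2 repr xs as" and as: "set as \<subseteq> P"
    and weak: "\<And>i b w h. i < length as \<Longrightarrow> b \<in> R \<Longrightarrow> w \<in> D \<Longrightarrow>
      w * (as ! i * b) \<in> ideal_ext R I (take i as) \<Longrightarrow> h \<in> P \<Longrightarrow>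
      \<exists>w\<in>D. w * (h * b) \<in> ideal_ext R I (take i as)"
  shows "weak_sequence B M xs"
  unfolding weak_sequence_def
proof (intro allI impI)
  fix i assume i: "i < length xs"
  have li: "i < length as" using i rep by (simp add: list_all2_lengthD)
  have rt: "list_all2 repr (take i xs) (take i as)" using rep by (rule list_all2_takeI)
  have ri: "repr (xs ! i) (as ! i)" using rep i by (rule list_all2_nthD)
  obtain s where s: "xs ! i = fr (as ! i) s" "as ! i \<in> R" "s \<in> D" using ri by (auto simp: repr_def)
  have asi: "as ! i \<in> P" using as li by auto
  have xM: "xs ! i \<in> M" using s asi by (simp add: fr_in_M)
  have "m \<otimes> y \<in> Idl (set (take i xs))"
    if y: "y \<in> carrier B" and xy: "xs ! i \<otimes> y \<in> Idl (set (take i xs))" and m: "m \<in> M" for y m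
  proof -
    obtain b t where b: "y = fr b t" "b \<in> R" "t \<in> D" using y by (rule fr_E)
    have "xs ! i \<otimes> y = fr (as ! i * b) (s * t)" using b s by (simp add: fr_mult_D)
    then obtain w where w: "w \<in> D" "w * (as ! i * b) \<in> ideal_ext R I (take i as)"
      using xy fr_in_Idl[OF rt, of "as ! i * b" "s * t"] b s R_closed(3) by auto
    obtain h u where h: "m = fr h u" "h \<in> P" "u \<in> D" using m by (rule M_E)
    have hR: "h \<in> R" using h PR by blast
    have "\<exists>w\<in>D. w * (h * b) \<in> ideal_ext R I (take i as)" by (rule weak[OF li b(2) w h(2)])
    then show ?thesis
      using fr_in_Idl[OF rt, of "h * b" "u * t"] h b hR R_closed(3) by (simp add: fr_mult_D)
  qed
  then show "colon_ideal B (Idl (set (take i xs))) {xs ! i} = colon_ideal B (Idl (set (take i xs))) M"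
    using xM by (auto simp: colon_ideal_def)
qed

lemma weak_sequenceD:
  assumes weak: "weak_sequence B M (map (\<lambda>a. fr a 1) as)" and as: "set as \<subseteq> P"
    and i: "i < length as" and b: "b \<in> R" "as ! i * b \<in> ideal_ext R I (take i as)" and h: "h \<in> P"
  shows "\<exists>w\<in>D. w * (h * b) \<in> ideal_ext R I (take i as)"
proof -
  let ?xs = "map (\<lambda>a. fr a 1) as"
  have asR: "set as \<subseteq> R" using as PR by blast
  have rt: "list_all2 repr (take i ?xs) (take i as)" by (rule list_all2_takeI[OF repr_fr[OF asR]])
  have ai: "as ! i \<in> R" using asR i by auto
  have hR: "h \<in> R" using h PR by blast
  have "\<exists>w\<in>D. w * (as ! i * b) \<in> ideal_ext R I (take i as)" using b by (intro bexI[of _ 1]) auto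
  then have "?xs ! i \<otimes> fr b 1 \<in> Idl (set (take i ?xs))"
    using fr_in_Idl[OF rt, of "as ! i * b" 1] ai b i R_closed(3) by (simp add: fr_mult_D)
  then have "fr b 1 \<in> colon_ideal B (Idl (set (take i ?xs))) {?xs ! i}"
    using b by (simp add: colon_ideal_def)
  also have "colon_ideal B (Idl (set (take i ?xs))) {?xs ! i} = colon_ideal B (Idl (set (take i ?xs))) M"
    using weak i unfolding weak_sequence_def by simp
  finally have "fr b 1 \<in> colon_ideal B (Idl (set (take i ?xs))) M" .
  moreover have "fr h 1 \<in> M" using h hR by (simp add: fr_in_M)
  ultimately have "fr h 1 \<otimes> fr b 1 \<in> Idl (set (take i ?xs))" by (auto simp: colon_ideal_def)
  then show ?thesis using fr_in_Idl[OF rt, of "h * b" 1] hR b R_closed(3) by (simp add: fr_mult_D)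
qed

end

lemma buchsbaum_complex_iff:
  assumes V: "finite V" and \<Delta>: "simplicial_complex V \<Delta>"
  shows "buchsbaum_complex TYPE('k::field) V \<Delta> \<longleftrightarrow>
    (\<forall>Pm. quotient_at_maximal V (face_ideal V \<Delta> :: 'k mpoly set) (mpoly_ring V Quot face_ideal V \<Delta>) Pm \<longrightarrow>
      buchsbaum_local (localization (mpoly_ring V Quot face_ideal V \<Delta>)
        (carrier (mpoly_ring V Quot (face_ideal V \<Delta> :: 'k mpoly set)) - Pm)))"
  unfolding buchsbaum_complex_def buchsbaum_ring_def stanley_reisner_ring_def
    stanley_reisner_ideal_eq[OF V \<Delta>]
  by (simp add: quotient_at_maximal_def quotient_at_maximal_axioms_def mpoly_quotient_def face_ideal_ideal)

section \<open>Two disjoint connected bipartite graphs\<close>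

context bipartite_join
begin

lemma coloured_power: "coloured c f \<Longrightarrow> coloured c (f ^ n)"
  by (auto simp: coloured_def res_power)

text \<open>If an ideal \<open>(\<alpha>, \<beta>)\<close> contains, near \<open>P\<close>, the red and the blue function, then \<open>\<alpha>, \<beta>\<close> is itself
  regular near \<open>P\<close>; this is the case of two elements of the fact that depth can be tested on any
  generators. Given a relation \<open>\<alpha> u + \<beta> v = 0\<close>, the cross products \<open>z = a\<^sub>1 v - b\<^sub>1 u\<close> and
  \<open>z' = a\<^sub>2 v - b\<^sub>2 u\<close> satisfy \<open>\<alpha> z = f v\<close>, \<open>\<beta> z = - f u\<close>, \<open>\<alpha> z' = g v\<close>, \<open>\<beta> z' = - g u\<close>. Therefore
  \<open>f z' - g z\<close> is killed by \<open>\<alpha>\<close> and \<open>\<beta>\<close>, hence zero; regularity of \<open>f, g\<close> gives \<open>z = f q\<close>, and then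
  \<open>v = \<alpha> q\<close> because \<open>f\<close> can be cancelled.\<close>

lemma regular_after_localization:
  fixes f g :: "'k::field mpoly"
  assumes P: "prime_in (Pol V) P"
    and f: "coloured fst f" and g: "coloured snd g"
    and \<alpha>: "\<alpha> \<in> Pol V" and \<beta>: "\<beta> \<in> Pol V" and u: "u \<in> Pol V" and v: "v \<in> Pol V"
    and w: "w1 \<in> Pol V - P" "w2 \<in> Pol V - P"
    and abcd: "a1 \<in> Pol V" "b1 \<in> Pol V" "a2 \<in> Pol V" "b2 \<in> Pol V"
    and f': "w1 * f - (\<alpha> * a1 + \<beta> * b1) \<in> J" and g': "w2 * g - (\<alpha> * a2 + \<beta> * b2) \<in> J"
    and rel: "\<alpha> * u + \<beta> * v \<in> J"
  shows "\<exists>w\<in>Pol V - P. \<exists>e\<in>Pol V. w * v - \<alpha> * e \<in> J"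
proof -
  have Dm: "s * t \<in> Pol V - P" if "s \<in> Pol V - P" "t \<in> Pol V - P" for s t
    using P that by (auto simp: prime_in_def)
  have D1: "1 \<in> Pol V - P" using P by (simp add: prime_in_def)
  have fV: "f \<in> Pol V" and gV: "g \<in> Pol V" using f g by (auto simp: coloured_def)
  \<comment> \<open>the elements of \<open>Pol V\<close> that vanish in the localization of \<open>Pol V / J\<close> at \<open>P\<close>\<close>
  define K where "K = {p \<in> Pol V. \<exists>s\<in>Pol V - P. s * p \<in> J}"
  have K: "ideal_in (Pol V) K"
    unfolding ideal_in_def
  proof (intro conjI ballI)
    show "K \<subseteq> Pol V" by (auto simp: K_def)
    show "0 \<in> K" using D1 ideal_inD(2)[OF J_ideal] by (auto simp: K_def)
    show "x + y \<in> K" if xy: "x \<in> K" "y \<in> K" for x y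
    proof -
      obtain s t where s: "s \<in> Pol V - P" "s * x \<in> J" "t \<in> Pol V - P" "t * y \<in> J"
        using xy by (auto simp: K_def)
      have "t * (s * x) + s * (t * y) \<in> J"
        using s(1,3) by (intro ideal_inD(3)[OF J_ideal] ideal_inD(4)[OF J_ideal _ s(2)]
            ideal_inD(4)[OF J_ideal _ s(4)]) auto
      then have "(s * t) * (x + y) \<in> J" by (simp add: algebra_simps)
      then show ?thesis using xy Dm[OF s(1,3)] unfolding K_def by auto
    qed
    show "r * x \<in> K" if rx: "r \<in> Pol V" "x \<in> K" for r x
    proof -
      obtain s where s: "s \<in> Pol V - P" "s * x \<in> J" using rx by (auto simp: K_def)
      have "r * (s * x) \<in> J" by (rule ideal_inD(4)[OF J_ideal rx(1) s(2)])
      then have "s * (r * x) \<in> J" by (simp add: mult_ac)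
      then show ?thesis using s(1) rx unfolding K_def by auto
    qed
  qed
  have JK: "x \<in> K" if "x \<in> J" for x
    using that D1 ideal_inD(1)[OF J_ideal that] by (auto simp: K_def intro!: bexI[of _ 1])
  note Kadd = ideal_inD(3)[OF K] and Kmult = ideal_inD(4)[OF K] and Kdiff = ideal_in_Pol_diff[OF K]
  let ?f = "w1 * f" and ?g = "w2 * g"
  have r1: "p \<in> K" if p: "p \<in> Pol V" "?f * p \<in> K" for p
  proof -
    obtain s where s: "s \<in> Pol V - P" "s * (?f * p) \<in> J" using p by (auto simp: K_def)
    then have fJ: "f * ((s * w1) * p) \<in> J" by (simp add: mult_ac)
    have "(s * w1) * p \<in> Pol V" using s(1) p(1) w(1) by simp
    from coloured_regular_1[OF f this fJ] show ?thesis using p Dm[OF s(1) w(1)] unfolding K_def by blast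
  qed
  have r2: "\<exists>s\<in>Pol V - P. \<exists>q\<in>Pol V. s * p - ?f * q \<in> K"
    if p: "p \<in> Pol V" "p' \<in> Pol V" "?f * p' - ?g * p \<in> K" for p p'
  proof -
    obtain s where s: "s \<in> Pol V - P" "s * (?f * p' - ?g * p) \<in> J" using p by (auto simp: K_def)
    have "g * ((s * w2) * p) = - (s * (?f * p' - ?g * p)) + f * (s * w1 * p')"
      by (simp add: algebra_simps)
    then have "g * ((s * w2) * p) \<in> ideal_plus (Pol V) J f"
      unfolding ideal_plus_def using ideal_in_Pol_uminus[OF J_ideal s(2)] s(1) w p(1,2)
      by (intro CollectI exI[of _ "- (s * (?f * p' - ?g * p))"] exI[of _ "s * w1 * p'"]) simp
    then have "(s * w2) * p \<in> ideal_plus (Pol V) J f"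
      by (rule coloured_regular_2[OF f g, rotated]) (use s(1) p(1) w(2) in simp)
    then obtain x q where q: "(s * w2) * p = x + f * q" "x \<in> J" "q \<in> Pol V"
      by (auto simp: ideal_plus_def)
    have "(w1 * (s * w2)) * p - ?f * q = w1 * x"
      using arg_cong[OF q(1), of "\<lambda>z. w1 * z"] by (simp add: algebra_simps)
    also have "\<dots> \<in> K" using q w by (intro JK ideal_inD(4)[OF J_ideal]) auto
    finally show ?thesis using q Dm[OF w(1) Dm[OF s(1) w(2)]] by blast
  qed
  have fK: "?f - (\<alpha> * a1 + \<beta> * b1) \<in> K" and gK: "?g - (\<alpha> * a2 + \<beta> * b2) \<in> K"
    and relK: "\<alpha> * u + \<beta> * v \<in> K" using f' g' rel by (auto intro: JK)
  have depth: "e \<in> K" if e: "e \<in> Pol V" "\<alpha> * e \<in> K" "\<beta> * e \<in> K" for e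
  proof (rule r1[OF e(1)])
    have "?f * e = e * (?f - (\<alpha> * a1 + \<beta> * b1)) + (a1 * (\<alpha> * e) + b1 * (\<beta> * e))"
      by (simp add: algebra_simps)
    also have "\<dots> \<in> K" by (rule Kadd[OF Kmult[OF e(1) fK] Kadd[OF Kmult[OF abcd(1) e(2)] Kmult[OF abcd(2) e(3)]]])
    finally show "?f * e \<in> K" .
  qed
  define z where "z = a1 * v - b1 * u"
  define z' where "z' = a2 * v - b2 * u"
  have zV: "z \<in> Pol V" "z' \<in> Pol V" using abcd u v by (auto simp: z_def z'_def)
  have \<alpha>z: "\<alpha> * z - ?f * v \<in> K"
  proof -
    have "\<alpha> * z - ?f * v = - (v * (?f - (\<alpha> * a1 + \<beta> * b1)) + b1 * (\<alpha> * u + \<beta> * v))"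
      by (simp add: z_def algebra_simps)
    also have "\<dots> \<in> K" by (rule ideal_in_Pol_uminus[OF K Kadd[OF Kmult[OF v fK] Kmult[OF abcd(2) relK]]])
    finally show ?thesis .
  qed
  have \<beta>z: "\<beta> * z + ?f * u \<in> K"
  proof -
    have "\<beta> * z + ?f * u = u * (?f - (\<alpha> * a1 + \<beta> * b1)) + a1 * (\<alpha> * u + \<beta> * v)"
      by (simp add: z_def algebra_simps)
    also have "\<dots> \<in> K" by (rule Kadd[OF Kmult[OF u fK] Kmult[OF abcd(1) relK]])
    finally show ?thesis .
  qed
  have \<alpha>z': "\<alpha> * z' - ?g * v \<in> K"
  proof -
    have "\<alpha> * z' - ?g * v = - (v * (?g - (\<alpha> * a2 + \<beta> * b2)) + b2 * (\<alpha> * u + \<beta> * v))"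
      by (simp add: z'_def algebra_simps)
    also have "\<dots> \<in> K" by (rule ideal_in_Pol_uminus[OF K Kadd[OF Kmult[OF v gK] Kmult[OF abcd(4) relK]]])
    finally show ?thesis .
  qed
  have \<beta>z': "\<beta> * z' + ?g * u \<in> K"
  proof -
    have "\<beta> * z' + ?g * u = u * (?g - (\<alpha> * a2 + \<beta> * b2)) + a2 * (\<alpha> * u + \<beta> * v)"
      by (simp add: z'_def algebra_simps)
    also have "\<dots> \<in> K" by (rule Kadd[OF Kmult[OF u gK] Kmult[OF abcd(3) relK]])
    finally show ?thesis .
  qed
  have FV: "?f \<in> Pol V" "?g \<in> Pol V" using w fV gV by auto
  have "?f * z' - ?g * z \<in> K"
  proof (rule depth)
    show "?f * z' - ?g * z \<in> Pol V" using FV zV by auto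
    have "\<alpha> * (?f * z' - ?g * z) = ?f * (\<alpha> * z' - ?g * v) - ?g * (\<alpha> * z - ?f * v)"
      by (simp add: algebra_simps)
    also have "\<dots> \<in> K" by (rule Kdiff[OF Kmult[OF FV(1) \<alpha>z'] Kmult[OF FV(2) \<alpha>z]])
    finally show "\<alpha> * (?f * z' - ?g * z) \<in> K" .
    have "\<beta> * (?f * z' - ?g * z) = ?f * (\<beta> * z' + ?g * u) - ?g * (\<beta> * z + ?f * u)"
      by (simp add: algebra_simps)
    also have "\<dots> \<in> K" by (rule Kdiff[OF Kmult[OF FV(1) \<beta>z'] Kmult[OF FV(2) \<beta>z]])
    finally show "\<beta> * (?f * z' - ?g * z) \<in> K" .
  qed
  then obtain s q where s: "s \<in> Pol V - P" "q \<in> Pol V" "s * z - ?f * q \<in> K" using r2[OF zV] by blast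
  have "s * v - \<alpha> * q \<in> K"
  proof (rule r1)
    show "s * v - \<alpha> * q \<in> Pol V" using s v \<alpha> by auto
    have "?f * (s * v - \<alpha> * q) = \<alpha> * (s * z - ?f * q) - s * (\<alpha> * z - ?f * v)"
      by (simp add: algebra_simps)
    also have "\<dots> \<in> K" using s(1) by (intro Kdiff[OF Kmult[OF \<alpha> s(3)] Kmult[OF _ \<alpha>z]]) simp
    finally show "?f * (s * v - \<alpha> * q) \<in> K" .
  qed
  then obtain t where t: "t \<in> Pol V - P" "t * (s * v - \<alpha> * q) \<in> J" by (auto simp: K_def)
  have "(t * s) * v - \<alpha> * (t * q) \<in> J" using t(2) by (simp add: algebra_simps)
  then show ?thesis using Dm[OF t(1) s(1)] t s by (intro bexI[of _ "t * s"] bexI[of _ "t * q"]) auto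
qed

end

text \<open>A face of two vertices contributes a component of dimension two at \<open>P\<close>, and one element cannot
  cut it down to a point. If \<open>\<beta>\<close> divided powers of \<open>f\<close> and of \<open>g\<close> up to factors outside \<open>P\<close>, then,
  \<open>f\<close> and \<open>g\<close> being polynomials in different variables, it would divide an element outside \<open>P\<close>.\<close>

lemma principal_ideal_not_primary:
  fixes P :: "'k::field mpoly set"
  assumes P: "prime_in (Pol V) P" and rb: "r \<in> V" "b \<in> V" "r \<noteq> b"
    and F: "\<forall>v\<in>V - {r, b}. var v \<in> P"
    and f: "f \<in> Pol {r}" "f \<noteq> 0" "f \<in> P" and g: "g \<in> Pol {b}" "g \<noteq> 0" "g \<in> P" and \<beta>: "\<beta> \<in> P"
    and rad: "\<And>a. a \<in> P \<Longrightarrow> \<exists>w\<in>Pol V - P. \<exists>n. \<exists>c\<in>Pol V. res {r, b} (w * a ^ n) = res {r, b} (\<beta> * c)"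
  shows False
proof -
  let ?F = "{r, b}"
  obtain w n c where 1: "w \<in> Pol V - P" "c \<in> Pol V" "res ?F (w * f ^ n) = res ?F (\<beta> * c)" using rad f by blast
  obtain w' n' c' where 2: "w' \<in> Pol V - P" "c' \<in> Pol V" "res ?F (w' * g ^ n') = res ?F (\<beta> * c')"
    using rad g by blast
  have rf: "res ?F f = f" and rg: "res ?F g = g" using f g by (auto intro!: res_id)
  let ?\<beta> = "res ?F \<beta>" and ?w = "res ?F w" and ?w' = "res ?F w'" and ?c = "res ?F c" and ?c' = "res ?F c'"
  have e1: "?w * f ^ n = ?\<beta> * ?c" and e2: "?w' * g ^ n' = ?\<beta> * ?c'"
    using 1(3) 2(3) by (simp_all add: res_mult res_power rf rg)
  have "?w' * ?c \<in> ideal_plus (Pol ?F) {0} (f ^ n)"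
  proof (rule nonzero_divisor_of_fresh_variable[of ?F _ b "g ^ n'"])
    have fF: "f \<in> Pol ?F" using f by (auto intro: Pol_mono)
    show "ideal_in (Pol ?F) (ideal_plus (Pol ?F) {0} (f ^ n))"
      using fF by (intro ideal_in_plus) (auto simp: ideal_in_def)
    show "coeff_stable b (ideal_plus (Pol ?F) {0} (f ^ n))"
      by (rule coeff_stable_ideal_plus[OF coeff_stable_0, of _ "{r}"]) (use f rb in auto)
    have "g ^ n' * (?w' * ?c) = (?w' * g ^ n') * ?c" by (simp add: mult_ac)
    also have "\<dots> = f ^ n * (?w * ?c')" unfolding e2 using e1 by (simp add: mult_ac)
    finally show "g ^ n' * (?w' * ?c) \<in> ideal_plus (Pol ?F) {0} (f ^ n)"
      unfolding ideal_plus_def by auto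
  qed (use g in auto)
  then obtain q where q: "q \<in> Pol ?F" "?w' * ?c = f ^ n * q" by (auto simp: ideal_plus_def)
  have "f ^ n * (?w * ?w') = (?w * f ^ n) * ?w'" by (simp only: mult_ac)
  also have "\<dots> = ?\<beta> * (?w' * ?c)" unfolding e1 by (simp only: mult_ac)
  also have "\<dots> = f ^ n * (?\<beta> * q)" unfolding q(2) by (simp only: mult_ac)
  finally have "?w * ?w' = ?\<beta> * q" using f by simp
  then have "res ?F (w * w' - \<beta> * q) = 0" using res_id[OF q(1), of ?F] by (simp add: res_diff res_mult)
  moreover have P_id: "ideal_in (Pol V) P" using P by (simp add: prime_in_def)
  have \<beta>V: "\<beta> \<in> Pol V" using \<beta> ideal_inD(1)[OF P_id] by blast
  have qV: "q \<in> Pol V" using q(1) by (rule Pol_mono[rotated]) (use rb in auto)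
  ultimately have "w * w' - \<beta> * q \<in> P" using 1 2 \<beta>V by (intro res_0_in_prime[OF P F]) auto
  moreover have "\<beta> * q \<in> P" using \<beta> qV by (intro ideal_inD(5)[OF P_id])
  ultimately have "(w * w' - \<beta> * q) + \<beta> * q \<in> P" by (rule ideal_inD(3)[OF P_id])
  then show False using 1 2 P by (auto simp: prime_in_def)
qed

text \<open>The face ring embeds into the product of the face rings of the two graphs, which are
  Cohen-Macaulay. So for a system of parameters \<open>\<alpha>, \<beta>\<close> and \<open>\<beta> b \<in> (\<alpha>)\<close> there are solutions
  \<open>b = \<alpha> q\<^sub>1\<close> and \<open>b = \<alpha> q\<^sub>2\<close> on the two components, near the prime in question. At the irrelevant
  ideal they need not glue, since the constant terms of \<open>q\<^sub>1\<close> and \<open>q\<^sub>2\<close> may differ, but \<open>h q\<^sub>1\<close> and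
  \<open>h q\<^sub>2\<close> do for every \<open>h\<close> in the maximal ideal, because the graphs meet only in the empty face. At
  any other maximal ideal some variable is invertible, and at most its component is left.\<close>

theorem buchsbaum_two_graphs:
  assumes G: "bipartite_join V {} E1" "bipartite_join V {} E2"
    and disj: "\<And>e e'. e \<in> E1 \<Longrightarrow> e' \<in> E2 \<Longrightarrow> {fst e, snd e} \<inter> {fst e', snd e'} = {}"
    and \<Delta>: "\<Delta> = {F. \<exists>e\<in>E1 \<union> E2. F \<subseteq> {fst e, snd e}}"
  shows "buchsbaum_complex TYPE('k::field) V \<Delta>"
proof -
  interpret G1: bipartite_join V "{}" E1 by fact
  interpret G2: bipartite_join V "{}" E2 by fact
  have V: "finite V" by (rule G1.V)
  have ft: "G1.facet e = {fst e, snd e}" "G2.facet e = {fst e, snd e}" for e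
    by (auto simp: G1.facet_def G2.facet_def)
  have EV: "fst e \<in> V \<and> snd e \<in> V \<and> fst e \<noteq> snd e" if "e \<in> E1 \<union> E2" for e
    using that G1.EsV G2.EsV G1.disj[of "fst e" "snd e" "fst e" "snd e"]
      G2.disj[of "fst e" "snd e" "fst e" "snd e"] by auto
  have sc: "simplicial_complex V \<Delta>"
    unfolding simplicial_complex_def
  proof (intro conjI ballI allI impI)
    show "\<Delta> \<subseteq> Pow V" using \<Delta> EV by blast
    show "{} \<in> \<Delta>" using \<Delta> G1.Es by blast
    show "H \<in> \<Delta>" if "F \<in> \<Delta>" "H \<subseteq> F" for F H using that \<Delta> by blast
  qed
  let ?I = "face_ideal V \<Delta> :: 'k mpoly set"
  let ?Fs = "(\<lambda>e. {fst e, snd e}) ` (E1 \<union> E2)"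
  have IF: "?I = face_ideal V ?Fs" using \<Delta> by (intro face_ideal_cong) auto
  have I12: "?I = G1.J \<inter> G2.J" unfolding IF by (auto simp: face_ideal_def ft)
  have "buchsbaum_local (localization (mpoly_ring V Quot ?I) (carrier (mpoly_ring V Quot ?I) - Pm))"
    if Pm: "quotient_at_maximal V ?I (mpoly_ring V Quot ?I) Pm" for Pm
  proof -
    interpret quotient_at_maximal V ?I "mpoly_ring V Quot ?I" Pm by (rule Pm)
    have D: "lq.D = Pol V - P" by (simp add: lq.D_def)
    have "\<forall>i\<in>V. \<exists>f\<in>Pol {i}. f \<noteq> 0 \<and> f \<in> P" using coordinate_in_P[OF V] by blast
    then obtain \<phi> where \<phi>: "\<And>i. i \<in> V \<Longrightarrow> \<phi> i \<in> Pol {i} \<and> \<phi> i \<noteq> 0 \<and> \<phi> i \<in> P" by metis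
    have dim: "krull_dim (localization (mpoly_ring V Quot ?I) S) \<le> enat 2"
      by (rule krull_dim_face_ring[OF V IF]) (auto simp: card_insert_if)
    have "weak_sequence (localization (mpoly_ring V Quot ?I) S) lq.M xs"
      if sop: "system_of_parameters (localization (mpoly_ring V Quot ?I) S) lq.M xs" for xs
    proof -
      have "set xs \<subseteq> lq.M" using sop by (simp add: system_of_parameters_def)
      then obtain as where as: "list_all2 lq.repr xs as" "set as \<subseteq> P" by (rule lq.repr_obtain)
      have "enat (length xs) \<le> enat 2" using sop dim by (simp add: system_of_parameters_def)
      then have l2: "length as \<le> 2" using as(1) by (simp add: list_all2_lengthD)
      have asV: "set as \<subseteq> Pol V" using as ideal_inD(1)[OF ideal_P] by blast
      have rad: "\<exists>w\<in>Pol V - P. \<exists>n. w * a ^ n \<in> ideal_ext (Pol V) ?I as" if "a \<in> P" for a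
        using lq.radical_of_system_of_parameters[OF sop as(1) that] by (simp add: D)
      have resI: "res {fst e, snd e} x = 0" if "x \<in> ?I" "e \<in> E1 \<union> E2" for x e
        using that unfolding IF by (auto simp: face_ideal_def)
      have no1: False if e: "e \<in> E1 \<union> E2" and eP: "\<forall>v\<in>V - {fst e, snd e}. var v \<in> P"
        and \<beta>: "\<beta> \<in> P" and ext: "\<And>x. x \<in> ideal_ext (Pol V) ?I as \<Longrightarrow>
          \<exists>c\<in>Pol V. res {fst e, snd e} x = res {fst e, snd e} (\<beta> * c)" for e \<beta>
      proof (rule principal_ideal_not_primary[OF prime_P _ _ _ eP _ _ _ _ _ _ \<beta>])
        show "fst e \<in> V" "snd e \<in> V" "fst e \<noteq> snd e" using EV[OF e] by auto
        then show "\<phi> (fst e) \<in> Pol {fst e}" "\<phi> (fst e) \<noteq> 0" "\<phi> (fst e) \<in> P"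
          "\<phi> (snd e) \<in> Pol {snd e}" "\<phi> (snd e) \<noteq> 0" "\<phi> (snd e) \<in> P" using \<phi> by auto
        show "\<exists>w\<in>Pol V - P. \<exists>n. \<exists>c\<in>Pol V. res {fst e, snd e} (w * a ^ n) = res {fst e, snd e} (\<beta> * c)"
          if "a \<in> P" for a using rad[OF that] ext by blast
      qed
      obtain e0 where e0: "e0 \<in> E1 \<union> E2" "\<forall>v\<in>V - {fst e0, snd e0}. var v \<in> P"
        using prime_over_face_ideal[OF V prime_P, of ?Fs] I_sub_P IF by auto
      show ?thesis
      proof (cases "length as = 2")
        case False
        have "as = []"
        proof (rule ccontr)
          assume "as \<noteq> []"
          then obtain \<beta> where \<beta>: "as = [\<beta>]" using False l2
            by (cases as) (auto simp: le_Suc_eq numeral_2_eq_2)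
          have "\<exists>c\<in>Pol V. res {fst e0, snd e0} x = res {fst e0, snd e0} (\<beta> * c)"
            if "x \<in> ideal_ext (Pol V) ?I as" for x
            using that resI[OF _ e0(1)] by (auto simp: \<beta> ideal_ext_def ideal_plus_def res_add)
          then show False using no1[OF e0, of \<beta>] as \<beta> by auto
        qed
        then show ?thesis using as by (simp add: weak_sequence_def)
      next
        case True
        then obtain \<alpha> \<beta> where ab: "as = [\<alpha>, \<beta>]"
          by (metis (no_types, opaque_lifting) Suc_1 Suc_length_conv length_0_conv One_nat_def)
        have \<alpha>: "\<alpha> \<in> P" "\<alpha> \<in> Pol V" and \<beta>: "\<beta> \<in> P" "\<beta> \<in> Pol V" using as asV ab by auto
        have ext: "ideal_ext (Pol V) ?I as = {x + \<alpha> * c + \<beta> * d | x c d. x \<in> ?I \<and> c \<in> Pol V \<and> d \<in> Pol V}"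
          unfolding ab ideal_ext_def ideal_plus_def by auto
        have res\<alpha>: "res {fst e, snd e} \<alpha> \<noteq> 0"
          if e: "e \<in> E1 \<union> E2" "\<forall>v\<in>V - {fst e, snd e}. var v \<in> P" for e
        proof
          assume 0: "res {fst e, snd e} \<alpha> = 0"
          have "\<exists>c\<in>Pol V. res {fst e, snd e} x = res {fst e, snd e} (\<beta> * c)"
            if "x \<in> ideal_ext (Pol V) ?I as" for x
            using that resI[OF _ e(1)] 0 unfolding ext by (auto simp: res_add res_mult)
          then show False using no1[OF e \<beta>(1)] by blast
        qed
        show ?thesis
        proof (rule lq.weak_sequenceI[OF as], unfold D)
          fix i b w h
          assume i: "i < length as" and b: "b \<in> Pol V" and w: "w \<in> Pol V - P"
            and wab: "w * (as ! i * b) \<in> ideal_ext (Pol V) ?I (take i as)" and h: "h \<in> P"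
          have hV: "h \<in> Pol V" using h ideal_inD(1)[OF ideal_P] by blast
          consider "i = 0" | "i = 1" using i ab by (auto simp: less_Suc_eq)
          then show "\<exists>w\<in>Pol V - P. w * (h * b) \<in> ideal_ext (Pol V) ?I (take i as)"
          proof cases
            case 1
            \<comment> \<open>\<open>\<alpha>\<close> is nonzero on the facets whose ideals lie in \<open>P\<close>; on any other facet \<open>b\<close> is killed by a variable outside \<open>P\<close>\<close>
            have wI: "w * (\<alpha> * b) \<in> ?I" using wab 1 ab by simp
            have "\<exists>u\<in>Pol V - P. res F (u * b) = 0" if F: "F \<in> ?Fs" for F
            proof -
              obtain e where e: "e \<in> E1 \<union> E2" "F = {fst e, snd e}" using F by blast
              show ?thesis
              proof (cases "\<forall>v\<in>V - F. var v \<in> P")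
                case True
                have "res F w \<noteq> 0" using res_0_in_prime[OF prime_P True, of w] w by auto
                moreover have "res F \<alpha> \<noteq> 0" using res\<alpha> e True by simp
                moreover have "res F w * (res F \<alpha> * res F b) = 0"
                  using resI[OF wI e(1)] e by (simp add: res_mult)
                ultimately have "res F b = 0" by simp
                then show ?thesis using D1 by (intro bexI[of _ 1]) auto
              next
                case False
                then obtain v where "v \<in> V" "v \<notin> F" "var v \<notin> P" by blast
                then show ?thesis by (intro bexI[of _ "var v"]) (auto simp: res_mult res_var)
              qed
            qed
            then obtain u where u: "\<And>F. F \<in> ?Fs \<Longrightarrow> u F \<in> Pol V - P \<and> res F (u F * b) = 0" by metis
            define U where "U = prod u ?Fs"
            have fin: "finite ?Fs" using G1.fin_Es G2.fin_Es by simp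
            have UV: "U \<in> Pol V" unfolding U_def using u by (intro Pol_prod) auto
            moreover have "U \<notin> P" using prime_in_prod[OF prime_P fin, of u] u UV unfolding U_def by blast
            moreover have "res F (U * (h * b)) = 0" if F: "F \<in> ?Fs" for F
            proof -
              have eq: "U * (h * b) = (prod u (?Fs - {F}) * h) * (u F * b)"
                unfolding U_def using prod.remove[OF fin F, of u] by (simp add: mult_ac)
              show ?thesis unfolding eq res_mult[of F _ "u F * b"] using u[OF F] by simp
            qed
            then have "U * (h * b) \<in> ?I" using UV hV b unfolding IF by (simp add: face_ideal_def)
            ultimately show ?thesis using 1 by (intro bexI[of _ U]) auto
          next
            case 2
            have take1: "take i as = [\<alpha>]" "as ! i = \<beta>" using 2 ab by auto
            obtain x c where x: "w * (\<beta> * b) = x + \<alpha> * c" "x \<in> ?I" "c \<in> Pol V"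
              using wab unfolding take1 by (auto simp: ideal_ext_def ideal_plus_def)
            have "\<alpha> * (- c) + \<beta> * (w * b) = x" using x(1) by (simp add: algebra_simps)
            then have rel: "\<alpha> * (- c) + \<beta> * (w * b) \<in> ?I" using x(2) by simp
            \<comment> \<open>on each component the red and blue functions have powers in \<open>(\<alpha>, \<beta>)\<close> near \<open>P\<close>\<close>
            have comp: "\<exists>w'\<in>Pol V - P. \<exists>q\<in>Pol V. w' * b - \<alpha> * q \<in> face_ideal V (bipartite_join.facet {} ` Es)"
              if Es: "bipartite_join V {} Es" "?I \<subseteq> face_ideal V (bipartite_join.facet {} ` Es)" for Es
            proof -
              interpret H: bipartite_join V "{}" Es by (rule Es(1))
              define f where "f = (\<Sum>v\<in>fst ` Es. var v * \<phi> v)"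
              define g where "g = (\<Sum>v\<in>snd ` Es. var v * \<phi> v)"
              have fg: "H.coloured fst f" "H.coloured snd g"
                unfolding f_def g_def using \<phi> by (auto intro!: H.coloured_sum)
              have "fst ` Es \<subseteq> V" "snd ` Es \<subseteq> V" using H.EsV by auto
              then have fgP: "f \<in> P" "g \<in> P" unfolding f_def g_def using \<phi>
                by (auto intro!: ideal_in_sum[OF ideal_P] ideal_inD(4)[OF ideal_P])
              obtain w1 n1 where 1: "w1 \<in> Pol V - P" "w1 * f ^ n1 \<in> ideal_ext (Pol V) ?I as"
                using rad[OF fgP(1)] by blast
              obtain w2 n2 where 2: "w2 \<in> Pol V - P" "w2 * g ^ n2 \<in> ideal_ext (Pol V) ?I as"
                using rad[OF fgP(2)] by blast
              obtain x1 a1 b1 where 11: "w1 * f ^ n1 = x1 + \<alpha> * a1 + \<beta> * b1" "x1 \<in> ?I" "a1 \<in> Pol V" "b1 \<in> Pol V"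
                using 1(2) unfolding ext by blast
              obtain x2 a2 b2 where 22: "w2 * g ^ n2 = x2 + \<alpha> * a2 + \<beta> * b2" "x2 \<in> ?I" "a2 \<in> Pol V" "b2 \<in> Pol V"
                using 2(2) unfolding ext by blast
              have "w1 * f ^ n1 - (\<alpha> * a1 + \<beta> * b1) = x1" "w2 * g ^ n2 - (\<alpha> * a2 + \<beta> * b2) = x2"
                using 11(1) 22(1) by (auto simp: algebra_simps)
              then have j: "w1 * f ^ n1 - (\<alpha> * a1 + \<beta> * b1) \<in> H.J" "w2 * g ^ n2 - (\<alpha> * a2 + \<beta> * b2) \<in> H.J"
                using 11(2) 22(2) Es(2) by auto
              have wb: "w * b \<in> Pol V" using w b by simp
              have "\<exists>w'\<in>Pol V - P. \<exists>q\<in>Pol V. w' * (w * b) - \<alpha> * q \<in> H.J"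
                by (rule H.regular_after_localization[OF prime_P H.coloured_power[OF fg(1)] H.coloured_power[OF fg(2)]
                      \<alpha>(2) \<beta>(2) Pol_uminus[OF x(3)] wb 1(1) 2(1) 11(3,4) 22(3,4) j subsetD[OF Es(2) rel]])
              then obtain w' q where w': "w' \<in> Pol V - P" "q \<in> Pol V" "w' * (w * b) - \<alpha> * q \<in> H.J" by blast
              then have "(w' * w) * b - \<alpha> * q \<in> H.J" by (simp add: mult.assoc)
              then show ?thesis using w'(2) D_m[OF w'(1) w] by blast
            qed
            obtain w1 q1 where 1: "w1 \<in> Pol V - P" "q1 \<in> Pol V" "w1 * b - \<alpha> * q1 \<in> G1.J"
              using comp[OF G(1)] I12 by blast
            obtain w2 q2 where 2: "w2 \<in> Pol V - P" "q2 \<in> Pol V" "w2 * b - \<alpha> * q2 \<in> G2.J"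
              using comp[OF G(2)] I12 by blast
            have "\<exists>w\<in>Pol V - P. \<exists>q\<in>Pol V. w * (h * b) - \<alpha> * q \<in> ?I"
            proof (cases "\<forall>v\<in>V. var v \<in> P")
              case True
              \<comment> \<open>all variables lie in \<open>P\<close>, so an element of \<open>P\<close> has constant term zero\<close>
              have "h - res {} h \<in> P" using True by (intro diff_res_in_ideal[OF hV ideal_P]) auto
              then have "h - (h - res {} h) \<in> P" by (rule ideal_in_Pol_diff[OF ideal_P h])
              then have hP: "res {} h \<in> P" by simp
              obtain c0 where c0: "res {} h = cst c0" using Pol_empty[of "res {} h"] by auto
              have "c0 = 0"
              proof (rule ccontr)
                assume "c0 \<noteq> 0"
                then have "cst (inverse c0) * res {} h = 1" by (simp add: c0 cst_mult[symmetric])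
                then have "1 \<in> P" using ideal_inD(4)[OF ideal_P Pol_cst hP] by metis
                then show False using D1 by blast
              qed
              then have h0: "res {} h = 0" using c0 by simp
              define V1 where "V1 = (\<Union>e\<in>E1. {fst e, snd e})"
              define V2 where "V2 = (\<Union>e\<in>E2. {fst e, snd e})"
              have V12: "V1 \<inter> V2 = {}" using disj unfolding V1_def V2_def by blast
              define q where "q = res V1 (h * w2 * q1) + res V2 (h * w1 * q2)"
              have VV: "V1 \<subseteq> V" "V2 \<subseteq> V" using EV by (auto simp: V1_def V2_def)
              have qV: "q \<in> Pol V" unfolding q_def by (intro Pol_add Pol_mono[OF VV(1)] Pol_mono[OF VV(2)] res_in_Pol)
              have vanish: "res F (res V' (h * s)) = 0" if "F \<inter> V' = {}" for F V' s
                using that h0 by (simp add: res_res res_mult)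
              have "(w1 * w2) * (h * b) - \<alpha> * q \<in> G1.J"
                unfolding face_ideal_def
              proof (intro CollectI conjI ballI)
                show "(w1 * w2) * (h * b) - \<alpha> * q \<in> Pol V" using 1 2 hV b \<alpha> qV by auto
                fix F assume "F \<in> G1.facet ` E1"
                then obtain e where e: "e \<in> E1" "F = {fst e, snd e}" by (auto simp: ft)
                have "F \<subseteq> V1" using e by (auto simp: V1_def)
                then have "F \<inter> V2 = {}" using V12 by blast
                then have "res F q = res F (h * w2 * q1)"
                  using \<open>F \<subseteq> V1\<close> vanish[of F V2 "w1 * q2"]
                  by (simp add: q_def res_add res_res Int_absorb2 mult.assoc)
                moreover have "res F (w1 * b) = res F (\<alpha> * q1)"
                  using 1(3) e by (auto simp: face_ideal_def ft res_diff)
                ultimately show "res F ((w1 * w2) * (h * b) - \<alpha> * q) = 0"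
                  by (simp add: res_diff res_mult)
              qed
              moreover have "(w1 * w2) * (h * b) - \<alpha> * q \<in> G2.J"
                unfolding face_ideal_def
              proof (intro CollectI conjI ballI)
                show "(w1 * w2) * (h * b) - \<alpha> * q \<in> Pol V" using 1 2 hV b \<alpha> qV by auto
                fix F assume "F \<in> G2.facet ` E2"
                then obtain e where e: "e \<in> E2" "F = {fst e, snd e}" by (auto simp: ft)
                have "F \<subseteq> V2" using e by (auto simp: V2_def)
                then have "F \<inter> V1 = {}" using V12 by blast
                then have "res F q = res F (h * w1 * q2)"
                  using \<open>F \<subseteq> V2\<close> vanish[of F V1 "w2 * q1"]
                  by (simp add: q_def res_add res_res Int_absorb2 mult.assoc)
                moreover have "res F (w2 * b) = res F (\<alpha> * q2)"
                  using 2(3) e by (auto simp: face_ideal_def ft res_diff)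
                ultimately show "res F ((w1 * w2) * (h * b) - \<alpha> * q) = 0"
                  by (simp add: res_diff res_mult)
              qed
              ultimately show ?thesis using I12 D_m[OF 1(1) 2(1)] qV by blast
            next
              case False
              then obtain v where v: "v \<in> V" "var v \<notin> P" by blast
              have vanish: "var v * z \<in> face_ideal V ((\<lambda>e. {fst e, snd e}) ` Es)"
                if "\<forall>e\<in>Es. v \<notin> {fst e, snd e}" "z \<in> Pol V" for z :: "'k mpoly" and Es
                using that v by (auto simp: face_ideal_def res_mult res_var)
              have fti: "G1.facet ` E1 = (\<lambda>e. {fst e, snd e}) ` E1" "G2.facet ` E2 = (\<lambda>e. {fst e, snd e}) ` E2"
                by (simp_all add: ft)
              have m: "(var v * w') * (h * b) - \<alpha> * (var v * h * q) = (var v * h) * (w' * b - \<alpha> * q)"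
                "(var v * w') * (h * b) - \<alpha> * (var v * h * q) = var v * (h * (w' * b - \<alpha> * q))" for w' q
                by (simp_all add: algebra_simps)
              have vh: "var v * h \<in> Pol V" using v hV by auto
              show ?thesis
              proof (cases "\<forall>e\<in>E2. v \<notin> {fst e, snd e}")
                case True
                have "(var v * w1) * (h * b) - \<alpha> * (var v * h * q1) \<in> G1.J"
                  unfolding m(1) using 1 vh by (intro ideal_inD(4)[OF G1.J_ideal])
                moreover have "(var v * w1) * (h * b) - \<alpha> * (var v * h * q1) \<in> G2.J"
                  unfolding m(2) fti using True 1 hV b \<alpha> by (intro vanish) auto
                ultimately have mem: "(var v * w1) * (h * b) - \<alpha> * (var v * h * q1) \<in> ?I"
                  unfolding I12 by (intro IntI)
                have "var v \<in> Pol V - P" using v by simp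
                then have sD: "var v * w1 \<in> Pol V - P" by (rule D_m) (rule 1(1))
                have qP: "var v * h * q1 \<in> Pol V" by (rule Pol_mult[OF vh 1(2)])
                show ?thesis
                  by (rule bexI[of _ "var v * w1", OF _ sD], rule bexI[of _ "var v * h * q1", OF _ qP], rule mem)
              next
                case False
                then have E1: "\<forall>e\<in>E1. v \<notin> {fst e, snd e}" using disj by blast
                have "(var v * w2) * (h * b) - \<alpha> * (var v * h * q2) \<in> G2.J"
                  unfolding m(1) using 2 vh by (intro ideal_inD(4)[OF G2.J_ideal])
                moreover have "(var v * w2) * (h * b) - \<alpha> * (var v * h * q2) \<in> G1.J"
                  unfolding m(2) fti using E1 2 hV b \<alpha> by (intro vanish) auto
                ultimately have mem: "(var v * w2) * (h * b) - \<alpha> * (var v * h * q2) \<in> ?I"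
                  unfolding I12 by (intro IntI)
                have "var v \<in> Pol V - P" using v by simp
                then have sD: "var v * w2 \<in> Pol V - P" by (rule D_m) (rule 2(1))
                have qP: "var v * h * q2 \<in> Pol V" by (rule Pol_mult[OF vh 2(2)])
                show ?thesis
                  by (rule bexI[of _ "var v * w2", OF _ sD], rule bexI[of _ "var v * h * q2", OF _ qP], rule mem)
              qed
            qed
            then obtain s q where s: "s \<in> Pol V - P" "q \<in> Pol V" "s * (h * b) - \<alpha> * q \<in> ?I" by blast
            have "s * (h * b) = (s * (h * b) - \<alpha> * q) + \<alpha> * q" by simp
            then have "s * (h * b) \<in> ideal_plus (Pol V) ?I \<alpha>" using s unfolding ideal_plus_def by blast
            then show ?thesis using s(1) unfolding take1 by (intro bexI[of _ s]) (auto simp: ideal_ext_def)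
          qed
        qed
      qed
    qed
    then have "buchsbaum_local (localization (mpoly_ring V Quot ?I) S)"
      unfolding buchsbaum_local_def using lq.local_ring_B by blast
    then show ?thesis by (simp add: S_def)
  qed
  then show ?thesis unfolding buchsbaum_complex_iff[OF V sc] by blast
qed

section \<open>Complexes that are not Buchsbaum\<close>

definition irrelevant :: "nat set \<Rightarrow> 'k::field mpoly set" where
  "irrelevant V = {f \<in> Pol V. res {} f = 0}"

lemma prime_res: "prime_in (Pol V) {p \<in> Pol V. res F p = (0 :: 'k::field mpoly)}"
  by (auto simp: prime_in_def ideal_in_def res_add res_mult)

lemma constant_term: "\<exists>c. res {} f = cst c" for f :: "'k::field mpoly"
  by (rule Pol_empty) simp

definition radical_in :: "nat set \<Rightarrow> 'k::field mpoly set \<Rightarrow> 'k mpoly set" where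
  "radical_in V E = {f \<in> Pol V. \<exists>n. f ^ n \<in> E}"

lemma radical_ideal:
  fixes E :: "'k::field mpoly set"
  assumes E: "ideal_in (Pol V) E"
  shows "ideal_in (Pol V) (radical_in V E)"
  unfolding ideal_in_def
  proof (intro conjI ballI)
    show "radical_in V E \<subseteq> Pol V" by (auto simp: radical_in_def)
    show "0 \<in> radical_in V E" using ideal_inD(2)[OF E] by (auto simp: radical_in_def intro!: exI[of _ 1])
    show "x + y \<in> radical_in V E" if xy: "x \<in> radical_in V E" "y \<in> radical_in V E" for x y
    proof -
      obtain k l where kl: "x ^ k \<in> E" "y ^ l \<in> E" and xyV: "x \<in> Pol V" "y \<in> Pol V"
        using xy by (auto simp: radical_in_def)
      have "(x + y) ^ (k + l) = (\<Sum>j\<le>k + l. of_nat ((k + l) choose j) * x ^ j * y ^ (k + l - j))"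
        by (rule binomial_ring)
      also have "\<dots> \<in> E"
      proof (rule ideal_in_sum[OF E])
        fix j assume j: "j \<in> {..k + l}"
        have cV: "of_nat n \<in> (Pol V :: 'k mpoly set)" for n by (induction n) auto
        show "of_nat ((k + l) choose j) * x ^ j * y ^ (k + l - j) \<in> E"
        proof (cases "k \<le> j")
          case True
          then have "x ^ j = x ^ (j - k) * x ^ k" by (simp flip: power_add)
          then have eq: "of_nat ((k + l) choose j) * x ^ j * y ^ (k + l - j)
              = (of_nat ((k + l) choose j) * x ^ (j - k) * y ^ (k + l - j)) * x ^ k"
            by (simp add: mult_ac)
          show ?thesis unfolding eq
            by (rule ideal_inD(4)[OF E _ kl(1)]) (intro Pol_mult cV Pol_power xyV)
        next
          case False
          then have "y ^ (k + l - j) = y ^ (k - j) * y ^ l" by (simp flip: power_add)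
          then have eq: "of_nat ((k + l) choose j) * x ^ j * y ^ (k + l - j)
              = (of_nat ((k + l) choose j) * x ^ j * y ^ (k - j)) * y ^ l"
            by (simp add: mult_ac)
          show ?thesis unfolding eq
            by (rule ideal_inD(4)[OF E _ kl(2)]) (intro Pol_mult cV Pol_power xyV)
        qed
      qed
      finally show ?thesis using xyV by (auto simp: radical_in_def)
    qed
    show "r * x \<in> radical_in V E" if rx: "r \<in> Pol V" "x \<in> radical_in V E" for r x
    proof -
      obtain k where k: "x ^ k \<in> E" "x \<in> Pol V" using rx by (auto simp: radical_in_def)
      have "r ^ k * x ^ k \<in> E" using k rx by (intro ideal_inD(4)[OF E]) auto
      then have "(r * x) ^ k \<in> E" by (simp add: power_mult_distrib)
      then show ?thesis using k rx by (auto simp: radical_in_def)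
    qed
  qed

context mpoly_quotient
begin

lemma irrelevant_maximal:
  assumes sub: "I \<subseteq> irrelevant V"
  shows "maximalideal (coset ` irrelevant V) A"
proof -
  let ?m = "irrelevant V :: 'k mpoly set"
  have mid: "ideal_in (Pol V) ?m" unfolding irrelevant_def using prime_res by (auto simp: prime_in_def)
  have mV: "?m \<subseteq> Pol V" by (auto simp: irrelevant_def)
  have mem: "coset f \<in> coset ` ?m \<longleftrightarrow> f \<in> ?m" if "f \<in> Pol V" for f
  proof
    assume "coset f \<in> coset ` ?m"
    then obtain g where g: "g \<in> ?m" "f - g \<in> I" by (auto simp: coset_eq)
    then have "(f - g) + g \<in> ?m" using sub by (intro ideal_inD(3)[OF mid]) auto
    then show "f \<in> ?m" by simp
  qed simp
  have id: "ideal (coset ` ?m) A"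
  proof (rule idealI[OF A.ring_axioms])
    show "subgroup (coset ` ?m) (add_monoid A)"
    proof (rule A.add.subgroupI)
      show "coset ` ?m \<subseteq> carrier A" using mV by (auto simp: carrier_A)
      show "coset ` ?m \<noteq> {}" using ideal_inD(2)[OF mid] by blast
      show "\<ominus>\<^bsub>A\<^esub> a \<in> coset ` ?m" if a: "a \<in> coset ` ?m" for a
      proof -
        obtain f where f: "a = coset f" "f \<in> ?m" using a by blast
        then have fV: "f \<in> Pol V" using mV by blast
        have "\<ominus>\<^bsub>A\<^esub> a = coset (- f)"
          using f fV by (intro A.minus_equality) (auto simp: coset_add coset_0 carrier_A)
        then show ?thesis using ideal_in_Pol_uminus[OF mid f(2)] by blast
      qed
      show "a \<oplus>\<^bsub>A\<^esub> b \<in> coset ` ?m" if ab: "a \<in> coset ` ?m" "b \<in> coset ` ?m" for a b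
      proof -
        obtain f g where f: "a = coset f" "f \<in> ?m" "b = coset g" "g \<in> ?m" using ab by blast
        then have "a \<oplus>\<^bsub>A\<^esub> b = coset (f + g)" using mV by (subst f, subst f, intro coset_add) auto
        then show ?thesis using ideal_inD(3)[OF mid f(2,4)] by blast
      qed
    qed
    have mult: "x \<otimes>\<^bsub>A\<^esub> a \<in> coset ` ?m" if ax: "a \<in> coset ` ?m" "x \<in> carrier A" for a x
    proof -
      obtain f g where f: "a = coset f" "f \<in> ?m" "x = coset g" "g \<in> Pol V" using ax by (auto simp: carrier_A)
      then have "x \<otimes>\<^bsub>A\<^esub> a = coset (g * f)" using mV by (subst f, subst f, intro coset_mult) auto
      then show ?thesis using ideal_inD(4)[OF mid f(4,2)] by blast
    qed
    show "x \<otimes>\<^bsub>A\<^esub> a \<in> coset ` ?m" if "a \<in> coset ` ?m" "x \<in> carrier A" for a x by (rule mult[OF that])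
    show "a \<otimes>\<^bsub>A\<^esub> x \<in> coset ` ?m" if ax: "a \<in> coset ` ?m" "x \<in> carrier A" for a x
    proof -
      have "a \<in> carrier A" using ax mV by (auto simp: carrier_A)
      then show ?thesis using mult[OF ax] A.m_comm[of a x] ax by simp
    qed
  qed
  show ?thesis
  proof (rule maximalidealI[OF id])
    have "1 \<notin> ?m" by (simp add: irrelevant_def)
    then have "\<one>\<^bsub>A\<^esub> \<notin> coset ` ?m" using mem[of 1] by (simp add: coset_1)
    then show "carrier A \<noteq> coset ` ?m" by (metis A.one_closed)
    fix N assume N: "ideal N A" "coset ` ?m \<subseteq> N" "N \<subseteq> carrier A"
    interpret N: ideal N A by (rule N(1))
    show "N = coset ` ?m \<or> N = carrier A"
    proof (cases "N \<subseteq> coset ` ?m")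
      case False
      then obtain x where x: "x \<in> N" "x \<notin> coset ` ?m" by blast
      then obtain f where "x = coset f" "f \<in> Pol V" using N(3) unfolding carrier_A by blast
      with x have f: "coset f \<in> N" "f \<in> Pol V" "f \<notin> ?m" by auto
      obtain c where c: "res {} f = cst c" using constant_term by blast
      then have "c \<noteq> 0" using f by (auto simp: irrelevant_def)
      define g where "g = cst (inverse c) * f"
      have gV: "g \<in> Pol V" using f by (simp add: g_def)
      have "coset g = coset (cst (inverse c)) \<otimes>\<^bsub>A\<^esub> coset f" using f by (simp add: g_def coset_mult)
      then have gN: "coset g \<in> N" using f by (auto simp: carrier_A intro: N.I_l_closed)
      have "res {} g = 1"
        using c \<open>c \<noteq> 0\<close> by (simp add: g_def res_mult res_id[OF Pol_cst] cst_mult[symmetric])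
      then have "1 - g \<in> ?m" using gV by (simp add: irrelevant_def res_diff)
      then have "coset (1 - g) \<in> N" using N(2) by blast
      then have "coset (1 - g) \<oplus>\<^bsub>A\<^esub> coset g \<in> N"
        using gN additive_subgroup.a_closed[OF N.additive_subgroup_axioms] by blast
      then have "\<one>\<^bsub>A\<^esub> \<in> N" using gV by (simp add: coset_add coset_1)
      then show ?thesis using N.one_imp_carrier by blast
    qed (use N in blast)
  qed
qed

end

text \<open>The failure is tested at the irrelevant maximal ideal, whose complement consists of the
  polynomials with nonzero constant term. The ideals of the faces of \<open>G\<close> that are obtained by
  deleting one vertex after the other form a chain of primes, so that the given list has as many
  elements as the dimension; being a system of parameters then only requires that the variables are
  nilpotent modulo the list. In a Buchsbaum local ring the maximal ideal would move \<open>b\<close> into the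
  ideal of the first \<open>i\<close> parameters.\<close>

lemma not_buchsbaumI:
  assumes V: "finite V" and \<Delta>: "simplicial_complex V \<Delta>"
    and as: "set as \<subseteq> (irrelevant V :: 'k::field mpoly set)"
    and G: "G \<in> \<Delta>" "length as = card G" and top: "\<And>F. F \<in> \<Delta> \<Longrightarrow> card F \<le> card G"
    and rad: "\<And>v. v \<in> V \<Longrightarrow> \<exists>n. var v ^ n \<in> ideal_ext (Pol V) (face_ideal V \<Delta>) as"
    and i: "i < length as" and b: "b \<in> Pol V"
    and ib: "as ! i * b \<in> ideal_ext (Pol V) (face_ideal V \<Delta>) (take i as)"
    and h: "h \<in> irrelevant V"
    and hb: "\<And>w. w \<in> Pol V \<Longrightarrow> res {} w \<noteq> 0 \<Longrightarrow>
      w * (h * b) \<notin> ideal_ext (Pol V) (face_ideal V \<Delta>) (take i as)"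
  shows "\<not> buchsbaum_complex TYPE('k) V \<Delta>"
proof
  let ?I = "face_ideal V \<Delta> :: 'k mpoly set" and ?m = "irrelevant V :: 'k mpoly set"
  assume bb: "buchsbaum_complex TYPE('k) V \<Delta>"
  interpret mpoly_quotient V ?I "mpoly_ring V Quot ?I"
    by unfold_locales (simp_all add: face_ideal_ideal)
  have empty: "{} \<in> \<Delta>" and down: "\<And>F H. F \<in> \<Delta> \<Longrightarrow> H \<subseteq> F \<Longrightarrow> H \<in> \<Delta>" and \<Delta>V: "\<Delta> \<subseteq> Pow V"
    using \<Delta> by (auto simp: simplicial_complex_def)
  have Im: "?I \<subseteq> ?m" using empty by (auto simp: face_ideal_def irrelevant_def)
  interpret quotient_at_maximal V ?I "mpoly_ring V Quot ?I" "coset ` ?m"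
    by (rule quotient_at_maximal.intro[OF mpoly_quotient_axioms
          quotient_at_maximal_axioms.intro[OF irrelevant_maximal[OF Im]]])
  have mid: "ideal_in (Pol V) ?m" unfolding irrelevant_def using prime_res by (auto simp: prime_in_def)
  have Pm: "P = ?m"
  proof
    show "P \<subseteq> ?m"
    proof
      fix f assume "f \<in> P"
      then obtain g where g: "g \<in> ?m" "f - g \<in> ?I" by (auto simp: P_def coset_eq)
      then have "(f - g) + g \<in> ?m" using Im by (intro ideal_inD(3)[OF mid]) auto
      then show "f \<in> ?m" by simp
    qed
    show "?m \<subseteq> P" unfolding P_def using ideal_inD(1)[OF mid] by blast
  qed
  have P_mem: "f \<in> P \<longleftrightarrow> f \<in> Pol V \<and> res {} f = 0" for f
    unfolding Pm by (simp add: irrelevant_def)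
  let ?B = "localization (mpoly_ring V Quot ?I) S"
  have "buchsbaum_local ?B"
    using bb quotient_at_maximal_axioms unfolding buchsbaum_complex_iff[OF V \<Delta>] S_def by blast
  then have weak: "\<And>xs. system_of_parameters ?B lq.M xs \<Longrightarrow> weak_sequence ?B lq.M xs"
    unfolding buchsbaum_local_def using lq.local_ring_unique by blast
  have "krull_dim ?B \<le> enat (card G)"
    using top \<Delta>V V by (intro krull_dim_face_ring[OF V refl]) (auto intro: finite_subset)
  moreover have "enat (card G) \<le> krull_dim ?B"
  proof -
    have "finite G" using G \<Delta>V V by (auto intro: finite_subset)
    then obtain gs where gs: "set gs = G" "distinct gs" using finite_distinct_list by blast
    define q where "q k = {p \<in> Pol V. res (set (drop k gs)) p = (0 :: 'k mpoly)}" for k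
    show ?thesis
    proof (rule lq.krull_dim_ge_chain)
      fix k assume "k \<le> card G"
      have "set (drop k gs) \<in> \<Delta>" using gs G down set_drop_subset by metis
      moreover have "res {} p = 0" if "res H p = 0" for H and p :: "'k mpoly"
        using res_res[of "{}" H p] that by simp
      ultimately show "prime_in (Pol V) (q k) \<and> ?I \<subseteq> q k \<and> q k \<subseteq> P"
        unfolding Pm q_def using prime_res[of V "set (drop k gs)"] by (auto simp: face_ideal_def irrelevant_def)
    next
      fix k assume k: "k < card G"
      then have kl: "k < length gs" using gs distinct_card by fastforce
      then have dr: "drop k gs = gs ! k # drop (Suc k) gs" by (simp add: Cons_nth_drop_Suc)
      have "gs ! k \<notin> set (drop (Suc k) gs)" using gs(2) dr by (metis distinct.simps(2) distinct_drop)
      moreover have "gs ! k \<in> V" using nth_mem[OF kl] gs(1) G(1) \<Delta>V by blast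
      ultimately have "var (gs ! k) \<in> q (Suc k)" "var (gs ! k) \<notin> q k" by (auto simp: q_def dr res_var)
      moreover have "q k \<subseteq> q (Suc k)"
      proof -
        have "set (drop (Suc k) gs) \<inter> set (drop k gs) = set (drop (Suc k) gs)" using dr by auto
        then have "res (set (drop (Suc k) gs)) p = 0" if "res (set (drop k gs)) p = 0" for p :: "'k mpoly"
          using res_res[of "set (drop (Suc k) gs)" "set (drop k gs)" p] that by simp
        then show ?thesis unfolding q_def by blast
      qed
      ultimately show "q k \<subset> q (Suc k)" by blast
    qed
  qed
  ultimately have dim: "krull_dim ?B = enat (length as)" using G by simp
  have asV: "set as \<subseteq> Pol V" using as by (auto simp: irrelevant_def)
  let ?E = "ideal_ext (Pol V) ?I as"
  have E: "ideal_in (Pol V) ?E" by (rule ideal_in_ext[OF subring_Pol face_ideal_ideal asV])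
  define N where "N = radical_in V ?E"
  have N: "ideal_in (Pol V) N" unfolding N_def by (rule radical_ideal[OF E])
  have "system_of_parameters ?B lq.M (map (\<lambda>a. frac a 1) as)"
  proof (rule lq.system_of_parametersI)
    show "set as \<subseteq> P" using as Pm by simp
    show "krull_dim ?B = enat (length as)" by (rule dim)
    fix a assume "a \<in> P"
    then have a: "a \<in> Pol V" "res {} a = 0" by (auto simp: P_mem)
    have "a - res {} a \<in> N"
      using rad by (intro diff_res_in_ideal[OF a(1) N]) (auto simp: N_def radical_in_def)
    then obtain n where "a ^ n \<in> ?E" using a by (auto simp: N_def radical_in_def)
    then show "\<exists>w\<in>lq.D. \<exists>n. w * a ^ n \<in> ?E" using lq.D_1 by (intro bexI[of _ 1] exI[of _ n]) auto
  qed
  from lq.weak_sequenceD[OF weak[OF this] _ i b ib]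
  obtain w where "w \<in> lq.D" "w * (h * b) \<in> ideal_ext (Pol V) ?I (take i as)"
    using as h Pm by blast
  moreover have "w \<in> Pol V" "res {} w \<noteq> 0"
    using \<open>w \<in> lq.D\<close> by (auto simp: lq.D_iff P_mem)
  ultimately show False using hb by blast
qed

definition sqfree_monomial :: "nat set \<Rightarrow> 'k::field mpoly" where "sqfree_monomial \<sigma> = (\<Prod>v\<in>\<sigma>. var v)"

lemma res_mon:
  assumes "finite \<sigma>"
  shows "res F (sqfree_monomial \<sigma>) = (if \<sigma> \<subseteq> F then sqfree_monomial \<sigma> else (0 :: 'k::field mpoly))"
proof (cases "\<sigma> \<subseteq> F")
  case True
  then show ?thesis unfolding sqfree_monomial_def res_prod by (auto simp: res_var intro!: prod.cong)
next
  case False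
  then obtain v where "v \<in> \<sigma>" "v \<notin> F" by blast
  then have "(\<Prod>i\<in>\<sigma>. res F (var i :: 'k mpoly)) = 0"
    using assms by (intro prod_zero) (auto simp: res_var)
  then show ?thesis using False by (simp add: sqfree_monomial_def res_prod)
qed

lemma mon_neq_0 [simp]: "sqfree_monomial \<sigma> \<noteq> (0 :: 'k::field mpoly)"
  unfolding sqfree_monomial_def by (induction \<sigma> rule: infinite_finite_induct) auto

lemma mon_Pol: "\<sigma> \<subseteq> V \<Longrightarrow> sqfree_monomial \<sigma> \<in> Pol V"
  unfolding sqfree_monomial_def by (intro Pol_prod) auto

lemma mon_mult: "finite \<sigma> \<Longrightarrow> finite \<tau> \<Longrightarrow> sqfree_monomial \<sigma> * sqfree_monomial \<tau> = sqfree_monomial (\<sigma> \<union> \<tau>) * sqfree_monomial (\<sigma> \<inter> \<tau>)"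
  unfolding sqfree_monomial_def by (simp add: prod.union_inter)

lemma res_mon_sum:
  assumes "finite A" "\<And>\<sigma>. \<sigma> \<in> A \<Longrightarrow> finite \<sigma>"
  shows "res F (\<Sum>\<sigma>\<in>A. sqfree_monomial \<sigma>) = (\<Sum>\<sigma> | \<sigma> \<in> A \<and> \<sigma> \<subseteq> F. sqfree_monomial \<sigma>)"
proof -
  have "res F (\<Sum>\<sigma>\<in>A. sqfree_monomial \<sigma>) = (\<Sum>\<sigma>\<in>A. if \<sigma> \<subseteq> F then sqfree_monomial \<sigma> else 0)"
    unfolding res_sum using assms by (intro sum.cong) (auto simp: res_mon)
  also have "\<dots> = (\<Sum>\<sigma> | \<sigma> \<in> A \<and> \<sigma> \<subseteq> F. sqfree_monomial \<sigma>)"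
    using assms by (simp add: sum.inter_filter)
  finally show ?thesis .
qed

lemma nonface_in_face_ideal:
  assumes "simplicial_complex V \<Delta>" "finite V" "\<sigma> \<subseteq> V" "\<sigma> \<notin> \<Delta>"
  shows "sqfree_monomial \<sigma> \<in> (face_ideal V \<Delta> :: 'k::field mpoly set)"
proof -
  have "finite \<sigma>" using assms by (auto intro: finite_subset)
  then show ?thesis using assms by (auto simp: face_ideal_def mon_Pol res_mon simplicial_complex_def)
qed

text \<open>The elementary symmetric polynomial of degree \<open>j\<close> in the variables \<open>W\<close>, modulo the ideal of the
  complex.\<close>

definition face_sum :: "nat set set \<Rightarrow> nat set \<Rightarrow> nat \<Rightarrow> 'k::field mpoly" where
  "face_sum \<Delta> W j = (\<Sum>\<sigma> | \<sigma> \<in> \<Delta> \<and> \<sigma> \<subseteq> W \<and> card \<sigma> = j. sqfree_monomial \<sigma>)"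

text \<open>Descending induction on the size of a face \<open>\<sigma>\<close> shows that its monomial is nilpotent modulo \<open>E\<close>:
  \<open>\<sigma>\<^sup>2\<close> equals \<open>\<sigma>\<close> times the sum of all faces of that size minus products \<open>\<sigma> \<tau>\<close>, and the latter are
  multiples of the monomials of the larger sets \<open>\<sigma> \<union> \<tau>\<close>.\<close>

lemma face_sums_radical:
  fixes E :: "'k::field mpoly set"
  assumes V: "finite V" and \<Delta>: "simplicial_complex V \<Delta>" and W: "W \<subseteq> V"
    and E: "ideal_in (Pol V) E" "face_ideal V \<Delta> \<subseteq> E"
    and top: "\<And>\<sigma>. \<sigma> \<in> \<Delta> \<Longrightarrow> \<sigma> \<subseteq> W \<Longrightarrow> card \<sigma> \<le> d"
    and s: "\<And>j. 1 \<le> j \<Longrightarrow> j \<le> d \<Longrightarrow> face_sum \<Delta> W j \<in> E" and v: "v \<in> W"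
  shows "\<exists>n. var v ^ n \<in> E"
proof -
  define N where "N = radical_in V E"
  have N: "ideal_in (Pol V) N" unfolding N_def by (rule radical_ideal[OF E(1)])
  have EN: "x \<in> N" if "x \<in> E" for x
    using that ideal_inD(1)[OF E(1) that] by (auto simp: N_def radical_in_def intro!: exI[of _ 1])
  have fin: "finite \<tau>" if "\<tau> \<subseteq> W" for \<tau> using that W V by (meson finite_subset)
  have monV: "sqfree_monomial \<tau> \<in> Pol V" if "\<tau> \<subseteq> W" for \<tau> using that W by (intro mon_Pol) blast
  have face: "sqfree_monomial \<sigma> \<in> N" if "\<sigma> \<in> \<Delta>" "\<sigma> \<subseteq> W" "\<sigma> \<noteq> {}" for \<sigma>
    using that
  proof (induction "d - card \<sigma>" arbitrary: \<sigma> rule: less_induct)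
    case less
    have c1: "1 \<le> card \<sigma>" "card \<sigma> \<le> d" using less fin top by (auto simp: Suc_le_eq card_gt_0_iff)
    let ?A = "{\<tau>. \<tau> \<in> \<Delta> \<and> \<tau> \<subseteq> W \<and> card \<tau> = card \<sigma>}"
    have finA: "finite ?A" using W V by (auto intro: finite_subset[of _ "Pow V"])
    have \<sigma>A: "\<sigma> \<in> ?A" using less by simp
    have other: "sqfree_monomial \<sigma> * sqfree_monomial \<tau> \<in> N" if \<tau>: "\<tau> \<in> ?A - {\<sigma>}" for \<tau>
    proof -
      have fs: "finite \<sigma>" "finite \<tau>" using fin less \<tau> by auto
      have un: "\<sigma> \<union> \<tau> \<subseteq> W" using less \<tau> by auto
      have "\<not> \<tau> \<subseteq> \<sigma>" using card_subset_eq[OF fs(1), of \<tau>] \<tau> by auto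
      then have "\<sigma> \<subset> \<sigma> \<union> \<tau>" by blast
      then have bigger: "card \<sigma> < card (\<sigma> \<union> \<tau>)" using fs by (intro psubset_card_mono) auto
      have "sqfree_monomial (\<sigma> \<union> \<tau>) \<in> N"
      proof (cases "\<sigma> \<union> \<tau> \<in> \<Delta>")
        case True
        then have "d - card (\<sigma> \<union> \<tau>) < d - card \<sigma>" using bigger top[OF True un] by linarith
        then show ?thesis using less(1)[of "\<sigma> \<union> \<tau>"] True un less(4) by blast
      next
        case False
        then show ?thesis using nonface_in_face_ideal[OF \<Delta> V] un W E(2) EN by blast
      qed
      moreover have "sqfree_monomial (\<sigma> \<inter> \<tau>) \<in> Pol V" using less by (intro monV) blast
      ultimately show ?thesis unfolding mon_mult[OF fs] by (rule ideal_inD(5)[OF N, rotated])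
    qed
    have "sqfree_monomial \<sigma> * face_sum \<Delta> W (card \<sigma>) = (\<Sum>\<tau>\<in>?A. sqfree_monomial \<sigma> * sqfree_monomial \<tau>)"
      by (simp add: face_sum_def sum_distrib_left)
    also have "\<dots> = sqfree_monomial \<sigma> * sqfree_monomial \<sigma> + (\<Sum>\<tau>\<in>?A - {\<sigma>}. sqfree_monomial \<sigma> * sqfree_monomial \<tau>)"
      by (rule sum.remove[OF finA \<sigma>A])
    finally have "sqfree_monomial \<sigma> * sqfree_monomial \<sigma>
        = sqfree_monomial \<sigma> * face_sum \<Delta> W (card \<sigma>) - (\<Sum>\<tau>\<in>?A - {\<sigma>}. sqfree_monomial \<sigma> * sqfree_monomial \<tau>)"
      unfolding eq_diff_eq by (rule sym)
    also have "\<dots> \<in> N"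
      using other by (intro ideal_in_Pol_diff[OF N] ideal_inD(4)[OF N monV[OF less(3)] EN[OF s[OF c1]]]
          ideal_in_sum[OF N])
    finally have "sqfree_monomial \<sigma> ^ 2 \<in> N" by (simp add: power2_eq_square)
    then obtain n where "(sqfree_monomial \<sigma> ^ 2) ^ n \<in> E" by (auto simp: N_def radical_in_def)
    then have "sqfree_monomial \<sigma> ^ (2 * n) \<in> E" by (simp add: power_mult)
    then show ?case using monV[OF less(3)] unfolding N_def radical_in_def by blast
  qed
  have "sqfree_monomial {v} \<in> N"
  proof (cases "{v} \<in> \<Delta>")
    case False
    then show ?thesis using nonface_in_face_ideal[OF \<Delta> V _ False] v W E(2) EN by blast
  qed (use face v in simp)
  then show ?thesis by (simp add: sqfree_monomial_def N_def radical_in_def)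
qed

text \<open>Let \<open>d\<close> be the largest size of a face and \<open>F\<close> a facet of smaller size. The face sums of degrees
  \<open>d, \<dots>, 1\<close>, in this order, are a system of parameters. No face of size \<open>d\<close> is compatible with \<open>F\<close>,
  so the first parameter kills the monomial of \<open>F\<close>; but this monomial is not killed by a variable
  \<open>x\<^sub>v\<close> with \<open>v \<in> F\<close>, as restriction to \<open>F\<close> shows.\<close>

theorem not_pure_imp_not_buchsbaum:
  assumes V: "finite V" and \<Delta>: "simplicial_complex V \<Delta>" and np: "\<not> pure_complex \<Delta>"
  shows "\<not> buchsbaum_complex TYPE('k::field) V \<Delta>"
proof -
  let ?I = "face_ideal V \<Delta> :: 'k mpoly set"
  have empty: "{} \<in> \<Delta>" and down: "\<And>F H. F \<in> \<Delta> \<Longrightarrow> H \<subseteq> F \<Longrightarrow> H \<in> \<Delta>" and \<Delta>V: "\<Delta> \<subseteq> Pow V"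
    using \<Delta> by (auto simp: simplicial_complex_def)
  have fin: "finite F" if "F \<subseteq> V" for F using that V by (rule finite_subset)
  have fin\<Delta>: "finite \<Delta>" using \<Delta>V V by (meson finite_Pow_iff finite_subset)
  obtain F1 F2 where F12: "F1 \<in> facets \<Delta>" "F2 \<in> facets \<Delta>" "card F1 \<noteq> card F2"
    using np unfolding pure_complex_def by blast
  have "\<exists>F G0. F \<in> facets \<Delta> \<and> G0 \<in> facets \<Delta> \<and> card F < card G0"
  proof (cases "card F1 < card F2")
    case False
    then have "card F2 < card F1" using F12(3) by simp
    then show ?thesis using F12 by blast
  qed (use F12 in blast)
  then obtain F G0 where FG: "F \<in> facets \<Delta>" "G0 \<in> \<Delta>" "card F < card G0"
    unfolding facets_def by blast
  have "Max (card ` \<Delta>) \<in> card ` \<Delta>" using fin\<Delta> empty by (intro Max_in) auto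
  then obtain G where Gm: "G \<in> \<Delta>" "Max (card ` \<Delta>) = card G" by blast
  have "card H \<le> card G" if "H \<in> \<Delta>" for H
    unfolding Gm(2)[symmetric] using fin\<Delta> that by (intro Max_ge) auto
  note G = Gm(1) this
  have Fd: "card F < card G" using FG G(2)[of G0] by simp
  have F: "F \<in> \<Delta>" "\<And>H. H \<in> \<Delta> \<Longrightarrow> F \<subseteq> H \<Longrightarrow> H = F" using FG by (auto simp: facets_def)
  have FV: "F \<subseteq> V" using F \<Delta>V by blast
  have "F \<noteq> {}"
  proof
    assume "F = {}"
    then have "G = {}" using F(2)[OF G(1)] by simp
    then show False using Fd by simp
  qed
  then obtain v where v: "v \<in> F" by blast
  define d where "d = card G"
  let ?s = "\<lambda>j. face_sum \<Delta> V j :: 'k mpoly"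
  have sm: "?s j \<in> irrelevant V" if "1 \<le> j" for j
  proof -
    have "?s j \<in> Pol V" unfolding face_sum_def by (intro Pol_sum mon_Pol) auto
    moreover have "res {} (?s j) = 0"
      unfolding face_sum_def using fin\<Delta> fin that
      by (subst res_mon_sum) (auto intro!: sum.neutral)
    ultimately show ?thesis by (simp add: irrelevant_def)
  qed
  let ?as = "map (\<lambda>k. ?s (d - k)) [0..<d]"
  show ?thesis
  proof (rule not_buchsbaumI[OF V \<Delta>, of ?as G 0 "sqfree_monomial F" "var v"])
    show "set ?as \<subseteq> irrelevant V" using sm by auto
    then have asV: "set ?as \<subseteq> Pol V" by (auto simp: irrelevant_def)
    show "G \<in> \<Delta>" "length ?as = card G" using G by (auto simp: d_def)
    show "card H \<le> card G" if "H \<in> \<Delta>" for H by (rule G(2)[OF that])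
    show "\<exists>n. var w ^ n \<in> ideal_ext (Pol V) ?I ?as" if w: "w \<in> V" for w
    proof (rule face_sums_radical[OF V \<Delta> order_refl _ _ _ _ w])
      show "ideal_in (Pol V) (ideal_ext (Pol V) ?I ?as)"
        by (rule ideal_in_ext[OF subring_Pol face_ideal_ideal asV])
      show "?I \<subseteq> ideal_ext (Pol V) ?I ?as" by (rule ideal_ext_superset) simp
      show "card \<sigma> \<le> d" if "\<sigma> \<in> \<Delta>" for \<sigma> using G(2)[OF that] by (simp add: d_def)
      fix j assume j: "1 \<le> j" "j \<le> d"
      then have "?s j \<in> set ?as" by (auto intro!: image_eqI[of _ _ "d - j"])
      then show "?s j \<in> ideal_ext (Pol V) ?I ?as"
        using ideal_ext_gen[OF subring_Pol face_ideal_ideal asV] by blast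
    qed
    show "0 < length ?as" using Fd by (simp add: d_def)
    show "sqfree_monomial F \<in> Pol V" using FV by (rule mon_Pol)
    have "?s d * sqfree_monomial F \<in> ?I"
      unfolding face_sum_def sum_distrib_right
    proof (rule ideal_in_sum[OF face_ideal_ideal])
      fix \<tau> assume \<tau>: "\<tau> \<in> {\<sigma>. \<sigma> \<in> \<Delta> \<and> \<sigma> \<subseteq> V \<and> card \<sigma> = d}"
      have "\<tau> \<union> F \<notin> \<Delta>"
      proof
        assume "\<tau> \<union> F \<in> \<Delta>"
        then have "\<tau> \<subseteq> F" using F(2)[of "\<tau> \<union> F"] by auto
        then have "card \<tau> \<le> card F" using fin[OF FV] by (intro card_mono)
        then show False using \<tau> Fd by (simp add: d_def)
      qed
      then have un: "sqfree_monomial (\<tau> \<union> F) \<in> ?I"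
        using \<tau> FV by (intro nonface_in_face_ideal[OF \<Delta> V]) auto
      have inter: "sqfree_monomial (\<tau> \<inter> F) \<in> Pol V" using FV by (intro mon_Pol) blast
      have fs: "finite \<tau>" "finite F" using \<tau> FV fin by auto
      show "sqfree_monomial \<tau> * sqfree_monomial F \<in> ?I"
        unfolding mon_mult[OF fs] by (rule ideal_inD(5)[OF face_ideal_ideal inter un])
    qed
    then show "?as ! 0 * sqfree_monomial F \<in> ideal_ext (Pol V) ?I (take 0 ?as)"
      using Fd by (simp add: d_def)
    show "var v \<in> irrelevant V" using v FV by (auto simp: irrelevant_def res_var)
    fix w :: "'k mpoly" assume w: "w \<in> Pol V" "res {} w \<noteq> 0"
    show "w * (var v * sqfree_monomial F) \<notin> ideal_ext (Pol V) ?I (take 0 ?as)"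
    proof
      assume "w * (var v * sqfree_monomial F) \<in> ideal_ext (Pol V) ?I (take 0 ?as)"
      then have "res F (w * (var v * sqfree_monomial F)) = 0" using F(1) by (simp add: face_ideal_def)
      then have "res F w = 0" using v fin[OF FV] by (simp add: res_mult res_var res_mon)
      then show False using w(2) res_res[of "{}" F w] by simp
    qed
  qed
qed

text \<open>The face sums \<open>s\<^sub>1\<close>, \<open>s\<^sub>2\<close> in the variables of the graph and the cone variables are a system of
  parameters. Let \<open>y\<^sub>1\<close> and \<open>y\<^sub>2\<close> be the parts of these sums supported on the first component. Then
  \<open>s\<^sub>2 y\<^sub>1 = s\<^sub>1 y\<^sub>2\<close>, because on the first component the parts are the full sums and on the second one
  they vanish. If \<open>w x\<^sub>t y\<^sub>1 = s\<^sub>1 c\<close> held for a cone point \<open>t\<close> and some \<open>w\<close> with nonzero constant term,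
  then restriction to a vertex of the first component together with \<open>T\<close> would give \<open>c = w x\<^sub>t\<close>,
  and restriction to a vertex of the second component together with \<open>T\<close> would give \<open>c = 0\<close>; these
  contradict each other on \<open>T\<close>, which contains \<open>t\<close>.\<close>

theorem cone_over_disconnected_graph_not_buchsbaum:
  assumes V: "finite V" and T: "T \<subseteq> V" "T \<noteq> {}" and E: "E1 \<subseteq> V \<times> V" "E2 \<subseteq> V \<times> V" "E1 \<noteq> {}" "E2 \<noteq> {}"
    and edge: "\<And>e. e \<in> E1 \<union> E2 \<Longrightarrow> fst e \<noteq> snd e \<and> fst e \<notin> T \<and> snd e \<notin> T"
    and disj: "\<And>e e'. e \<in> E1 \<Longrightarrow> e' \<in> E2 \<Longrightarrow> {fst e, snd e} \<inter> {fst e', snd e'} = {}"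
    and \<Delta>: "\<Delta> = {F. \<exists>e\<in>E1 \<union> E2. F \<subseteq> insert (fst e) (insert (snd e) T)}"
  shows "\<not> buchsbaum_complex TYPE('k::field) V \<Delta>"
proof -
  let ?I = "face_ideal V \<Delta> :: 'k mpoly set"
  define facet where "facet e = insert (fst e) (insert (snd e) T)" for e :: "nat \<times> nat"
  have EV: "fst e \<in> V \<and> snd e \<in> V" if "e \<in> E1 \<union> E2" for e using that E by auto
  have facetV: "facet e \<subseteq> V" if "e \<in> E1 \<union> E2" for e using EV[OF that] T by (auto simp: facet_def)
  have mem: "F \<in> \<Delta> \<longleftrightarrow> (\<exists>e\<in>E1 \<union> E2. F \<subseteq> facet e)" for F by (simp add: \<Delta> facet_def)
  have sc: "simplicial_complex V \<Delta>"
    unfolding simplicial_complex_def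
  proof (intro conjI ballI allI impI)
    show "\<Delta> \<subseteq> Pow V" using mem facetV by blast
    show "{} \<in> \<Delta>" using mem E(3) by blast
    show "H \<in> \<Delta>" if "F \<in> \<Delta>" "H \<subseteq> F" for F H using that by (meson mem order_trans)
  qed
  have fin: "finite F" if "F \<subseteq> V" for F using that V by (rule finite_subset)
  have finT: "finite T" using T(1) by (rule fin)
  have fin\<Delta>: "finite \<Delta>" using V mem facetV by (intro finite_subset[of \<Delta> "Pow V"]) blast+
  have cf: "card (facet e) = card T + 2" if "e \<in> E1 \<union> E2" for e
    using edge[OF that] finT by (simp add: facet_def)
  obtain e1 where e1: "e1 \<in> E1" using E(3) by blast
  obtain e2 where e2: "e2 \<in> E2" using E(4) by blast
  obtain t where t: "t \<in> T" using T(2) by blast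
  obtain ts where ts: "set ts = T" "distinct ts" using finite_distinct_list[OF finT] by blast
  define W where "W = V - T"
  have WV: "W \<subseteq> V" by (auto simp: W_def)
  let ?s = "\<lambda>j. face_sum \<Delta> W j :: 'k mpoly"
  have sm: "?s j \<in> irrelevant V" if "1 \<le> j" for j
  proof -
    have "?s j \<in> Pol V" unfolding face_sum_def using WV by (intro Pol_sum mon_Pol) auto
    moreover have "res {} (?s j) = 0"
      unfolding face_sum_def using fin\<Delta> fin WV that
      by (subst res_mon_sum) (auto intro!: sum.neutral)
    ultimately show ?thesis by (simp add: irrelevant_def)
  qed
  define V1 where "V1 = (\<Union>e\<in>E1. {fst e, snd e})"
  have V1V: "V1 \<subseteq> V" using EV by (auto simp: V1_def)
  \<comment> \<open>the parts \<open>y\<^sub>j\<close> of the face sums on the first component\<close>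
  define part where "part j = (\<Sum>\<sigma> | \<sigma> \<in> \<Delta> \<and> \<sigma> \<subseteq> W \<and> card \<sigma> = j \<and> \<sigma> \<subseteq> V1. sqfree_monomial \<sigma> :: 'k mpoly)" for j
  have partV: "part j \<in> Pol V" for j unfolding part_def using WV by (intro Pol_sum mon_Pol) auto
  have res_s: "res F (?s j) = (\<Sum>\<sigma> | (\<sigma> \<in> \<Delta> \<and> \<sigma> \<subseteq> W \<and> card \<sigma> = j) \<and> \<sigma> \<subseteq> F. sqfree_monomial \<sigma>)" for F j
    unfolding face_sum_def using fin\<Delta> fin WV by (subst res_mon_sum) auto
  have res_part: "res F (part j) = (\<Sum>\<sigma> | (\<sigma> \<in> \<Delta> \<and> \<sigma> \<subseteq> W \<and> card \<sigma> = j \<and> \<sigma> \<subseteq> V1) \<and> \<sigma> \<subseteq> F. sqfree_monomial \<sigma>)" for F j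
    unfolding part_def using fin\<Delta> fin WV by (subst res_mon_sum) auto
  have part1: "res F (part j) = res F (?s j)" if "F \<inter> W \<subseteq> V1" for F j
    unfolding res_s res_part using that by (intro sum.cong Collect_cong) auto
  have part2: "res F (part j) = 0" if "F \<inter> W \<inter> V1 = {}" "1 \<le> j" for F j
    unfolding res_part
  proof (rule sum.neutral, clarify)
    fix \<sigma> assume "\<sigma> \<subseteq> W" "\<sigma> \<subseteq> V1" "\<sigma> \<subseteq> F" "j = card \<sigma>"
    then have "\<sigma> = {}" using that by blast
    then show "sqfree_monomial \<sigma> = (0 :: 'k mpoly)" using \<open>j = card \<sigma>\<close> that by simp
  qed
  have in1: "facet e \<inter> W \<subseteq> V1" if "e \<in> E1" for e using that by (auto simp: facet_def W_def V1_def)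
  have in2: "facet e \<inter> W \<inter> V1 = {}" if "e \<in> E2" for e
    using disj[OF _ that] unfolding facet_def W_def V1_def by blast
  have vtx: "res (insert v T) (?s 1) = var v" if "v \<in> W" "insert v T \<in> \<Delta>" for v
  proof -
    have "{v} \<in> \<Delta>" using that(2) mem by blast
    then have "{\<sigma>. (\<sigma> \<in> \<Delta> \<and> \<sigma> \<subseteq> W \<and> card \<sigma> = 1) \<and> \<sigma> \<subseteq> insert v T} = {{v}}"
      using that(1) by (auto simp: card_1_singleton_iff W_def)
    then show ?thesis unfolding res_s by (simp add: sqfree_monomial_def)
  qed
  let ?as = "?s 1 # ?s 2 # map var ts"
  show ?thesis
  proof (rule not_buchsbaumI[OF V sc, of ?as "facet e1" 1 "part 1" "var t"])
    show asm: "set ?as \<subseteq> irrelevant V" using sm ts T by (auto simp: irrelevant_def res_var)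
    then have asV: "set ?as \<subseteq> Pol V" by (auto simp: irrelevant_def)
    show "facet e1 \<in> \<Delta>" using mem e1 by blast
    show "length ?as = card (facet e1)" using cf[of e1] e1 ts distinct_card by fastforce
    show "card F \<le> card (facet e1)" if F: "F \<in> \<Delta>" for F
    proof -
      obtain e where e: "e \<in> E1 \<union> E2" "F \<subseteq> facet e" using F mem by blast
      then have "card F \<le> card (facet e)" using facetV fin by (intro card_mono) auto
      then show ?thesis using cf e e1 by simp
    qed
    show "\<exists>n. var w ^ n \<in> ideal_ext (Pol V) ?I ?as" if w: "w \<in> V" for w
    proof (cases "w \<in> T")
      case True
      then have "var w \<in> set ?as" using ts by auto
      then have "var w \<in> ideal_ext (Pol V) ?I ?as"
        using ideal_ext_gen[OF subring_Pol face_ideal_ideal asV] by blast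
      then show ?thesis by (intro exI[of _ 1]) simp
    next
      case False
      then have wW: "w \<in> W" using w by (simp add: W_def)
      show ?thesis
      proof (rule face_sums_radical[OF V sc WV _ _ _ _ wW])
        show "ideal_in (Pol V) (ideal_ext (Pol V) ?I ?as)"
          by (rule ideal_in_ext[OF subring_Pol face_ideal_ideal asV])
        show "?I \<subseteq> ideal_ext (Pol V) ?I ?as" by (rule ideal_ext_superset) simp
        show "card \<sigma> \<le> 2" if \<sigma>: "\<sigma> \<in> \<Delta>" "\<sigma> \<subseteq> W" for \<sigma>
        proof -
          obtain e where "\<sigma> \<subseteq> facet e" using \<sigma> mem by blast
          then have "\<sigma> \<subseteq> {fst e, snd e}" using \<sigma>(2) by (auto simp: facet_def W_def)
          then have "card \<sigma> \<le> card {fst e, snd e}" by (intro card_mono) auto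
          also have "\<dots> \<le> 2" by (simp add: card_insert_if)
          finally show ?thesis .
        qed
        fix j :: nat assume "1 \<le> j" "j \<le> 2"
        then have "j = 1 \<or> j = 2" by auto
        then have "?s j \<in> set ?as" by auto
        then show "?s j \<in> ideal_ext (Pol V) ?I ?as"
          using ideal_ext_gen[OF subring_Pol face_ideal_ideal asV] by blast
      qed
    qed
    have take1: "take 1 ?as = [?s 1]" by simp
    have ext1: "ideal_ext (Pol V) ?I (take 1 ?as) = ideal_plus (Pol V) ?I (?s 1)"
      by (simp add: take1 ideal_ext_def)
    show "1 < length ?as" by simp
    show "part 1 \<in> Pol V" by (rule partV)
    have "?s 2 * part 1 - ?s 1 * part 2 \<in> ?I"
      unfolding face_ideal_def
    proof (intro CollectI conjI ballI)
      show "?s 2 * part 1 - ?s 1 * part 2 \<in> Pol V"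
        using sm[of 1] sm[of 2] partV by (auto simp: irrelevant_def)
      fix F assume "F \<in> \<Delta>"
      then obtain e where e: "e \<in> E1 \<union> E2" "F \<subseteq> facet e" using mem by blast
      show "res F (?s 2 * part 1 - ?s 1 * part 2) = 0"
      proof (cases "e \<in> E1")
        case True
        then have "F \<inter> W \<subseteq> V1" using in1[OF True] e by blast
        then show ?thesis using part1 by (simp add: res_diff res_mult)
      next
        case False
        then have "F \<inter> W \<inter> V1 = {}" using in2[of e] e by blast
        then show ?thesis using part2 by (simp add: res_diff res_mult)
      qed
    qed
    moreover have "?s 2 * part 1 = (?s 2 * part 1 - ?s 1 * part 2) + ?s 1 * part 2" by simp
    ultimately have "?s 2 * part 1 \<in> ideal_plus (Pol V) ?I (?s 1)"
      unfolding ideal_plus_def using partV by blast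
    then show "?as ! 1 * part 1 \<in> ideal_ext (Pol V) ?I (take 1 ?as)" unfolding ext1 by simp
    show "var t \<in> irrelevant V" using t T by (auto simp: irrelevant_def res_var)
    fix w :: "'k mpoly" assume w: "w \<in> Pol V" "res {} w \<noteq> 0"
    show "w * (var t * part 1) \<notin> ideal_ext (Pol V) ?I (take 1 ?as)"
    proof
      assume "w * (var t * part 1) \<in> ideal_ext (Pol V) ?I (take 1 ?as)"
      then obtain x c where x: "w * (var t * part 1) = x + ?s 1 * c" "x \<in> ?I" "c \<in> Pol V"
        unfolding ext1 ideal_plus_def by blast
      let ?H = "\<lambda>e. insert (fst e) T"
      have H: "?H e \<in> \<Delta>" "fst e \<in> W" if "e \<in> E1 \<union> E2" for e
        using that mem edge[OF that] EV[OF that] by (auto simp: facet_def W_def)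
      have eq: "res (?H e) w * (res (?H e) (var t) * res (?H e) (part 1)) = var (fst e) * res (?H e) c"
        if e: "e \<in> E1 \<union> E2" for e
        using arg_cong[OF x(1), of "res (?H e)"] x(2) H[OF e] vtx[OF H(2)[OF e] H(1)[OF e]]
        by (simp add: res_mult res_add face_ideal_def)
      have "res (?H e1) (part 1) = var (fst e1)"
        using vtx[OF H(2) H(1), of e1] part1[of "?H e1" 1] in1[OF e1] e1 by (auto simp: facet_def)
      then have "var (fst e1) * (res (?H e1) w * var t) = var (fst e1) * res (?H e1) c"
        using eq[of e1] e1 t by (simp add: res_var mult_ac)
      then have c1: "res (?H e1) w * var t = res (?H e1) c" by simp
      have "res T c = res T (res (?H e1) c)" by (simp add: res_res Int_absorb2 subset_insertI)
      also have "\<dots> = res T w * var t"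
        unfolding c1[symmetric] using t by (simp add: res_mult res_res res_var Int_absorb2 subset_insertI)
      finally have cT: "res T c = res T w * var t" .
      have "?H e2 \<inter> W \<inter> V1 = {}" using in2[OF e2] by (auto simp: facet_def)
      then have "res (?H e2) (part 1) = 0" using part2 by simp
      then have "res (?H e2) c = 0" using eq[of e2] e2 by simp
      then have "res T c = 0" using res_res[of T "?H e2" c] by (simp add: Int_absorb2 subset_insertI)
      then have "res T w = 0" using cT by simp
      then show False using w(2) res_res[of "{}" T w] by simp
    qed
  qed
qed

section \<open>The graph of a lexsegment\<close>

lemma lookup_XX: "lookup (X a + X b) c = (if c = a then 1 else 0) + (if c = b then 1 else 0)"
  by (auto simp: lookup_add lookup_single)

lemma X_add_less:
  assumes "a < b" "c < d" "c < a \<or> (c = a \<and> d < b)"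
  shows "X a + X b < X c + X d"
proof -
  have "less_fun (lookup (X a + X b)) (lookup (X c + X d))"
    unfolding less_fun_def
  proof (cases "c < a")
    case True
    then show "\<exists>k. lookup (X a + X b) k < lookup (X c + X d) k \<and>
        (\<forall>k'<k. lookup (X a + X b) k' = lookup (X c + X d) k')"
      using assms by (intro exI[of _ c]) (auto simp: lookup_XX simp del: One_nat_def)
  next
    case False
    then show "\<exists>k. lookup (X a + X b) k < lookup (X c + X d) k \<and>
        (\<forall>k'<k. lookup (X a + X b) k' = lookup (X c + X d) k')"
      using assms by (intro exI[of _ d]) (auto simp: lookup_XX simp del: One_nat_def)
  qed
  then show ?thesis by (simp add: less_poly_mapping.rep_eq)
qed

text \<open>The order compares exponents at the first index where they differ.\<close>

lemma X_add_le:
  assumes "a < b" "c < d"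
  shows "X a + X b \<le> X c + X d \<longleftrightarrow> c < a \<or> (c = a \<and> d \<le> b)"
proof (cases "c < a \<or> (c = a \<and> d < b)")
  case True
  then show ?thesis using X_add_less[OF assms True] by auto
next
  case False
  show ?thesis
  proof (cases "a = c \<and> b = d")
    case neq: False
    then have "a < c \<or> (a = c \<and> b < d)" using False by auto
    then show ?thesis using X_add_less[OF assms(2,1)] False neq by auto
  qed simp
qed

lemma X_add_eq:
  assumes "a < b" "c < d"
  shows "X a + X b = X c + X d \<longleftrightarrow> a = c \<and> b = d"
proof
  assume eq: "X a + X b = X c + X d"
  have "X a + X b \<le> X c + X d" "X c + X d \<le> X a + X b" by (simp_all only: eq order_refl)
  then show "a = c \<and> b = d" unfolding X_add_le[OF assms] X_add_le[OF assms(2,1)] by auto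
qed simp

lemma sqfree_monomials_2:
  "m \<in> sqfree_monomials V 2 \<longleftrightarrow> (\<exists>a b. a \<in> V \<and> b \<in> V \<and> a < b \<and> m = X a + X b)"
proof
  assume m: "m \<in> sqfree_monomials V 2"
  have one: "lookup m i = 1" if "i \<in> keys m" for i
  proof -
    have "lookup m i \<le> 1" "lookup m i \<noteq> 0" using m that by (auto simp: sqfree_monomials_def in_keys_iff)
    then show ?thesis by linarith
  qed
  have "(\<Sum>i\<in>keys m. lookup m i) = card (keys m)" using one by simp
  then have "card (keys m) = 2" using m by (simp add: sqfree_monomials_def)
  then obtain x y where xy: "keys m = {x, y}" "x \<noteq> y" by (auto simp: card_2_iff)
  define a b where "a = min x y" and "b = max x y"
  have ab: "keys m = {a, b}" "a < b" using xy by (auto simp: a_def b_def min_def max_def)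
  have "m = X a + X b"
  proof (rule poly_mapping_eqI)
    fix c show "lookup m c = lookup (X a + X b) c"
    proof (cases "c \<in> keys m")
      case True
      then show ?thesis using one[OF True] ab unfolding lookup_XX by auto
    next
      case False
      then have "lookup m c = 0" by (simp add: in_keys_iff)
      moreover have "c \<noteq> a" "c \<noteq> b" using False ab by auto
      ultimately show ?thesis by (simp only: lookup_XX if_False add_0)
    qed
  qed
  moreover have "a \<in> V" "b \<in> V" using m ab by (auto simp: sqfree_monomials_def)
  ultimately show "\<exists>a b. a \<in> V \<and> b \<in> V \<and> a < b \<and> m = X a + X b" using ab by blast
next
  assume "\<exists>a b. a \<in> V \<and> b \<in> V \<and> a < b \<and> m = X a + X b"
  then obtain a b where ab: "a \<in> V" "b \<in> V" "a < b" "m = X a + X b" by blast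
  have k: "keys m = {a, b}" unfolding ab(4) by (auto simp: in_keys_iff lookup_XX split: if_splits simp del: One_nat_def)
  have l: "lookup m c \<le> 1" for c unfolding ab(4) lookup_XX using ab(3) by auto
  have "(\<Sum>i\<in>keys m. lookup m i) = lookup m a + lookup m b" unfolding k using ab(3) by simp
  also have "\<dots> = 2" unfolding ab(4) lookup_XX using ab(3) by simp
  finally show "m \<in> sqfree_monomials V 2" using k l ab by (simp add: sqfree_monomials_def)
qed

text \<open>A set is a face exactly if its squarefree monomial is not in the ideal, which for generators of
  degree two is a condition on pairs: the complex consists of the independent sets of a graph.\<close>

lemma complex_of_quadratic_ideal:
  fixes \<Delta> :: "nat set set"
  assumes V: "finite V" and \<Delta>: "simplicial_complex V \<Delta>"
    and L: "\<And>m. m \<in> L \<Longrightarrow> \<exists>a b. a \<in> V \<and> b \<in> V \<and> a < b \<and> m = X a + X b"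
    and eq: "stanley_reisner_ideal V \<Delta> = (monomial_ideal V L :: 'k::field mpoly set)"
  shows "\<Delta> = {F. F \<subseteq> V \<and> (\<forall>a\<in>F. \<forall>b\<in>F. a < b \<longrightarrow> X a + X b \<notin> L)}"
proof -
  have mem: "F \<in> \<Delta> \<longleftrightarrow> (\<forall>a\<in>F. \<forall>b\<in>F. a < b \<longrightarrow> X a + X b \<notin> L)" if F: "F \<subseteq> V" for F
  proof -
    define p where "p = term_of (\<Sum>i\<in>F. X i) (1 :: 'k)"
    have fF: "finite F" using F V by (rule finite_subset)
    have kF: "keys (\<Sum>i\<in>F. X i) = F" by (rule keys_sum_X[OF fF])
    have pV: "p \<in> Pol V" unfolding p_def by (rule Pol_term) (simp only: kF F)
    have "p \<in> face_ideal V \<Delta> \<longleftrightarrow> F \<notin> \<Delta>"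
    proof -
      have "res G p = 0 \<longleftrightarrow> \<not> F \<subseteq> G" for G
      proof -
        have "res G p = (if F \<subseteq> G then p else 0)" unfolding p_def res_term kF by simp
        moreover have "p \<noteq> 0" unfolding p_def by (metis lookup_single_eq lookup_zero zero_neq_one)
        ultimately show ?thesis by simp
      qed
      then have "p \<in> face_ideal V \<Delta> \<longleftrightarrow> (\<forall>G\<in>\<Delta>. \<not> F \<subseteq> G)" using pV by (simp add: face_ideal_def)
      then show ?thesis using \<Delta> unfolding simplicial_complex_def by blast
    qed
    moreover have "p \<in> monomial_ideal V L \<longleftrightarrow> (\<exists>a\<in>F. \<exists>b\<in>F. a < b \<and> X a + X b \<in> L)"
    proof -
      have LV: "keys m \<subseteq> V" if m: "m \<in> L" for m
      proof -
        obtain a b where "a \<in> V" "b \<in> V" "m = X a + X b" using L[OF m] by blast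
        then show ?thesis by (auto simp: in_keys_iff lookup_XX split: if_splits simp del: One_nat_def)
      qed
      have le: "(\<forall>c. lookup (X a + X b) c \<le> lookup (\<Sum>i\<in>F. X i) c) \<longleftrightarrow> a \<in> F \<and> b \<in> F" if "a < b" for a b
      proof
        assume *: "\<forall>c. lookup (X a + X b) c \<le> lookup (\<Sum>i\<in>F. X i) c"
        show "a \<in> F \<and> b \<in> F"
          using *[rule_format, of a] *[rule_format, of b] unfolding lookup_XX lookup_sum_X[OF fF]
          by (auto split: if_splits)
      next
        assume "a \<in> F \<and> b \<in> F"
        then show "\<forall>c. lookup (X a + X b) c \<le> lookup (\<Sum>i\<in>F. X i) c"
          unfolding lookup_XX lookup_sum_X[OF fF] using that by auto
      qed
      have "keys p = {\<Sum>i\<in>F. X i}" unfolding p_def by simp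
      moreover have "(monomial_ideal V L :: 'k mpoly set)
          = {p \<in> Pol V. \<forall>m\<in>keys p. \<exists>s\<in>L. \<forall>c. lookup s c \<le> lookup m c}"
        by (rule monomial_ideal_eq) (rule LV)
      ultimately have "p \<in> monomial_ideal V L \<longleftrightarrow> (\<exists>m\<in>L. \<forall>c. lookup m c \<le> lookup (\<Sum>i\<in>F. X i) c)"
        using pV by (simp del: One_nat_def)
      also have "\<dots> \<longleftrightarrow> (\<exists>a b. a < b \<and> X a + X b \<in> L \<and> (\<forall>c. lookup (X a + X b) c \<le> lookup (\<Sum>i\<in>F. X i) c))"
        using L by metis
      also have "\<dots> \<longleftrightarrow> (\<exists>a\<in>F. \<exists>b\<in>F. a < b \<and> X a + X b \<in> L)" using le by blast
      finally show ?thesis .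
    qed
    ultimately show ?thesis using eq stanley_reisner_ideal_eq[OF V \<Delta>, where 'k = 'k] by auto
  qed
  have "F \<subseteq> V" if "F \<in> \<Delta>" for F using \<Delta> that by (auto simp: simplicial_complex_def)
  then have "F \<in> \<Delta> \<longleftrightarrow> F \<subseteq> V \<and> (\<forall>a\<in>F. \<forall>b\<in>F. a < b \<longrightarrow> X a + X b \<notin> L)" for F
    using mem[of F] by (cases "F \<subseteq> V") (simp, metis)
  then show ?thesis by (rule Set.set_eqI[OF trans[OF _ mem_Collect_eq[symmetric]]])
qed

definition independent_sets :: "nat set \<Rightarrow> (nat \<Rightarrow> nat \<Rightarrow> bool) \<Rightarrow> nat set set" where
  "independent_sets V C = {F. F \<subseteq> V \<and> (\<forall>a\<in>F. \<forall>b\<in>F. a < b \<longrightarrow> \<not> C a b)}"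

lemma double_star_complex:
  assumes V: "V = T \<union> {c, c'} \<union> (N \<union> N')" and ne: "N \<noteq> {}" "N' \<noteq> {}" and cc: "c < c'"
    and between: "\<And>v. v \<in> N \<union> N' \<Longrightarrow> c < v \<and> v < c'"
    and T: "\<And>t a. t \<in> T \<Longrightarrow> a \<in> V \<Longrightarrow> \<not> C t a \<and> \<not> C a t"
    and blue: "\<And>v w. v \<in> N \<union> N' \<Longrightarrow> w \<in> N \<union> N' \<Longrightarrow> v < w \<Longrightarrow> C v w" and red: "C c c'"
    and N: "\<And>v. v \<in> N \<union> N' \<Longrightarrow> C c v \<longleftrightarrow> v \<notin> N" "\<And>v. v \<in> N \<union> N' \<Longrightarrow> C v c' \<longleftrightarrow> v \<notin> N'"
  shows "independent_sets V C = {F. \<exists>e\<in>{c} \<times> N \<union> {c'} \<times> N'. F \<subseteq> insert (fst e) (insert (snd e) T)}"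
proof (rule equalityI; rule subsetI)
  fix F assume "F \<in> independent_sets V C"
  then have FV: "F \<subseteq> V" and ind: "\<And>a b. a \<in> F \<Longrightarrow> b \<in> F \<Longrightarrow> a < b \<Longrightarrow> \<not> C a b"
    by (auto simp: independent_sets_def)
  have uniq: "v = w" if "v \<in> F" "w \<in> F" "v \<in> N \<union> N'" "w \<in> N \<union> N'" for v w
    using blue[OF that(3,4)] blue[OF that(4,3)] ind[OF that(1,2)] ind[OF that(2,1)] by (metis linorder_neqE_nat)
  have inI: "F \<in> {F. \<exists>e\<in>{c} \<times> N \<union> {c'} \<times> N'. F \<subseteq> insert (fst e) (insert (snd e) T)}"
    if "d = c \<and> v \<in> N \<or> d = c' \<and> v \<in> N'" "F \<subseteq> insert d (insert v T)" for d v
    using that by (intro CollectI bexI[of _ "(d, v)"]) auto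
  show "F \<in> {F. \<exists>e\<in>{c} \<times> N \<union> {c'} \<times> N'. F \<subseteq> insert (fst e) (insert (snd e) T)}"
  proof (cases "\<exists>v\<in>F. v \<in> N \<union> N'")
    case True
    then obtain v where v: "v \<in> F" "v \<in> N \<union> N'" by blast
    have F: "F \<subseteq> insert c (insert c' (insert v T))" using FV V uniq[OF _ v(1) _ v(2)] by blast
    have "c \<in> F \<Longrightarrow> v \<in> N" using ind[of c v] N(1)[OF v(2)] between[OF v(2)] v(1) by blast
    moreover have "c' \<in> F \<Longrightarrow> v \<in> N'" using ind[of v c'] N(2)[OF v(2)] between[OF v(2)] v(1) by blast
    moreover have "\<not> (c \<in> F \<and> c' \<in> F)" using ind[of c c'] red cc by blast
    ultimately have "(v \<in> N \<and> F \<subseteq> insert c (insert v T)) \<or> (v \<in> N' \<and> F \<subseteq> insert c' (insert v T))"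
      using F v(2) by blast
    then show ?thesis using inI[of c v] inI[of c' v] by blast
  next
    case False
    have F: "F \<subseteq> insert c (insert c' T)" using FV V False by blast
    have "\<not> (c \<in> F \<and> c' \<in> F)" using ind[of c c'] red cc by blast
    then have "F \<subseteq> insert c T \<or> F \<subseteq> insert c' T" using F by blast
    moreover obtain v w where "v \<in> N" "w \<in> N'" using ne by blast
    ultimately show ?thesis using inI[of c v] inI[of c' w] by blast
  qed
next
  fix F assume "F \<in> {F. \<exists>e\<in>{c} \<times> N \<union> {c'} \<times> N'. F \<subseteq> insert (fst e) (insert (snd e) T)}"
  then obtain d v where dv: "F \<subseteq> insert d (insert v T)" "d = c \<and> v \<in> N \<or> d = c' \<and> v \<in> N'" by auto
  have sub: "insert d (insert v T) \<subseteq> V" using dv(2) V by auto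
  have "\<not> C a b" if "a \<in> F" "b \<in> F" "a < b" for a b
  proof (cases "a \<in> T \<or> b \<in> T")
    case True
    then show ?thesis using T sub dv(1) that by blast
  next
    case False
    then have "a \<in> {d, v}" "b \<in> {d, v}" using dv(1) that by auto
    then have "(a = d \<and> b = v) \<or> (a = v \<and> b = d)" using that(3) by auto
    then show ?thesis using dv(2) N[of v] between[of v] that(3) by auto
  qed
  then show "F \<in> independent_sets V C" using dv(1) sub by (auto simp: independent_sets_def)
qed

text \<open>Here \<open>C\<close> relates vertices that do not form a face. The complex is the join of the simplex \<open>T\<close> with
  a graph made of two stars, with centres \<open>c\<close> and \<open>c'\<close> and sets of leaves \<open>N\<close> and \<open>N'\<close>. It is bipartite:
  the centres are red, the leaves blue. The stars are connected with each other exactly if they share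
  a leaf.\<close>

locale double_star =
  fixes V T N N' :: "nat set" and c c' :: nat and C :: "nat \<Rightarrow> nat \<Rightarrow> bool"
  assumes finV: "finite V" and V: "V = T \<union> {c, c'} \<union> (N \<union> N')" and ne: "N \<noteq> {}" "N' \<noteq> {}"
    and cc: "c < c'" and between: "\<And>v. v \<in> N \<union> N' \<Longrightarrow> c < v \<and> v < c'"
    and Tc: "c \<notin> T" "c' \<notin> T" "\<And>v. v \<in> N \<union> N' \<Longrightarrow> v \<notin> T"
    and T: "\<And>t a. t \<in> T \<Longrightarrow> a \<in> V \<Longrightarrow> \<not> C t a \<and> \<not> C a t"
    and blue: "\<And>v w. v \<in> N \<union> N' \<Longrightarrow> w \<in> N \<union> N' \<Longrightarrow> v < w \<Longrightarrow> C v w" and red: "C c c'"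
    and N: "\<And>v. v \<in> N \<union> N' \<Longrightarrow> C c v \<longleftrightarrow> v \<notin> N" "\<And>v. v \<in> N \<union> N' \<Longrightarrow> C v c' \<longleftrightarrow> v \<notin> N'"
begin

lemma complex_eq:
  "independent_sets V C = {F. \<exists>e\<in>{c} \<times> N \<union> {c'} \<times> N'. F \<subseteq> insert (fst e) (insert (snd e) T)}"
  by (rule double_star_complex[OF V ne cc]) (fact between T blue red N)+

lemma connected_cohen_macaulay:
  assumes "N \<inter> N' \<noteq> {}"
  shows "cohen_macaulay_complex TYPE('k::field) V (independent_sets V C)"
proof -
  let ?E = "{c} \<times> N \<union> {c'} \<times> N'"
  let ?r = "{(e, e'). e \<in> ?E \<and> e' \<in> ?E \<and> (fst e = fst e' \<or> snd e = snd e')}"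
  obtain v where v: "v \<in> N" "v \<in> N'" using assms by blast
  interpret bipartite_join V T ?E
  proof unfold_locales
    show "finite V" by (rule finV)
    show "T \<subseteq> V" "?E \<subseteq> V \<times> V" using V by auto
    show "?E \<noteq> {}" using v by auto
    show "r \<notin> T \<and> b \<notin> T \<and> r \<noteq> b'" if "(r, b) \<in> ?E" "(r', b') \<in> ?E" for r b r' b'
      using that Tc between[of b'] by auto
    have to_v: "(e, (c, v)) \<in> ?r\<^sup>* \<and> ((c, v), e) \<in> ?r\<^sup>*" if "e \<in> ?E" for e
    proof (cases "fst e = c")
      case True
      then have "(e, (c, v)) \<in> ?r" "((c, v), e) \<in> ?r" using that v by auto
      then show ?thesis by blast
    next
      case False
      then have "(e, (c', v)) \<in> ?r" "((c', v), e) \<in> ?r" using that v by auto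
      moreover have "((c', v), (c, v)) \<in> ?r" "((c, v), (c', v)) \<in> ?r" using v by auto
      ultimately show ?thesis by (meson converse_rtrancl_into_rtrancl r_into_rtrancl)
    qed
    show "(e, e') \<in> ?r\<^sup>*" if "e \<in> ?E" "e' \<in> ?E" for e e'
      using to_v[OF that(1)] to_v[OF that(2)] by (meson rtrancl_trans)
  qed
  show ?thesis by (rule cohen_macaulay) (simp add: complex_eq facet_def)
qed

lemma star_bipartite_join:
  assumes "T = {}"
  shows "bipartite_join V {} ({c} \<times> N)" "bipartite_join V {} ({c'} \<times> N')"
proof -
  have star: "bipartite_join V {} ({d} \<times> M)"
    if dM: "d \<in> V" "M \<subseteq> V" "M \<noteq> {}" "d \<notin> M" for d M
  proof unfold_locales
    fix e e' assume "e \<in> {d} \<times> M" "e' \<in> {d} \<times> M"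
    then show "(e, e') \<in> {(e, e'). e \<in> {d} \<times> M \<and> e' \<in> {d} \<times> M \<and> (fst e = fst e' \<or> snd e = snd e')}\<^sup>*"
      by (intro r_into_rtrancl) auto
  qed (use dM finV in auto)
  show "bipartite_join V {} ({c} \<times> N)" "bipartite_join V {} ({c'} \<times> N')"
    by (rule star; use V ne between in auto)+
qed

lemma components_disjoint:
  assumes "N \<inter> N' = {}" "e \<in> {c} \<times> N" "e' \<in> {c'} \<times> N'"
  shows "{fst e, snd e} \<inter> {fst e', snd e'} = {}"
  using assms cc between[of "snd e"] between[of "snd e'"] by auto

lemma disconnected_buchsbaum:
  assumes "N \<inter> N' = {}" "T = {}"
  shows "buchsbaum_complex TYPE('k::field) V (independent_sets V C)"
  by (rule buchsbaum_two_graphs[OF star_bipartite_join[OF assms(2)] components_disjoint[OF assms(1)]])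
    (simp_all add: complex_eq assms(2))

lemma disconnected_cone_not_buchsbaum:
  assumes "N \<inter> N' = {}" "T \<noteq> {}"
  shows "\<not> buchsbaum_complex TYPE('k::field) V (independent_sets V C)"
proof (rule cone_over_disconnected_graph_not_buchsbaum[OF finV _ assms(2), of "{c} \<times> N" "{c'} \<times> N'"])
  show "T \<subseteq> V" "{c} \<times> N \<subseteq> V \<times> V" "{c'} \<times> N' \<subseteq> V \<times> V" using V by auto
  show "{c} \<times> N \<noteq> {}" "{c'} \<times> N' \<noteq> {}" using ne by auto
  show "fst e \<noteq> snd e \<and> fst e \<notin> T \<and> snd e \<notin> T" if "e \<in> {c} \<times> N \<union> {c'} \<times> N'" for e
    using that Tc between[of "snd e"] by auto
  show "{fst e, snd e} \<inter> {fst e', snd e'} = {}" if "e \<in> {c} \<times> N" "e' \<in> {c'} \<times> N'" for e e'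
    by (rule components_disjoint[OF assms(1) that])
qed (rule complex_eq)

text \<open>Starting from \<open>c\<close>, edges lead only to vertices of the star of \<open>c\<close>.\<close>

lemma disconnected:
  assumes "N \<inter> N' = {}" "T = {}"
  shows "\<not> connected_complex (independent_sets V C)"
proof
  let ?\<Delta> = "independent_sets V C"
  assume conn: "connected_complex ?\<Delta>"
  obtain v v' where v: "v \<in> N" "v' \<in> N'" using ne by blast
  have mem: "F \<in> ?\<Delta> \<longleftrightarrow> (\<exists>e\<in>{c} \<times> N \<union> {c'} \<times> N'. F \<subseteq> {fst e, snd e})" for F
    unfolding complex_eq assms(2) by simp
  have "{c} \<in> ?\<Delta>" unfolding mem using v by (intro bexI[of _ "(c, v)"]) auto
  moreover have "{c'} \<in> ?\<Delta>" unfolding mem using v by (intro bexI[of _ "(c', v')"]) auto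
  ultimately have "(c, c') \<in> {(a, b). {a, b} \<in> ?\<Delta>}\<^sup>*"
    using conn by (auto simp: connected_complex_def vertices_def)
  then have "c' \<in> insert c N"
  proof (induction rule: rtrancl_induct)
    case (step a b)
    have "{a, b} \<in> ?\<Delta>" using step(2) by simp
    then obtain e where e: "e \<in> {c} \<times> N \<union> {c'} \<times> N'" "a \<in> {fst e, snd e}" "b \<in> {fst e, snd e}"
      unfolding mem by blast
    have "e \<in> {c} \<times> N"
    proof (rule ccontr)
      assume "e \<notin> {c} \<times> N"
      then have "e \<in> {c'} \<times> N'" using e(1) by blast
      moreover have "\<exists>w\<in>N. a \<in> {c, w}" using step(3) v by auto
      then obtain w where "w \<in> N" "a \<in> {c, w}" by blast
      ultimately show False using components_disjoint[OF assms(1), of "(c, w)" e] e(2) by auto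
    qed
    then show ?case using e(3) by auto
  qed simp
  then show False using cc between[of c'] by auto
qed

end

section \<open>Pure lexsegment complexes\<close>

text \<open>The end points of the segment are \<open>u = x\<^sub>i x\<^sub>j\<close> and \<open>v = x\<^sub>r x\<^sub>s\<close>; the assumption \<open>lex\<close> says that
  \<open>u > v\<close>, and \<open>C a b\<close> below that \<open>x\<^sub>a x\<^sub>b\<close> lies between them.\<close>

locale lexsegment_graph =
  fixes n i j r s :: nat
  assumes i: "1 \<le> i" and ij: "i < j" and jn: "j \<le> n" and rs: "r < s" and sn: "s \<le> n"
    and lex: "i < r \<or> (i = r \<and> j < s)"
begin

definition C :: "nat \<Rightarrow> nat \<Rightarrow> bool" where
  "C a b \<longleftrightarrow> a < b \<and> (i < a \<or> (i = a \<and> j \<le> b)) \<and> (a < r \<or> (a = r \<and> b \<le> s))"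

abbreviation "\<Gamma> \<equiv> independent_sets {i..n} C"
abbreviation "\<Delta> \<equiv> independent_sets {1..n} C"

lemma facetI:
  assumes F: "F \<subseteq> {i..n}" "\<And>a b. a \<in> F \<Longrightarrow> b \<in> F \<Longrightarrow> a < b \<Longrightarrow> \<not> C a b"
    and max: "\<And>x. i \<le> x \<Longrightarrow> x \<le> n \<Longrightarrow> x \<notin> F \<Longrightarrow> \<exists>a\<in>F. (a < x \<and> C a x) \<or> (x < a \<and> C x a)"
  shows "F \<in> facets \<Gamma>"
proof -
  have "G = F" if G: "G \<in> \<Gamma>" "F \<subseteq> G" for G
  proof (rule ccontr)
    assume "G \<noteq> F"
    then obtain x where x: "x \<in> G" "x \<notin> F" using G(2) by blast
    then have "i \<le> x" "x \<le> n" using G(1) by (auto simp: independent_sets_def)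
    then obtain a where "a \<in> F" "(a < x \<and> C a x) \<or> (x < a \<and> C x a)" using max x(2) by blast
    then show False using G x(1) by (auto simp: independent_sets_def)
  qed
  then show ?thesis using F by (auto simp: facets_def independent_sets_def)
qed

text \<open>Purity is tested on few facets. If \<open>r = i\<close>, all generators contain \<open>x\<^sub>i\<close>, and the facets
  \<open>{i+1..n}\<close> and \<open>{i..j-1} \<union> {s+1..n}\<close> differ in size. Otherwise \<open>{r+1..n}\<close> is a facet, so that all
  facets have \<open>n - r\<close> elements. Further facets, whose shape depends on the position of \<open>j\<close> relative
  to \<open>i + 1\<close> and \<open>r\<close>, are a single vertex, the pair \<open>{i, i+1}\<close>, the set \<open>{i} \<union> {r+1..j-1}\<close> or,
  for \<open>r = i + 1\<close>, the set \<open>{i, r} \<union> {s+1..n-1}\<close>; their sizes leave only the listed cases.\<close>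

lemma pure_shapes:
  assumes pure: "pure_complex \<Gamma>"
  shows "i < r"
    and "(j = i + 1 \<and> r + 1 = n \<and> s = n) \<or>
      (i + 1 < j \<and> j = r \<and> r + 2 = n \<and> s + 1 = n) \<or>
      (i + 1 < j \<and> j + 1 = n \<and> r + 2 = n \<and> s = n) \<or>
      (i + 1 < j \<and> j + 1 = n \<and> r + 2 = n \<and> s + 1 = n) \<or>
      (i + 1 < j \<and> j = n \<and> r + 2 = n) \<or>
      (i + 2 < n \<and> j = n \<and> r = i + 1 \<and> s = i + 2)"
proof -
  have eq: "card F = card G" if "F \<in> facets \<Gamma>" "G \<in> facets \<Gamma>" for F G
    using pure that unfolding pure_complex_def by blast
  show ir: "i < r"
  proof (rule ccontr)
    assume "\<not> i < r"
    then have r: "r = i" "j < s" using lex by auto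
    have "{i+1..n} \<in> facets \<Gamma>"
    proof (rule facetI)
      fix x assume "i \<le> x" "x \<le> n" "x \<notin> {i+1..n}"
      then have "x = i" by simp
      then show "\<exists>a\<in>{i+1..n}. (a < x \<and> C a x) \<or> (x < a \<and> C x a)"
        unfolding C_def using ij jn r by (intro bexI[of _ j]) auto
    qed (use r in \<open>unfold C_def, auto\<close>)
    moreover have "{i..j-1} \<union> {s+1..n} \<in> facets \<Gamma>"
    proof (rule facetI)
      fix x assume "i \<le> x" "x \<le> n" "x \<notin> {i..j-1} \<union> {s+1..n}"
      then have "j \<le> x" "x \<le> s" by auto
      then show "\<exists>a\<in>{i..j-1} \<union> {s+1..n}. (a < x \<and> C a x) \<or> (x < a \<and> C x a)"
        unfolding C_def using ij r by (intro bexI[of _ i]) auto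
    qed (use r ij jn sn in \<open>unfold C_def, auto\<close>)
    ultimately have "card {i+1..n} = card ({i..j-1} \<union> {s+1..n})" by (rule eq)
    also have "\<dots> = card {i..j-1} + card {s+1..n}" using r by (intro card_Un_disjoint) auto
    finally show False using ij jn r sn by simp
  qed
  have C1: "{r+1..n} \<in> facets \<Gamma>"
  proof (rule facetI)
    fix x assume x: "i \<le> x" "x \<le> n" "x \<notin> {r+1..n}"
    show "\<exists>a\<in>{r+1..n}. (a < x \<and> C a x) \<or> (x < a \<and> C x a)"
    proof (cases "x = r")
      case True
      then show ?thesis using ir rs sn unfolding C_def by (intro bexI[of _ s]) auto
    next
      case False
      then show ?thesis using x ir rs sn jn unfolding C_def by (intro bexI[of _ n]) auto
    qed
  qed (use ir in \<open>unfold C_def, auto\<close>)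
  have size: "card F = n - r" if "F \<in> facets \<Gamma>" for F using eq[OF that C1] by simp
  have C3: "n - r = 2" if "i + 1 < j" "i + 1 < r \<or> j = i + 2"
  proof -
    have "{i, i+1} \<in> facets \<Gamma>"
    proof (rule facetI)
      fix x assume x: "i \<le> x" "x \<le> n" "x \<notin> {i, i+1}"
      show "\<exists>a\<in>{i, i+1}. (a < x \<and> C a x) \<or> (x < a \<and> C x a)"
      proof (cases "i + 1 < r")
        case True
        then show ?thesis using x unfolding C_def by (intro bexI[of _ "i+1"]) auto
      next
        case False
        then show ?thesis using x that ir unfolding C_def by (intro bexI[of _ i]) auto
      qed
    qed (use that ij jn in \<open>unfold C_def, auto\<close>)
    then show ?thesis using size by fastforce
  qed
  show "(j = i + 1 \<and> r + 1 = n \<and> s = n) \<or>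
      (i + 1 < j \<and> j = r \<and> r + 2 = n \<and> s + 1 = n) \<or>
      (i + 1 < j \<and> j + 1 = n \<and> r + 2 = n \<and> s = n) \<or>
      (i + 1 < j \<and> j + 1 = n \<and> r + 2 = n \<and> s + 1 = n) \<or>
      (i + 1 < j \<and> j = n \<and> r + 2 = n) \<or>
      (i + 2 < n \<and> j = n \<and> r = i + 1 \<and> s = i + 2)"
  proof (cases "j = i + 1")
    case True
    have "{i} \<in> facets \<Gamma>" using True ir jn by (intro facetI) (unfold C_def, auto)
    then have "n - r = 1" using size by fastforce
    then show ?thesis using True rs sn by auto
  next
    case False
    then have j: "i + 1 < j" using ij by simp
    show ?thesis
    proof (cases "j \<le> r + 1")
      case True
      then have "i + 1 < r \<or> j = i + 2" using j by linarith
      then have "n - r = 2" by (rule C3[OF j])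
      then have nr: "r + 2 = n" using rs sn by simp
      have nj: "\<not> j < r"
      proof
        assume jr: "j < r"
        have "{j} \<in> facets \<Gamma>" using jr ij jn ir by (intro facetI) (unfold C_def, auto)
        then have "n - r = 1" using size by fastforce
        then show False using nr by simp
      qed
      have njs: "\<not> (j = r \<and> s = n)"
      proof
        assume js: "j = r \<and> s = n"
        have "{r} \<in> facets \<Gamma>" using js ij jn ir by (intro facetI) (unfold C_def, auto)
        then have "n - r = 1" using size by fastforce
        then show False using nr by simp
      qed
      have "j = r \<or> j = r + 1" "s = r + 1 \<or> s = n" using True nj rs sn nr by linarith+
      then show ?thesis using j nr njs by auto
    next
      case False
      then have rj: "r + 1 < j" by simp
      have "{i} \<union> {r+1..j-1} \<in> facets \<Gamma>"
      proof (rule facetI)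
        fix x assume x: "i \<le> x" "x \<le> n" "x \<notin> {i} \<union> {r+1..j-1}"
        show "\<exists>a\<in>{i} \<union> {r+1..j-1}. (a < x \<and> C a x) \<or> (x < a \<and> C x a)"
        proof (cases "x \<le> r")
          case True
          then show ?thesis using x rj rs unfolding C_def by (intro bexI[of _ "r+1"]) auto
        next
          case False
          then show ?thesis using x rj ir unfolding C_def by (intro bexI[of _ i]) auto
        qed
      qed (use rj ir jn in \<open>unfold C_def, auto\<close>)
      then have "card ({i} \<union> {r+1..j-1}) = n - r" by (rule size)
      moreover have "card ({i} \<union> {r+1..j-1}) = card {i} + card {r+1..j-1}"
        using ir by (intro card_Un_disjoint) auto
      ultimately have jn': "j = n" using rj jn by simp
      show ?thesis
      proof (cases "i + 1 < r")
        case True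
        then have "n - r = 2" using C3[OF j] by simp
        then show ?thesis using j jn' rs sn by auto
      next
        case False
        then have r: "r = i + 1" using ir by simp
        have "{i, r} \<union> {s+1..n-1} \<in> facets \<Gamma>"
        proof (rule facetI)
          fix x assume x: "i \<le> x" "x \<le> n" "x \<notin> {i, r} \<union> {s+1..n-1}"
          show "\<exists>a\<in>{i, r} \<union> {s+1..n-1}. (a < x \<and> C a x) \<or> (x < a \<and> C x a)"
          proof (cases "x \<le> s")
            case True
            then show ?thesis using x r unfolding C_def by (intro bexI[of _ r]) auto
          next
            case False
            then show ?thesis using x r jn' unfolding C_def by (intro bexI[of _ i]) auto
          qed
        qed (use r rj jn' rs sn in \<open>unfold C_def, auto\<close>)
        then have "card ({i, r} \<union> {s+1..n-1}) = n - r" by (rule size)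
        moreover have "card ({i, r} \<union> {s+1..n-1}) = card {i, r} + card {s+1..n-1}"
          using r rs by (intro card_Un_disjoint) auto
        ultimately have "2 + (n - 1 - s) = n - r" using r by simp
        then show ?thesis using j jn' r rs sn rj by auto
      qed
    qed
  qed
qed

lemma join_eq: "\<Delta> = complex_join (Pow {1..<i}) \<Gamma>"
proof (rule equalityI; rule subsetI)
  fix F assume F: "F \<in> \<Delta>"
  then have "F \<inter> {i..n} \<in> \<Gamma>" by (auto simp: independent_sets_def)
  moreover have "F = (F \<inter> {1..<i}) \<union> (F \<inter> {i..n})" using F i ij jn by (auto simp: independent_sets_def)
  ultimately show "F \<in> complex_join (Pow {1..<i}) \<Gamma>" unfolding complex_join_def by blast
next
  fix F assume "F \<in> complex_join (Pow {1..<i}) \<Gamma>"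
  then obtain G H where GH: "F = G \<union> H" "G \<subseteq> {1..<i}" "H \<in> \<Gamma>" by (auto simp: complex_join_def)
  have "\<not> C a b" if "a \<in> F" "b \<in> F" "a < b" for a b
  proof (cases "a < i")
    case True
    then show ?thesis by (simp add: C_def)
  next
    case False
    then have "a \<in> H" "b \<in> H" using that GH(1,2) by auto
    then show ?thesis using GH(3) that(3) by (auto simp: independent_sets_def)
  qed
  moreover have "F \<subseteq> {1..n}" using GH i ij jn by (fastforce simp: independent_sets_def)
  ultimately show "F \<in> \<Delta>" by (simp add: independent_sets_def)
qed

text \<open>Facets of the join are facets of \<open>\<Gamma>\<close> enlarged by the same \<open>i - 1\<close> cone points.\<close>

lemma pure_cone:
  assumes "pure_complex \<Delta>" shows "pure_complex \<Gamma>"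
proof -
  have facet: "{1..<i} \<union> F \<in> facets \<Delta>" if F: "F \<in> facets \<Gamma>" for F
  proof -
    have F\<Gamma>: "F \<in> \<Gamma>" and max: "\<And>G. G \<in> \<Gamma> \<Longrightarrow> F \<subseteq> G \<Longrightarrow> G = F" using F by (auto simp: facets_def)
    have in\<Delta>: "{1..<i} \<union> F \<in> \<Delta>" unfolding join_eq complex_join_def using F\<Gamma> by blast
    have mx: "G = {1..<i} \<union> F" if G: "G \<in> \<Delta>" "{1..<i} \<union> F \<subseteq> G" for G
    proof -
      have "G \<inter> {i..n} \<in> \<Gamma>" using G by (auto simp: independent_sets_def)
      moreover have "F \<subseteq> G \<inter> {i..n}" using G F\<Gamma> by (auto simp: independent_sets_def)
      ultimately have "G \<inter> {i..n} = F" by (rule max)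
      moreover have "G \<subseteq> {1..<i} \<union> {i..n}" using G by (auto simp: independent_sets_def)
      ultimately show ?thesis using G(2) by blast
    qed
    show ?thesis unfolding facets_def by (intro CollectI conjI ballI impI in\<Delta> mx)
  qed
  have size: "card ({1..<i} \<union> F) = (i - 1) + card F" if "F \<in> facets \<Gamma>" for F
  proof -
    have "F \<subseteq> {i..n}" using that by (auto simp: facets_def independent_sets_def)
    then show ?thesis by (subst card_Un_disjoint) (auto intro: finite_subset)
  qed
  show ?thesis
    unfolding pure_complex_def
  proof (intro ballI)
    fix F G assume FG: "F \<in> facets \<Gamma>" "G \<in> facets \<Gamma>"
    have "card ({1..<i} \<union> F) = card ({1..<i} \<union> G)"
      using assms facet[OF FG(1)] facet[OF FG(2)] unfolding pure_complex_def by blast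
    then show "card F = card G" using size[OF FG(1)] size[OF FG(2)] by simp
  qed
qed

lemma simplicial: "simplicial_complex {1..n} \<Delta>"
  by (auto simp: simplicial_complex_def independent_sets_def)

text \<open>In all shapes with edges the centres are \<open>i\<close> and \<open>n\<close>. Besides the vertices before \<open>i\<close> some
  vertices \<open>T'\<close> between the centres may be compatible with everything; any two of the remaining ones
  form a generator.\<close>

lemma double_starI:
  assumes "i < r" and n: "i < n" and T': "T' \<subseteq> {i<..<n}"
    and T'C: "\<And>t. t \<in> T' \<Longrightarrow> \<not> C i t \<and> (\<forall>v\<in>{i<..n}. \<not> C t v \<and> \<not> C v t)"
    and N: "N = {v \<in> {i<..<n} - T'. \<not> C i v}" "N' = {v \<in> {i<..<n} - T'. \<not> C v n}"
    and cover: "N \<union> N' = {i<..<n} - T'" and ne: "N \<noteq> {}" "N' \<noteq> {}"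
    and blue: "\<And>v w. v \<in> {i<..<n} - T' \<Longrightarrow> w \<in> {i<..<n} - T' \<Longrightarrow> v < w \<Longrightarrow> C v w"
  shows "double_star {1..n} ({1..<i} \<union> T') N N' i n C"
proof unfold_locales
  show "{1..n} = {1..<i} \<union> T' \<union> {i, n} \<union> (N \<union> N')" using cover T' i n by auto
  show "i < v \<and> v < n" if "v \<in> N \<union> N'" for v using that cover by auto
  show "\<not> C t a \<and> \<not> C a t" if t: "t \<in> {1..<i} \<union> T'" and a: "a \<in> {1..n}" for t a
  proof (cases "t \<in> T'")
    case True
    then have ti: "i < t" "t < n" using T' by auto
    show ?thesis
    proof (cases "a \<le> i")
      case True
      then show ?thesis using T'C[OF \<open>t \<in> T'\<close>] ti by (cases "a = i") (auto simp: C_def)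
    next
      case False
      then show ?thesis using T'C[OF \<open>t \<in> T'\<close>] a by auto
    qed
  next
    case False
    then have "t < i" using t by auto
    then show ?thesis using \<open>i < r\<close> ij by (auto simp: C_def)
  qed
  show "C v w" if "v \<in> N \<union> N'" "w \<in> N \<union> N'" "v < w" for v w using that blue cover by blast
  show "C i n" using \<open>i < r\<close> ij jn by (simp add: C_def)
  show "C i v \<longleftrightarrow> v \<notin> N" if "v \<in> N \<union> N'" for v using that cover N by blast
  show "C v n \<longleftrightarrow> v \<notin> N'" if "v \<in> N \<union> N'" for v using that cover N by blast
  show "v \<notin> {1..<i} \<union> T'" if "v \<in> N \<union> N'" for v using that cover by auto
  show "finite {1..n}" by simp
  show "N \<noteq> {}" "N' \<noteq> {}" "i < n" by fact+
  show "i \<notin> {1..<i} \<union> T'" "n \<notin> {1..<i} \<union> T'" using T' n by auto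
qed

lemma disconnected_shape:
  assumes "i + 1 < j" "(j = r \<and> r + 2 = n \<and> s + 1 = n) \<or> (j + 1 = n \<and> r + 2 = n \<and> s = n)"
  shows "double_star {1..n} {1..<i} {i<..<j} {j..<n} i n C"
proof -
  have "double_star {1..n} ({1..<i} \<union> {}) {i<..<j} {j..<n} i n C"
    using assms by (intro double_starI) (unfold C_def, auto)
  then show ?thesis by simp
qed

text \<open>The two stars share the leaf \<open>w\<close>. In the shape with \<open>r = i + 1\<close> and \<open>s = i + 2\<close> the vertices
  after \<open>i + 2\<close> and before \<open>n\<close> occur in no generator and are cone points.\<close>

lemma connected_shape:
  assumes "i < r"
    and "(i + 1 < j \<and> j + 1 = n \<and> r + 2 = n \<and> s + 1 = n) \<or> (i + 1 < j \<and> j = n \<and> r + 2 = n) \<or>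
      (i + 2 < n \<and> j = n \<and> r = i + 1 \<and> s = i + 2)"
  shows "cohen_macaulay_complex TYPE('k::field) {1..n} \<Delta>"
proof -
  define T' where "T' = (if j = n \<and> r = i + 1 \<and> s = i + 2 then {i+3..<n} else {})"
  define N where "N = {v \<in> {i<..<n} - T'. \<not> C i v}"
  define N' where "N' = {v \<in> {i<..<n} - T'. \<not> C v n}"
  define w where "w = (if j = n \<and> r = i + 1 \<and> s = i + 2 then i + 1 else if j = n then n - 1 else n - 2)"
  have w: "w \<in> N" "w \<in> N'" using assms rs sn unfolding w_def N_def N'_def T'_def C_def by (auto split: if_splits)
  have "double_star {1..n} ({1..<i} \<union> T') N N' i n C"
  proof (rule double_starI[OF assms(1) _ _ _ N_def N'_def])
    show "N \<union> N' = {i<..<n} - T'"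
      using assms rs sn unfolding N_def N'_def T'_def C_def by (auto split: if_splits)
    show "C v w" if "v \<in> {i<..<n} - T'" "w \<in> {i<..<n} - T'" "v < w" for v w
      using that assms rs sn unfolding T'_def C_def by (auto split: if_splits)
    show "\<not> C i t \<and> (\<forall>v\<in>{i<..n}. \<not> C t v \<and> \<not> C v t)" if "t \<in> T'" for t
      using that assms unfolding T'_def C_def by (auto split: if_splits)
    show "i < n" "T' \<subseteq> {i<..<n}" using ij jn by (auto simp: T'_def)
    show "N \<noteq> {}" "N' \<noteq> {}" using w by auto
  qed
  then interpret double_star "{1..n}" "{1..<i} \<union> T'" N N' i n C .
  show ?thesis by (rule connected_cohen_macaulay) (use w in blast)
qed

text \<open>Any two vertices from \<open>i\<close> on form a generator. Without cone points the complex is a set of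
  points; otherwise the cone point \<open>i - 1\<close> serves as centre of a single star, which is a connected
  bipartite graph.\<close>

lemma points_shape:
  assumes "i < r" "j = i + 1" "r + 1 = n" "s = n"
  shows "cohen_macaulay_complex TYPE('k::field) {1..n} \<Delta>"
proof -
  have C: "C a b \<longleftrightarrow> i \<le> a" if "a < b" "b \<le> n" for a b using that assms unfolding C_def by auto
  have uniq: "a = b" if F: "F \<in> \<Delta>" and ab: "a \<in> F" "b \<in> F" "i \<le> a" "i \<le> b" for F a b
  proof -
    have n: "a \<le> n" "b \<le> n" using F ab by (auto simp: independent_sets_def)
    have "\<not> a < b" using F ab C[of a b] n unfolding independent_sets_def by blast
    moreover have "\<not> b < a" using F ab C[of b a] n unfolding independent_sets_def by blast
    ultimately show ?thesis by simp
  qed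
  show ?thesis
  proof (cases "i = 1")
    case True
    show ?thesis
    proof (rule cohen_macaulay_points)
      show "\<Delta> = insert {} ((\<lambda>v. {v}) ` {1..n})"
      proof (rule equalityI; rule subsetI)
        fix F assume F: "F \<in> \<Delta>"
        have "a = b" if "a \<in> F" "b \<in> F" for a b
        proof -
          have "a \<in> {1..n}" "b \<in> {1..n}" using F that unfolding independent_sets_def by blast+
          then show ?thesis using uniq[OF F that] True by simp
        qed
        then show "F \<in> insert {} ((\<lambda>v. {v}) ` {1..n})"
          using F unfolding independent_sets_def by blast
      qed (auto simp: independent_sets_def)
    qed (use jn ij in auto)
  next
    case False
    then have i1: "1 < i" using i by simp
    let ?E = "{i - 1} \<times> {i..n}"
    interpret bipartite_join "{1..n}" "{1..<i-1}" ?E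
    proof unfold_locales
      fix e e' assume "e \<in> ?E" "e' \<in> ?E"
      then show "(e, e') \<in> {(e, e'). e \<in> ?E \<and> e' \<in> ?E \<and> (fst e = fst e' \<or> snd e = snd e')}\<^sup>*"
        by (intro r_into_rtrancl) auto
    qed (use i1 ij jn in auto)
    show ?thesis
    proof (rule cohen_macaulay, rule equalityI; rule subsetI)
      fix F assume F: "F \<in> \<Delta>"
      have FV: "F \<subseteq> {1..n}" using F by (simp add: independent_sets_def)
      have "\<exists>v\<in>{i..n}. F \<subseteq> insert v {1..<i}"
      proof (cases "\<exists>v\<in>F. i \<le> v")
        case True
        then obtain v where v: "v \<in> F" "i \<le> v" by blast
        have "F \<subseteq> insert v {1..<i}"
        proof
          fix x assume x: "x \<in> F"
          then show "x \<in> insert v {1..<i}" using uniq[OF F x v(1) _ v(2)] FV by (cases "i \<le> x") auto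
        qed
        then show ?thesis using v FV by (intro bexI[of _ v]) auto
      next
        case False
        then have "F \<subseteq> insert n {1..<i}" using FV by (auto simp: not_le)
        then show ?thesis using ij jn by (intro bexI[of _ n]) auto
      qed
      then obtain v where v: "v \<in> {i..n}" "F \<subseteq> insert v {1..<i}" by blast
      have "insert v {1..<i} = facet (i - 1, v)" unfolding facet_def using i1 by auto
      then have "F \<subseteq> facet (i - 1, v)" "(i - 1, v) \<in> ?E" using v by auto
      then show "F \<in> {F. \<exists>e\<in>?E. F \<subseteq> facet e}" by blast
    next
      fix F assume "F \<in> {F. \<exists>e\<in>?E. F \<subseteq> facet e}"
      then obtain v where v: "v \<in> {i..n}" "F \<subseteq> facet (i - 1, v)" by auto
      have fc: "facet (i - 1, v) = insert v {1..<i}" unfolding facet_def using i1 by auto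
      have "\<not> C a b" if ab: "a \<in> F" "b \<in> F" "a < b" for a b
      proof -
        have "a \<in> insert v {1..<i}" "b \<in> insert v {1..<i}" using ab v fc by auto
        then have "a < i" using ab(3) v(1) by auto
        then show ?thesis by (auto simp: C_def)
      qed
      moreover have "F \<subseteq> {1..n}" using v fc i ij jn by fastforce
      ultimately show "F \<in> \<Delta>" by (simp add: independent_sets_def)
    qed
  qed
qed

end

theorem theorem3p8:
  fixes n i j :: nat
    and u v :: monomial
    and \<Delta> \<Delta>\<^sub>1 \<Delta>\<^sub>2 :: "nat set set"
  assumes "u \<in> sqfree_monomials {1..n} 2" and "v \<in> sqfree_monomials {1..n} 2" and "u > v"
    and "u = X i + X j" and "i < j"
    and "simplicial_complex {1..n} \<Delta>"
    and "stanley_reisner_ideal {1..n} \<Delta> =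
           (monomial_ideal {1..n} (lexsegment n u v) :: (monomial \<Rightarrow>\<^sub>0 'k::field) set)"
    and "\<Delta>\<^sub>1 = Pow {1..<i}"
    and "simplicial_complex {i..n} \<Delta>\<^sub>2"
    and "stanley_reisner_ideal {i..n} \<Delta>\<^sub>2 =
           (monomial_ideal {i..n} (lexsegment n u v) :: (monomial \<Rightarrow>\<^sub>0 'k) set)"
    and "\<not> cohen_macaulay_complex TYPE('k) {1..n} \<Delta>"
  defines "cond1 \<equiv> buchsbaum_complex TYPE('k) {1..n} \<Delta>"
    and "cond2 \<equiv>
           (u = X 1 + X (n - 2) \<and> v = X (n - 2) + X (n - 1) \<and> n > 4) \<or>
           (u = X 1 + X (n - 1) \<and> v = X (n - 2) + X n \<and> n > 3)"
    and "cond3 \<equiv> vertices \<Delta>\<^sub>1 = {} \<and> pure_complex \<Delta>\<^sub>2"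
  shows "\<Delta> = complex_join \<Delta>\<^sub>1 \<Delta>\<^sub>2 \<and>
         (cond1 \<longleftrightarrow> cond2) \<and> (cond2 \<longleftrightarrow> cond3) \<and>
         (cond1 \<or> cond2 \<or> cond3 \<longrightarrow> \<not> connected_complex \<Delta>)"
proof -
  have u2: "X i + X j \<in> sqfree_monomials {1..n} 2" using assms(1,4) by simp
  then obtain i' j' where "i' \<in> {1..n}" "j' \<in> {1..n}" "i' < j'" "X i + X j = X i' + X j'"
    unfolding sqfree_monomials_2 by blast
  then have ij: "1 \<le> i" "j \<le> n" using X_add_eq[OF assms(5), of i' j'] by auto
  obtain r s where rs: "r \<in> {1..n}" "s \<in> {1..n}" "r < s" and v: "v = X r + X s"
    using assms(2) unfolding sqfree_monomials_2 by blast
  have vu: "X r + X s < X i + X j" using assms(3) unfolding assms(4) v .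
  then have "i < r \<or> (i = r \<and> j \<le> s)" using X_add_le[OF rs(3) assms(5)] by (simp only: less_imp_le)
  moreover have "\<not> (i = r \<and> j = s)" using vu by auto
  ultimately have lex: "i < r \<or> (i = r \<and> j < s)" by auto
  interpret G: lexsegment_graph n i j r s
    using ij assms(5) rs lex by unfold_locales auto
  have L: "X a + X b \<in> lexsegment n u v \<longleftrightarrow> G.C a b" if ab: "a < b" "a \<in> {1..n}" "b \<in> {1..n}" for a b
  proof -
    have "X a + X b \<in> sqfree_monomials {1..n} 2" unfolding sqfree_monomials_2 using ab by blast
    then show ?thesis
      unfolding lexsegment_def v assms(4) mem_Collect_eq X_add_le[OF rs(3) ab(1)]
        X_add_le[OF ab(1) assms(5)] G.C_def using ab(1) by auto
  qed
  have Lm: "\<exists>a b. a \<in> {i..n} \<and> b \<in> {i..n} \<and> a < b \<and> m = X a + X b" if m: "m \<in> lexsegment n u v" for m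
  proof -
    have "m \<in> sqfree_monomials {1..n} 2" using m by (simp add: lexsegment_def)
    then obtain a b where ab: "a \<in> {1..n}" "b \<in> {1..n}" "a < b" "m = X a + X b"
      unfolding sqfree_monomials_2 by blast
    then have "G.C a b" using L[of a b] m by simp
    then have "i \<le> a" by (auto simp: G.C_def)
    then show ?thesis using ab by (intro exI[of _ a] exI[of _ b]) auto
  qed
  have Lm1: "\<exists>a b. a \<in> {1..n} \<and> b \<in> {1..n} \<and> a < b \<and> m = X a + X b" if m: "m \<in> lexsegment n u v" for m
  proof -
    obtain a b where "a \<in> {i..n}" "b \<in> {i..n}" "a < b" "m = X a + X b" using Lm[OF m] by blast
    then show ?thesis using ij by (intro exI[of _ a] exI[of _ b]) auto
  qed
  have "\<Delta> = {F. F \<subseteq> {1..n} \<and> (\<forall>a\<in>F. \<forall>b\<in>F. a < b \<longrightarrow> X a + X b \<notin> lexsegment n u v)}"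
    by (rule complex_of_quadratic_ideal[OF finite_atLeastAtMost assms(6) _ assms(7)]) (rule Lm1)
  also have "\<dots> = independent_sets {1..n} G.C"
    unfolding independent_sets_def using L by (intro Collect_cong) (metis subsetD)
  finally have \<Delta>: "\<Delta> = independent_sets {1..n} G.C" .
  have "\<Delta>\<^sub>2 = {F. F \<subseteq> {i..n} \<and> (\<forall>a\<in>F. \<forall>b\<in>F. a < b \<longrightarrow> X a + X b \<notin> lexsegment n u v)}"
    by (rule complex_of_quadratic_ideal[OF finite_atLeastAtMost assms(9) _ assms(10)]) (rule Lm)
  also have "\<dots> = independent_sets {i..n} G.C"
  proof -
    have "{i..n} \<subseteq> {1..n}" using ij by auto
    then show ?thesis unfolding independent_sets_def using L by (intro Collect_cong) (metis subsetD)
  qed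
  finally have \<Delta>2: "\<Delta>\<^sub>2 = independent_sets {i..n} G.C" .
  \<comment> \<open>the two shapes in which the stars are disjoint; for \<open>i = 1\<close> they are the two cases of the claim\<close>
  define shape where "shape \<longleftrightarrow> i + 1 < j \<and>
    ((j = r \<and> r + 2 = n \<and> s + 1 = n) \<or> (j + 1 = n \<and> r + 2 = n \<and> s = n))"
  have star: "double_star {1..n} {1..<i} {i<..<j} {j..<n} i n G.C" if shape
    using that unfolding shape_def by (intro G.disconnected_shape) auto
  have disj: "{i<..<j} \<inter> {j..<n} = {}" by auto
  have pure: shape if p: "pure_complex \<Delta>\<^sub>2"
  proof -
    have ir: "i < r" and sh: "(j = i + 1 \<and> r + 1 = n \<and> s = n) \<or>
      (i + 1 < j \<and> j = r \<and> r + 2 = n \<and> s + 1 = n) \<or>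
      (i + 1 < j \<and> j + 1 = n \<and> r + 2 = n \<and> s = n) \<or>
      (i + 1 < j \<and> j + 1 = n \<and> r + 2 = n \<and> s + 1 = n) \<or>
      (i + 1 < j \<and> j = n \<and> r + 2 = n) \<or>
      (i + 2 < n \<and> j = n \<and> r = i + 1 \<and> s = i + 2)"
      using G.pure_shapes p unfolding \<Delta>2 by blast+
    have ncm: "\<not> cohen_macaulay_complex TYPE('k) {1..n} (independent_sets {1..n} G.C)"
      using assms(11) unfolding \<Delta> .
    have "\<not> (j = i + 1 \<and> r + 1 = n \<and> s = n)" using G.points_shape[OF ir] ncm by blast
    moreover have "\<not> ((i + 1 < j \<and> j + 1 = n \<and> r + 2 = n \<and> s + 1 = n) \<or>
        (i + 1 < j \<and> j = n \<and> r + 2 = n) \<or> (i + 2 < n \<and> j = n \<and> r = i + 1 \<and> s = i + 2))"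
      using G.connected_shape[OF ir] ncm by blast
    ultimately show ?thesis using sh unfolding shape_def by argo
  qed
  have v1: "vertices \<Delta>\<^sub>1 = {} \<longleftrightarrow> i = 1"
    using ij(1) unfolding assms(8) vertices_def by auto
  have cond2: "cond2 \<longleftrightarrow> i = 1 \<and> shape"
  proof
    assume cond2
    then consider "n > 4" "X i + X j = X 1 + X (n - 2)" "X r + X s = X (n - 2) + X (n - 1)"
      | "n > 3" "X i + X j = X 1 + X (n - 1)" "X r + X s = X (n - 2) + X n"
      unfolding cond2_def assms(4) v by blast
    then show "i = 1 \<and> shape"
    proof cases
      case 1
      then show ?thesis
        using X_add_eq[OF assms(5), of 1 "n - 2"] X_add_eq[OF rs(3), of "n - 2" "n - 1"]
        unfolding shape_def by linarith
    next
      case 2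
      then show ?thesis
        using X_add_eq[OF assms(5), of 1 "n - 1"] X_add_eq[OF rs(3), of "n - 2" n]
        unfolding shape_def by linarith
    qed
  next
    assume s: "i = 1 \<and> shape"
    then consider "j = n - 2" "r = n - 2" "s = n - 1" "n > 4" | "j = n - 1" "r = n - 2" "s = n" "n > 3"
      unfolding shape_def by linarith
    then show cond2 using s unfolding cond2_def assms(4) v by cases simp_all
  qed
  have c21: cond1 if "i = 1" shape
  proof -
    interpret double_star "{1..n}" "{1..<i}" "{i<..<j}" "{j..<n}" i n G.C by (rule star[OF that(2)])
    show ?thesis unfolding cond1_def \<Delta> by (rule disconnected_buchsbaum[OF disj]) (simp add: that)
  qed
  have c1: "i = 1 \<and> pure_complex \<Delta>\<^sub>2" if cond1
  proof -
    have p: "pure_complex \<Delta>\<^sub>2"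
      using that not_pure_imp_not_buchsbaum[OF finite_atLeastAtMost G.simplicial, where 'k = 'k] G.pure_cone
      unfolding cond1_def \<Delta> \<Delta>2 by blast
    interpret double_star "{1..n}" "{1..<i}" "{i<..<j}" "{j..<n}" i n G.C by (rule star[OF pure[OF p]])
    have "{1..<i} = {}"
      using that disconnected_cone_not_buchsbaum[OF disj, where 'k = 'k] unfolding cond1_def \<Delta> by blast
    then show ?thesis using p ij(1) by auto
  qed
  have disc: "\<not> connected_complex \<Delta>" if "i = 1" shape
  proof -
    interpret double_star "{1..n}" "{1..<i}" "{i<..<j}" "{j..<n}" i n G.C by (rule star[OF that(2)])
    show ?thesis unfolding \<Delta> by (rule disconnected[OF disj]) (simp add: that)
  qed
  have join: "\<Delta> = complex_join \<Delta>\<^sub>1 \<Delta>\<^sub>2"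
    unfolding \<Delta> \<Delta>2 assms(8) by (rule G.join_eq)
  have cond3: "cond3 \<longleftrightarrow> i = 1 \<and> pure_complex \<Delta>\<^sub>2" unfolding cond3_def v1 by simp
  show ?thesis using join cond2 cond3 c21 c1 pure disc by blast
qed

end
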